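(* Let $p\ge 5$ be a prime with $p\equiv -1\pmod 3$, let $r\ge 1$ be an integer, and put $q=p^r$. Let $\mathcal{C}$ be the curve over $\mathbb{F}_{q^6}$ given by \[ \mathcal{C}:\qquad y^3=x^{(q^2+1)/2}+x . \] Then $\mathcal{C}$ has genus \[ g=\frac{q^2-1}{2} \] and \[ \#\mathcal{C}(\mathbb{F}_{q^6})=q^6+1+(-1)^{r+1}(q^2-1)q^3 . \] Consequently, $\mathcal{C}$ is maximal over $\mathbb{F}_{q^6}$ if $r$ is odd, and minimal over $\mathbb{F}_{q^6}$ if $r$ is even.
   Context: The curve $\mathcal{C}$ given by the affine equation is understood as its smooth projective model over $\mathbb{F}_{q^6}$, i.e. the smooth projective curve with function field $\mathbb{F}_{q^6}(x,y)$, where $y^3=x^{(q^2+1)/2}+x$; the genus and the number $\#\mathcal{C}(\mathbb{F}_{q^6})$ of $\mathbb{F}_{q^6}$-rational points refer to this model. For a finite field $\mathbb{F}_Q$ with $Q$ a square, a smooth projective curve $\mathcal{X}/\mathbb{F}_Q$ of genus $g$ is called maximal over $\mathbb{F}_Q$ if $\#\mathcal{X}(\mathbb{F}_Q)=Q+1+2g\sqrt{Q}$, and minimal over $\mathbb{F}_Q$ if $\#\mathcal{X}(\mathbb{F}_Q)=Q+1-2g\sqrt{Q}$. *)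

theory Defs
  imports Complex_Main "HOL-Computational_Algebra.Computational_Algebra" "HOL-Number_Theory.Cong" "HOL-Library.Cardinality"
begin

text \<open>
  The smooth projective model of a curve over a field \<open>k\<close> is handled through its function field
  \<open>F\<close>: \<open>'k\<close> is the field of constants, \<open>'f\<close> the function field, and \<open>\<iota> :: 'k \<Rightarrow> 'f\<close> the inclusion.
  The closed points of the model are the valuation rings of \<open>F\<close> over \<open>k\<close>.
\<close>

definition field_embedding :: "('k::field \<Rightarrow> 'f::field) \<Rightarrow> bool" where
  "field_embedding \<iota> \<longleftrightarrow>
     \<iota> 1 = 1 \<and> (\<forall>a b. \<iota> (a + b) = \<iota> a + \<iota> b) \<and> (\<forall>a b. \<iota> (a * b) = \<iota> a * \<iota> b)"

definition transcendental_over :: "('k::field \<Rightarrow> 'f::field) \<Rightarrow> 'f \<Rightarrow> bool" where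
  "transcendental_over \<iota> x \<longleftrightarrow> (\<forall>g :: 'k poly. poly (map_poly \<iota> g) x = 0 \<longrightarrow> g = 0)"

definition is_subfield :: "'f::field set \<Rightarrow> bool" where
  "is_subfield S \<longleftrightarrow> 0 \<in> S \<and> 1 \<in> S \<and>
     (\<forall>a\<in>S. \<forall>b\<in>S. a + b \<in> S \<and> a * b \<in> S) \<and> (\<forall>a\<in>S. - a \<in> S \<and> inverse a \<in> S)"

definition adjoin :: "('k::field \<Rightarrow> 'f::field) \<Rightarrow> 'f set \<Rightarrow> 'f set" where
  "adjoin \<iota> A = \<Inter>{S. is_subfield S \<and> range \<iota> \<subseteq> S \<and> A \<subseteq> S}"

definition valuation_ring :: "('k::field \<Rightarrow> 'f::field) \<Rightarrow> 'f set \<Rightarrow> bool" where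
  "valuation_ring \<iota> R \<longleftrightarrow> range \<iota> \<subset> R \<and> R \<subset> UNIV \<and>
     (\<forall>a\<in>R. \<forall>b\<in>R. a + b \<in> R \<and> a * b \<in> R) \<and> (\<forall>a. a \<in> R \<or> inverse a \<in> R)"

definition places :: "('k::field \<Rightarrow> 'f::field) \<Rightarrow> 'f set set" where
  "places \<iota> = {R. valuation_ring \<iota> R}"

definition max_ideal :: "'f::field set \<Rightarrow> 'f set" where
  "max_ideal R = {z \<in> R. z = 0 \<or> inverse z \<notin> R}"

text \<open>The normalized discrete valuation of \<open>R\<close> on \<open>z \<noteq> 0\<close>: write \<open>z = t\<^sup>n u\<close> with \<open>t\<close> a generator of the
  maximal ideal and \<open>u\<close> a unit.\<close>

definition place_ord :: "'f::field set \<Rightarrow> 'f \<Rightarrow> int" where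
  "place_ord R z = (THE n. \<exists>t u. max_ideal R = (\<lambda>a. t * a) ` R \<and>
     u \<in> R - max_ideal R \<and> z = t powi n * u)"

text \<open>\<open>B\<close> represents a basis of the residue field \<open>R / max_ideal R\<close> as a vector space over \<open>k\<close>.\<close>

definition residue_basis :: "('k::field \<Rightarrow> 'f::field) \<Rightarrow> 'f set \<Rightarrow> 'f set \<Rightarrow> bool" where
  "residue_basis \<iota> R B \<longleftrightarrow> finite B \<and> B \<subseteq> R \<and>
     (\<forall>z\<in>R. \<exists>c. z - (\<Sum>b\<in>B. \<iota> (c b) * b) \<in> max_ideal R) \<and>
     (\<forall>c. (\<Sum>b\<in>B. \<iota> (c b) * b) \<in> max_ideal R \<longrightarrow> (\<forall>b\<in>B. c b = 0))"

definition place_degree :: "('k::field \<Rightarrow> 'f::field) \<Rightarrow> 'f set \<Rightarrow> nat" where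
  "place_degree \<iota> R = (THE n. \<exists>B. residue_basis \<iota> R B \<and> card B = n)"

text \<open>The \<open>k\<close>-rational points are the closed points with residue field \<open>k\<close>.\<close>

definition num_rational_points :: "('k::field \<Rightarrow> 'f::field) \<Rightarrow> nat" where
  "num_rational_points \<iota> = card {R \<in> places \<iota>. place_degree \<iota> R = 1}"

definition divisors :: "('k::field \<Rightarrow> 'f::field) \<Rightarrow> ('f set \<Rightarrow> int) set" where
  "divisors \<iota> = {D. finite {R. D R \<noteq> 0} \<and> {R. D R \<noteq> 0} \<subseteq> places \<iota>}"

definition divisor_degree :: "('k::field \<Rightarrow> 'f::field) \<Rightarrow> ('f set \<Rightarrow> int) \<Rightarrow> int" where
  "divisor_degree \<iota> D = (\<Sum>R | D R \<noteq> 0. D R * int (place_degree \<iota> R))"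

definition riemann_roch_space :: "('k::field \<Rightarrow> 'f::field) \<Rightarrow> ('f set \<Rightarrow> int) \<Rightarrow> 'f set" where
  "riemann_roch_space \<iota> D = {z. z \<noteq> 0 \<longrightarrow> (\<forall>R\<in>places \<iota>. place_ord R z + D R \<ge> 0)}"

definition riemann_roch_dim :: "('k::field \<Rightarrow> 'f::field) \<Rightarrow> ('f set \<Rightarrow> int) \<Rightarrow> nat" where
  "riemann_roch_dim \<iota> D = vector_space.dim (\<lambda>a z. \<iota> a * z) (riemann_roch_space \<iota> D)"

text \<open>The genus is the maximum of \<open>deg D - l(D) + 1\<close> over all divisors \<open>D\<close> (Riemann's theorem).\<close>

definition genus :: "('k::field \<Rightarrow> 'f::field) \<Rightarrow> int" where
  "genus \<iota> = (GREATEST g. \<exists>D\<in>divisors \<iota>.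
     g = divisor_degree \<iota> D - int (riemann_roch_dim \<iota> D) + 1)"

definition maximal_curve :: "('k::field \<Rightarrow> 'f::field) \<Rightarrow> bool" where
  "maximal_curve \<iota> \<longleftrightarrow> finite (UNIV :: 'k set) \<and> (\<exists>s. CARD('k) = s\<^sup>2) \<and>
     real (num_rational_points \<iota>) =
       real CARD('k) + 1 + 2 * real_of_int (genus \<iota>) * sqrt (real CARD('k))"

definition minimal_curve :: "('k::field \<Rightarrow> 'f::field) \<Rightarrow> bool" where
  "minimal_curve \<iota> \<longleftrightarrow> finite (UNIV :: 'k set) \<and> (\<exists>s. CARD('k) = s\<^sup>2) \<and>
     real (num_rational_points \<iota>) =
       real CARD('k) + 1 - 2 * real_of_int (genus \<iota>) * sqrt (real CARD('k))"

text \<open>The curve \<open>y\<^sup>3 = x ^ ((q\<^sup>2 + 1) / 2) + x\<close>, presented by its function field \<open>k(x, y)\<close>, in which the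
  coordinate function \<open>x\<close> is transcendental over \<open>k\<close>. These conditions determine \<open>(\<iota>, x, y)\<close> up to
  isomorphism, because \<open>Y\<^sup>3 - X ^ ((q\<^sup>2 + 1) / 2) - X\<close> is irreducible over \<open>k(X)\<close> (Eisenstein at \<open>X\<close>).
  The division by 2 is exact for odd \<open>q\<close>.\<close>

definition curve_C :: "nat \<Rightarrow> ('k::field \<Rightarrow> 'f::field) \<Rightarrow> 'f \<Rightarrow> 'f \<Rightarrow> bool" where
  "curve_C q \<iota> x y \<longleftrightarrow> field_embedding \<iota> \<and> transcendental_over \<iota> x \<and>
     y ^ 3 = x ^ ((q\<^sup>2 + 1) div 2) + x \<and> adjoin \<iota> {x, y} = UNIV"

end

(*
  Point count.  Let chi be a cubic character of F_Q, Q = q^6.  The substitutions x = w^-2 and x = nu w^-2 (nu a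
  suitable non-square) turn the affine equation into y^3 = w^(q^2) + w, whose right-hand side permutes F_Q, and
  y^3 = w^(q^2) - w.  Additive characters reduce the count for the latter to the sum over y of psi(y^3).  As 3
  divides p + 1, this sum is an average of the sums E(a) of psi(a y^(p+1)), which belong to quadratic forms that
  are Hermitian over F_(p^2): E(a)^2 is computed by completing the square, and the sign of E(a) follows from a
  congruence modulo p + 1.

  Genus.  Write m = (q^2 + 1)/2.  The ring O = k[x] + k[x] y + k[x] y^2 is the ring of functions that are regular at
  all places with x regular, the other place being totally ramified with pole orders 3 and m for x and y.  The
  elements of O with pole order at most N >= 2m form a space of dimension N + 1 - (m - 1), which yields the value
  m - 1 of deg D - l(D) + 1 for D = N * infinity.  For an arbitrary divisor D, multiplication by an h in O moves
  all poles to infinity; comparing dimensions gives deg D - l(D) + 1 <= m - 1, because the zeros of h have total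
  degree at most its pole order at infinity.  Since k is finite, all dimensions are computed by counting elements.
*)

theory Submission
  imports Defs
begin

section \<open>Power residues and additive characters of a finite field\<close>

text \<open>Places are arbitrary valuation rings of the function field, so discreteness, finite
  residue fields and the list of places all have to be proved. One count does most of this: with Q
  the size of k and \<open>d h\<close> the pole order of h at infinity, O contains at most Q^(d h)
  elements that are pairwise incongruent modulo h O. It bounds the powers of a uniformizer that
  divide h, makes residue rings finite, provides maximal ideals, and bounds the total degree of the
  zeros of h. Local uniformizers come from smoothness: at every nonzero prime of O one of the
  partial derivatives 3 y^2 and m x^(m-1) + 1 is a unit. Here 2 m = q^2 + 1 is 1 in the field, which
  keeps X^m + X separable. In the point count, (-1)^r enters as the sign of (-p)^(3 r), and q^2 - 1
  counts the nonzero elements of the subfield of order q^2: only these frequencies survive besides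
  0, and all of them are cubes in F_Q, so each contributes the same cubic sum.\<close>

lemma power_card_minus_1:
  fixes x :: "'k::field"
  assumes fin: "finite (UNIV :: 'k set)" and "x \<noteq> 0"
  shows "x ^ (CARD('k) - 1) = 1"
proof -
  let ?A = "UNIV - {0::'k}"
  have bij: "bij_betw ((*) x) ?A ?A"
    by (rule bij_betwI[where g = "(*) (inverse x)"]) (use assms in auto)
  have "\<Prod>?A = (\<Prod>z\<in>?A. x * z)"
    using prod.reindex_bij_betw[OF bij, of id] by simp
  also have "\<dots> = x ^ card ?A * \<Prod>?A"
    by (simp add: prod.distrib)
  finally have "x ^ card ?A = 1"
    using fin by (simp add: prod_zero_iff)
  then show ?thesis
    using fin by (simp add: card_Diff_subset)
qed

lemma power_card:
  fixes x :: "'k::field"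
  assumes fin: "finite (UNIV :: 'k set)"
  shows "x ^ CARD('k) = x"
proof (cases "x = 0")
  case False
  have "CARD('k) > 0" using fin by (simp add: card_gt_0_iff)
  then have "x ^ CARD('k) = x ^ (CARD('k) - 1) * x"
    by (metis Suc_diff_1 power_Suc2)
  then show ?thesis using power_card_minus_1[OF fin False] by simp
next
  case True
  have "CARD('k) > 0" using fin by (simp add: card_gt_0_iff)
  then show ?thesis using True by simp
qed

lemma card_field_ge_2:
  assumes fin: "finite (UNIV :: 'k::field set)"
  shows "CARD('k) \<ge> 2"
proof -
  have "card {0::'k, 1} \<le> CARD('k)" using fin by (intro card_mono) auto
  then show ?thesis by simp
qed

text \<open>With N = CARD('k) - 1 = d e, the N nonzero elements are roots of the product of X^d - 1
  and \<open>?G\<close> = 1 + X^d + ... + X^(d (e - 1)). The second factor has at most N - d roots,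
  which leaves at least d for the first.\<close>

lemma card_roots_of_unity_field:
  assumes fin: "finite (UNIV :: 'k::field set)" and d: "d dvd CARD('k) - 1"
  shows "card {z::'k. z ^ d = 1} = d"
proof -
  let ?N = "CARD('k) - 1"
  obtain e where e: "?N = d * e" using d by blast
  have N0: "?N > 0" using card_field_ge_2[OF fin] by simp
  then have d0: "d > 0" and e0: "e > 0" using e by (auto intro: Nat.gr0I)
  let ?P = "monom (1::'k) d - 1"
  let ?G = "\<Sum>i<e. monom (1::'k) (d * i)"
  have degP: "degree ?P = d"
    using degree_add_eq_left[of "-1" "monom (1::'k) d"] d0 by (simp add: degree_monom_eq)
  have P0: "?P \<noteq> 0" using degP d0 by auto
  have cG: "poly ?G 0 = 1"
    using e0 d0 by (simp add: poly_sum poly_monom power_0_left sum.delta lessThan_Suc_eq_insert_0)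
  then have G0: "?G \<noteq> 0" by auto
  have degG: "degree ?G \<le> ?N - d"
  proof (rule degree_sum_le)
    fix i assume "i \<in> {..<e}"
    then have "d * (i + 1) \<le> d * e" by (intro mult_le_mono) auto
    then show "degree (monom (1::'k) (d * i)) \<le> ?N - d"
      using e by (simp add: degree_monom_eq algebra_simps)
  qed simp
  have "UNIV - {0} \<subseteq> {z. poly ?P z = 0} \<union> {z. poly ?G z = 0}"
  proof
    fix z :: 'k assume "z \<in> UNIV - {0}"
    then have "z ^ ?N = 1" using power_card_minus_1[OF fin] by simp
    then have "(z ^ d) ^ e - 1 = 0" by (simp only: e power_mult) simp
    then have "(z ^ d - 1) * (\<Sum>i<e. (z ^ d) ^ i) = 0"
      by (simp add: power_diff_1_eq)
    then show "z \<in> {z. poly ?P z = 0} \<union> {z. poly ?G z = 0}"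
      by (simp add: poly_monom poly_sum power_mult)
  qed
  then have "card (UNIV - {0::'k}) \<le> card ({z. poly ?P z = 0} \<union> {z. poly ?G z = 0})"
    using fin by (intro card_mono) (auto intro: finite_subset)
  also have "\<dots> \<le> card {z. poly ?P z = 0} + card {z. poly ?G z = 0}"
    by (rule card_Un_le)
  also have "card {z. poly ?G z = 0} \<le> ?N - d"
    using card_poly_roots_bound[OF G0] degG by linarith
  finally have "?N \<le> card {z. poly ?P z = 0} + (?N - d)"
    using fin by (simp add: card_Diff_subset)
  moreover have "d \<le> ?N" using d N0 by (rule dvd_imp_le)
  ultimately have "d \<le> card {z. poly ?P z = 0}" by linarith
  moreover have "card {z. poly ?P z = 0} \<le> d"
    using card_poly_roots_bound[OF P0] degP by simp
  ultimately show ?thesis by (simp add: poly_monom)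
qed

lemma card_power_eq_power:
  fixes w :: "'k::field"
  assumes fin: "finite (UNIV :: 'k set)" and e: "e dvd CARD('k) - 1" and "w \<noteq> 0"
  shows "card {z. z ^ e = w ^ e} = e"
proof -
  have "bij_betw ((*) w) {z::'k. z ^ e = 1} {z. z ^ e = w ^ e}"
    by (rule bij_betwI[where g = "\<lambda>z. z / w"]) (use assms in \<open>auto simp: power_mult_distrib power_divide\<close>)
  then have "card {z::'k. z ^ e = 1} = card {z. z ^ e = w ^ e}" by (rule bij_betw_same_card)
  then show ?thesis using card_roots_of_unity_field[OF fin e] by simp
qed

text \<open>The map w -> w^e is e-to-one on the e M nonzero elements, so its image has M elements.
  The image consists of solutions of z^M = 1, of which there are only M, hence it is all of
  them.\<close>

lemma card_power_eq:
  fixes c :: "'k::field"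
  assumes fin: "finite (UNIV :: 'k set)" and N: "CARD('k) - 1 = e * M" and c: "c \<noteq> 0"
  shows "card {w. w ^ e = c} = (if c ^ M = 1 then e else 0)"
proof -
  have N0: "e * M > 0" using card_field_ge_2[OF fin] N by linarith
  then have e0: "e > 0" and M0: "M > 0" by (auto intro!: Nat.gr0I)
  have ed: "e dvd CARD('k) - 1" using N by simp
  have Md: "M dvd CARD('k) - 1" using N by simp
  define P where "P = (\<lambda>w::'k. w ^ e) ` (UNIV - {0})"
  have fP: "finite P" unfolding P_def using fin by (auto intro: finite_subset)
  have PM: "P \<subseteq> {z. z ^ M = 1}"
    unfolding P_def using power_card_minus_1[OF fin] N by (auto simp flip: power_mult)
  have "card (UNIV - {0::'k}) = (\<Sum>b\<in>P. card {w \<in> UNIV - {0}. w ^ e = b})"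
    using sum.image_gen[of "UNIV - {0::'k}" "\<lambda>_. 1::nat" "\<lambda>w. w ^ e"] fin by (simp add: P_def)
  also have "\<dots> = (\<Sum>b\<in>P. e)"
  proof (rule sum.cong)
    fix b assume "b \<in> P"
    then obtain w where w: "w \<noteq> 0" "b = w ^ e" unfolding P_def by auto
    have "{z \<in> UNIV - {0}. z ^ e = b} = {z. z ^ e = w ^ e}" using w e0 by (auto simp: power_0_left)
    then show "card {z \<in> UNIV - {0}. z ^ e = b} = e" using card_power_eq_power[OF fin ed w(1)] by simp
  qed simp
  also have "card (UNIV - {0::'k}) = e * M"
    using fin N by (simp add: card_Diff_subset)
  finally have "e * M = card P * e" by simp
  then have "card P = M" using e0 by simp
  then have PE: "P = {z. z ^ M = 1}"
    using card_roots_of_unity_field[OF fin Md] PM fin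
    by (metis (no_types, lifting) card_subset_eq finite_subset subset_UNIV)
  show ?thesis
  proof (cases "c ^ M = 1")
    case True
    then have "c \<in> P" using PE by simp
    then obtain w where "w \<noteq> 0" "c = w ^ e" unfolding P_def by auto
    then show ?thesis using card_power_eq_power[OF fin ed] True by simp
  next
    case False
    have "{w. w ^ e = c} = {}"
    proof (rule ccontr)
      assume "{w. w ^ e = c} \<noteq> {}"
      then obtain w where w: "w ^ e = c" by auto
      with c e0 have "w \<noteq> 0" by (auto simp: power_0_left)
      then have "c \<in> P" using w unfolding P_def by auto
      then show False using PE False by simp
    qed
    then show ?thesis using False by simp
  qed
qed

lemma ex_power_eq:
  fixes c :: "'k::field"
  assumes fin: "finite (UNIV :: 'k set)" and N: "CARD('k) - 1 = e * M" and c: "c ^ M = 1"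
  shows "\<exists>w. w ^ e = c"
proof -
  have N0: "e * M > 0" using card_field_ge_2[OF fin] N by linarith
  then have c0: "c \<noteq> 0" using c by (auto simp: power_0_left)
  have "card {w. w ^ e = c} > 0" using card_power_eq[OF fin N c0] c N0 by simp
  then show ?thesis by (auto simp: card_gt_0_iff)
qed

lemma card_power_eq_minus_1:
  assumes fin: "finite (UNIV :: 'k::field set)" and d: "2 * d dvd CARD('k) - 1"
    and two: "(2::'k) \<noteq> 0"
  shows "card {z::'k. z ^ d = - 1} = d"
proof -
  have "d dvd CARD('k) - 1" using d by (metis dvd_mult_right)
  moreover have "card {z::'k. z ^ (2 * d) = 1} = card {z::'k. z ^ d = 1} + card {z::'k. z ^ d = - 1}"
  proof -
    have "{z::'k. z ^ (2 * d) = 1} = {z. z ^ d = 1} \<union> {z. z ^ d = - 1}"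
      by (auto simp: mult.commute[of 2] power_mult power2_eq_1_iff)
    moreover have "{z::'k. z ^ d = 1} \<inter> {z. z ^ d = - 1} = {}"
      using two by (auto simp: eq_neg_iff_add_eq_0)
    ultimately show ?thesis using fin by (simp add: card_Un_disjoint finite_subset[OF subset_UNIV])
  qed
  ultimately show ?thesis using card_roots_of_unity_field[OF fin] d by simp
qed

text \<open>The shift z -> z + 1 leaves the sum of all elements unchanged, so CARD('k) is 0 in the
  field and the characteristic divides a power of p.\<close>

lemma CHAR_eq_of_card_power:
  assumes p: "prime p" and card: "CARD('k::field) = p ^ n"
  shows "CHAR('k) = p"
proof -
  have fin: "finite (UNIV :: 'k set)"
    using card p by (metis card.infinite power_eq_0_iff not_prime_0)
  have pr: "prime CHAR('k)"
    using prime_CHAR_semidom[where 'a = 'k] finite_imp_CHAR_pos[OF fin] by blast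
  have bij: "bij_betw (\<lambda>z::'k. z + 1) UNIV UNIV"
    by (rule bij_betwI[where g = "\<lambda>z. z - 1"]) auto
  have "\<Sum>(UNIV::'k set) = (\<Sum>z\<in>UNIV. z + 1)"
    using sum.reindex_bij_betw[OF bij, of id] by simp
  also have "\<dots> = \<Sum>(UNIV::'k set) + of_nat CARD('k)"
    by (simp add: sum.distrib)
  finally have "of_nat (p ^ n) = (0::'k)" using card by simp
  then have "CHAR('k) dvd p ^ n" by (simp only: of_nat_eq_0_iff_char_dvd)
  then have "CHAR('k) dvd p" using pr prime_dvd_power by blast
  then show ?thesis using pr p by (metis prime_nat_iff not_prime_1)
qed

text \<open>The character is z -> exp (2 pi i Tr z / p), where Tr is the absolute trace
  \<open>t\<close>. It is nontrivial because the trace is a nonzero polynomial of degree at most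
  p^(n - 1), too small to vanish on the whole field.\<close>

lemma additive_character_exists:
  assumes p: "prime p" and card: "CARD('k::field) = p ^ n" and n: "n > 0"
  shows "\<exists>\<psi> :: 'k \<Rightarrow> complex. (\<forall>a b. \<psi> (a + b) = \<psi> a * \<psi> b) \<and> (\<forall>a. \<psi> (a ^ p) = \<psi> a)
    \<and> (\<forall>a. \<psi> a ^ p = 1) \<and> (\<exists>a. \<psi> a \<noteq> 1)"
proof -
  have fin: "finite (UNIV :: 'k set)"
    using card p by (metis card.infinite power_eq_0_iff not_prime_0)
  have ch: "CHAR('k) = p" by (rule CHAR_eq_of_card_power[OF p card])
  have p0: "p > 0" using p by (simp add: prime_gt_0_nat)
  have p1: "p > 1" using p by (rule prime_gt_1_nat)
  define t where "t = (\<lambda>z::'k. \<Sum>i<n. z ^ (p ^ i))"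
  have tadd: "t (a + b) = t a + t b" for a b
    unfolding t_def using freshmans_dream'[where 'a = 'k] p ch by (simp add: sum.distrib)
  have t_shift: "t (z ^ p) = t z" for z
  proof -
    have "t (z ^ p) = (\<Sum>i<n. z ^ (p ^ Suc i))" unfolding t_def by (simp flip: power_mult)
    moreover have "(\<Sum>i<Suc n. z ^ (p ^ i)) = z ^ (p ^ 0) + (\<Sum>i<n. z ^ (p ^ Suc i))"
      by (rule sum.lessThan_Suc_shift)
    moreover have "(\<Sum>i<Suc n. z ^ (p ^ i)) = t z + z" unfolding t_def
      using power_card[OF fin, of z] card by simp
    ultimately show ?thesis by simp
  qed
  have t_pow: "t z ^ p = t (z ^ p)" for z
    unfolding t_def using p ch
    by (subst freshmans_dream_sum) (auto simp flip: power_mult simp: mult.commute)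
  \<comment> \<open>X^p - X has at most p roots, and the images of 0, ..., p - 1 already are p of
    them. This places the trace, which is its own p-th power, in the prime field.\<close>
  have prime_field: "of_nat ` {..<p} = {z::'k. z ^ p = z}"
  proof -
    have inj: "inj_on (of_nat :: nat \<Rightarrow> 'k) {..<p}"
      by (auto simp: inj_on_def of_nat_eq_iff_cong_CHAR ch cong_def)
    have ofp: "(of_nat j :: 'k) ^ p = of_nat j" for j
      by (induction j) (use p ch p0 freshmans_dream[where 'a = 'k] in \<open>auto simp: power_0_left\<close>)
    let ?P = "monom (1::'k) p - monom 1 1"
    have "degree ?P = p" using degree_add_eq_left[of "- monom (1::'k) 1" "monom 1 p"] p1 by (simp add: degree_monom_eq)
    then have "?P \<noteq> 0" using p0 by auto
    then have "card {z. poly ?P z = 0} \<le> p" "finite {z. poly ?P z = 0}"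
      using card_poly_roots_bound[of ?P] \<open>degree ?P = p\<close> poly_roots_finite[of ?P] by auto
    moreover have "{z. poly ?P z = 0} = {z. z ^ p = z}" by (simp add: poly_monom)
    ultimately have "card {z::'k. z ^ p = z} \<le> p" "finite {z::'k. z ^ p = z}" by auto
    moreover have "card (of_nat ` {..<p} :: 'k set) = p" using inj by (simp add: card_image)
    ultimately show ?thesis using ofp by (intro card_seteq) auto
  qed
  have "\<exists>j<p. of_nat j = t z" for z
    using prime_field t_pow[of z] t_shift[of z] by (metis (mono_tags, lifting) imageE lessThan_iff mem_Collect_eq)
  then obtain e where e: "\<And>z. e z < p" "\<And>z. of_nat (e z) = t z" by metis
  define \<omega> where "\<omega> = (\<lambda>j::nat. cis (2 * pi * real j / real p))"
  have om: "\<omega> j = cis (2 * pi / real p) ^ j" for j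
    unfolding \<omega>_def by (simp add: DeMoivre mult_ac)
  have omp: "cis (2 * pi / real p) ^ p = 1" using p0 by (simp add: DeMoivre)
  have om_cong: "\<omega> i = \<omega> j" if "[i = j] (mod p)" for i j
  proof -
    have "\<omega> i = \<omega> (i mod p)" for i
      unfolding om using omp by (metis (no_types, lifting) mod_mult_div_eq mult.right_neutral power_add power_mult power_one)
    then show ?thesis using that unfolding cong_def by metis
  qed
  define \<psi> where "\<psi> = (\<lambda>z. \<omega> (e z))"
  have "\<psi> (a + b) = \<psi> a * \<psi> b" for a b
  proof -
    have "(of_nat (e (a + b)) :: 'k) = of_nat (e a + e b)" using e(2) tadd by simp
    then have "[e (a + b) = e a + e b] (mod p)" by (simp only: of_nat_eq_iff_cong_CHAR ch)
    then have "\<omega> (e (a + b)) = \<omega> (e a + e b)" by (rule om_cong)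
    then show ?thesis unfolding \<psi>_def om by (simp add: power_add)
  qed
  moreover have "\<psi> (a ^ p) = \<psi> a" for a
  proof -
    have "(of_nat (e (a ^ p)) :: 'k) = of_nat (e a)" using e(2) t_shift by simp
    then have "[e (a ^ p) = e a] (mod p)" by (simp only: of_nat_eq_iff_cong_CHAR ch)
    then show ?thesis unfolding \<psi>_def by (rule om_cong)
  qed
  moreover have "\<psi> a ^ p = 1" for a
    unfolding \<psi>_def om using omp by (metis mult.commute power_mult power_one)
  moreover have "\<exists>a. \<psi> a \<noteq> 1"
  proof -
    let ?P = "\<Sum>i<n. monom (1::'k) (p ^ i)"
    have c1: "coeff ?P 1 = 1"
    proof -
      have "coeff ?P 1 = (\<Sum>i<n. if i = 0 then 1 else 0)"
        unfolding coeff_sum by (intro sum.cong) (use p1 in \<open>auto\<close>)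
      then show ?thesis using n by simp
    qed
    then have P0: "?P \<noteq> 0" by auto
    have "degree ?P \<le> p ^ (n - 1)"
      by (rule degree_sum_le) (use p1 in \<open>auto simp: degree_monom_eq intro!: power_increasing\<close>)
    also have "\<dots> < p ^ n" using p1 n by simp
    finally have "card {z. poly ?P z = 0} < CARD('k)"
      using card_poly_roots_bound[OF P0] card by simp
    then have "{z. poly ?P z = 0} \<noteq> UNIV" by (metis less_irrefl)
    then obtain z where "poly ?P z \<noteq> 0" by auto
    then have "t z \<noteq> 0" unfolding t_def by (simp add: poly_sum poly_monom)
    then have "e z \<noteq> 0" using e(2)[of z] by (metis of_nat_0)
    moreover have "inj_on \<omega> {..<p}"
      unfolding \<omega>_def using bij_betw_roots_unity[OF p0] by (rule bij_betw_imp_inj_on)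
    ultimately have "\<omega> (e z) \<noteq> \<omega> 0"
      using e(1)[of z] p0 by (simp add: inj_on_eq_iff)
    then show ?thesis unfolding \<psi>_def \<omega>_def by auto
  qed
  ultimately show ?thesis by blast
qed

section \<open>Cubic exponential sums\<close>

text \<open>\<open>psi_frob\<close> is what remains of the trace: under \<psi> any argument may be
  replaced by its p-th power, which is how terms w^p z are turned into multiples of z^p.\<close>

locale field_char_sums =
  fixes p r :: nat and \<psi> :: "'k::field \<Rightarrow> complex"
  assumes p: "prime p" and p5: "p \<ge> 5" and p3: "p mod 3 = 2" and r: "r \<ge> 1"
    and card: "CARD('k) = p ^ (6 * r)"
    and psi_add: "\<And>a b. \<psi> (a + b) = \<psi> a * \<psi> b"
    and psi_frob: "\<And>a. \<psi> (a ^ p) = \<psi> a"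
    and psi_pow: "\<And>a. \<psi> a ^ p = 1"
    and psi_nontriv: "\<exists>a. \<psi> a \<noteq> 1"
begin

lemma p0: "p > 0" using p5 by simp
lemma p1: "p > 1" using p5 by simp

lemma odd_p: "odd p"
  using p p5 prime_odd_nat[of p] by linarith

lemma fin: "finite (UNIV :: 'k set)"
  using card p0 by (metis card.infinite power_eq_0_iff not_gr_zero)

lemma char: "CHAR('k) = p" by (rule CHAR_eq_of_card_power[OF p card])

lemma frob_add: "(a + b :: 'k) ^ (p ^ i) = a ^ (p ^ i) + b ^ (p ^ i)"
  using freshmans_dream'[where 'a = 'k] p char by simp

lemma frob_add1: "(a + b :: 'k) ^ p = a ^ p + b ^ p"
  using frob_add[of a b 1] by simp

lemma two_neq_0: "(2::'k) \<noteq> 0"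
proof
  assume "(2::'k) = 0"
  then have "of_nat 2 = (0::'k)" by simp
  then have "p dvd 2" by (simp only: of_nat_eq_0_iff_char_dvd char)
  then show False using p5 by (auto dest: dvd_imp_le)
qed

lemma frob_diff: "(a - b :: 'k) ^ (p ^ i) = a ^ (p ^ i) - b ^ (p ^ i)"
  using frob_add[of "a - b" b i] by (simp add: algebra_simps)

lemma frob_bij: "bij (\<lambda>z::'k. z ^ (p ^ i))"
proof -
  have "inj (\<lambda>z::'k. z ^ (p ^ i))"
  proof (rule injI)
    fix a b :: 'k assume "a ^ (p ^ i) = b ^ (p ^ i)"
    then have "(a - b) ^ (p ^ i) = 0" by (simp add: frob_diff)
    then show "a = b" by simp
  qed
  then show ?thesis using fin by (simp add: bij_def finite_UNIV_inj_surj)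
qed

lemma psi_0 [simp]: "\<psi> 0 = 1"
proof -
  have "\<psi> 0 = \<psi> 0 * \<psi> 0" using psi_add[of 0 0] by simp
  moreover have "\<psi> 0 \<noteq> 0" using psi_pow[of 0] p0 by (auto simp: power_0_left)
  ultimately show ?thesis by simp
qed

lemma psi_norm: "norm (\<psi> a) = 1"
proof -
  have "norm (\<psi> a) ^ p = 1" using psi_pow[of a] by (metis norm_power norm_one)
  then show ?thesis using p0 by (metis norm_ge_zero power_eq_iff_eq_base power_one zero_le_one)
qed

lemma psi_neg: "\<psi> (- a) = cnj (\<psi> a)"
proof -
  have "\<psi> a * \<psi> (- a) = 1" using psi_add[of a "- a"] by simp
  moreover have "\<psi> a * cnj (\<psi> a) = 1" using psi_norm[of a] by (simp add: complex_norm_square[symmetric])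
  moreover have "\<psi> a \<noteq> 0" using psi_norm[of a] by auto
  ultimately show ?thesis by (metis mult_left_cancel)
qed

lemma psi_of_nat: "\<psi> (of_nat j * a) = \<psi> a ^ j"
  by (induction j) (auto simp: algebra_simps psi_add)

lemma psi_frob': "\<psi> (a ^ (p ^ i)) = \<psi> a"
proof (induction i)
  case (Suc i)
  have "a ^ (p ^ Suc i) = (a ^ (p ^ i)) ^ p" by (simp flip: power_mult add: mult.commute)
  then show ?case using Suc psi_frob by simp
qed simp

lemma sum_psi: "(\<Sum>z\<in>UNIV. \<psi> (b * z)) = (if b = 0 then of_nat (p ^ (6 * r)) else 0)"
proof (cases "b = 0")
  case True
  then show ?thesis using card by simp
next
  case False
  obtain a where a: "\<psi> a \<noteq> 1" using psi_nontriv by blast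
  have bij: "bij_betw (\<lambda>z. z + a / b) UNIV (UNIV::'k set)"
    by (rule bij_betwI[where g = "\<lambda>z. z - a / b"]) auto
  have "(\<Sum>z\<in>UNIV. \<psi> (b * z)) = (\<Sum>z\<in>UNIV. \<psi> (b * (z + a / b)))"
    using sum.reindex_bij_betw[OF bij, of "\<lambda>z. \<psi> (b * z)"] by simp
  also have "\<dots> = (\<Sum>z\<in>UNIV. \<psi> (b * z)) * \<psi> a"
    using False by (simp add: distrib_left psi_add sum_distrib_right)
  finally show ?thesis using a False by (metis mult_cancel_left2)
qed

section \<open>The quadratic sums of \<psi>(a y^(p+1)) and their signs\<close>

definition E :: "'k \<Rightarrow> complex" where "E a = (\<Sum>y\<in>UNIV. \<psi> (a * y ^ (p + 1)))"

text \<open>\<open>M = (p\<^sup>6\<^sup>r - 1) / (p\<^sup>2 - 1)\<close>\<close>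

definition M :: nat where "M = (\<Sum>i<3 * r. (p ^ 2) ^ i)"

lemma card_M: "p ^ (6 * r) - 1 = (p ^ 2 - 1) * M"
proof -
  have "(p ^ 2 - 1) * (\<Sum>i<n. (p ^ 2) ^ i) = (p ^ 2) ^ n - 1" for n :: nat
  proof (induction n)
    case (Suc n)
    have "(p ^ 2) ^ n \<ge> 1" "p ^ 2 \<ge> 1" using p0 by simp_all
    then show ?case using Suc by (simp add: algebra_simps diff_mult_distrib)
  qed simp
  from this[of "3 * r"] show ?thesis unfolding M_def by (simp flip: power_mult)
qed

lemma card_M': "p ^ (6 * r) - 1 = (p + 1) * ((p - 1) * M)"
proof -
  have "p ^ 2 - 1 = (p + 1) * (p - 1)" using p0 by (cases p) (auto simp: power2_eq_square)
  then show ?thesis using card_M by (metis mult.assoc)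
qed

lemma even_M: "even M \<longleftrightarrow> even r"
proof -
  have "even (\<Sum>i<n. (p ^ 2) ^ i) \<longleftrightarrow> even n" for n :: nat
    by (induction n) (use odd_p in auto)
  from this[of "3 * r"] show ?thesis unfolding M_def by simp
qed

text \<open>Nonzero elements of the prime field are (p + 1)-th powers: j^(p - 1) = 1 gives j = l^(p
  + 1) for some l, which is absorbed by the substitution y -> l y.\<close>

lemma E_scale:
  assumes "0 < j" "j < p"
  shows "E (of_nat j * a) = E a"
proof -
  have c0: "(of_nat j :: 'k) \<noteq> 0"
    using assms by (auto simp: of_nat_eq_0_iff_char_dvd char dest: dvd_imp_le)
  have "(of_nat j :: 'k) ^ p = of_nat j"
    by (induction j) (use p0 frob_add1 in \<open>auto simp: power_0_left\<close>)
  then have "(of_nat j :: 'k) * of_nat j ^ (p - 1) = of_nat j * 1"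
    using p0 by (metis Suc_diff_1 mult.right_neutral power_Suc)
  then have "(of_nat j :: 'k) ^ (p - 1) = 1" using c0 by (metis mult_left_cancel)
  then have "(of_nat j :: 'k) ^ ((p - 1) * M) = 1" by (simp add: power_mult)
  then obtain l :: 'k where l: "l ^ (p + 1) = of_nat j"
    using ex_power_eq[OF fin, of "p + 1" "(p - 1) * M" "of_nat j"] card card_M' by auto
  then have l0: "l \<noteq> 0" using c0 by auto
  have bij: "bij_betw (\<lambda>y. l * y) UNIV (UNIV::'k set)"
    by (rule bij_betwI[where g = "\<lambda>z. z / l"]) (use l0 in auto)
  have "E a = (\<Sum>y\<in>UNIV. \<psi> (a * (l * y) ^ (p + 1)))"
    unfolding E_def using sum.reindex_bij_betw[OF bij, of "\<lambda>y. \<psi> (a * y ^ (p + 1))"] by simp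
  also have "\<dots> = E (of_nat j * a)"
    unfolding E_def by (simp only: power_mult_distrib l) (simp add: mult_ac)
  finally show ?thesis by simp
qed

text \<open>Sum E(j a) over all j < p. The geometric sum over j detects \<psi> = 1, while by
  \<open>E_scale\<close> every term with j nonzero equals E(a), and the term j = 0 is the size of
  the field.\<close>

lemma E_count:
  "of_nat (p - 1) * E a = of_nat p * of_nat (card {y. \<psi> (a * y ^ (p + 1)) = 1}) - of_nat (p ^ (6 * r))"
proof -
  have geo: "(\<Sum>j<p. \<psi> z ^ j) = (if \<psi> z = 1 then of_nat p else 0)" for z
    using psi_pow[of z] by (simp add: geometric_sum)
  have "(\<Sum>j<p. E (of_nat j * a)) = (\<Sum>y\<in>UNIV. \<Sum>j<p. \<psi> (of_nat j * (a * y ^ (p + 1))))"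
    unfolding E_def by (subst sum.swap) (simp add: mult_ac)
  also have "\<dots> = (\<Sum>y\<in>UNIV. if \<psi> (a * y ^ (p + 1)) = 1 then of_nat p else 0)"
    by (simp only: psi_of_nat geo)
  also have "\<dots> = of_nat p * of_nat (card {y. \<psi> (a * y ^ (p + 1)) = 1})"
    using fin by (simp add: sum.If_cases mult.commute)
  finally have 1: "(\<Sum>j<p. E (of_nat j * a)) = of_nat p * of_nat (card {y. \<psi> (a * y ^ (p + 1)) = 1})" .
  have "{..<p} = insert 0 {1..<p}" using p0 by auto
  then have "(\<Sum>j<p. E (of_nat j * a)) = E 0 + (\<Sum>j\<in>{1..<p}. E (of_nat j * a))" by simp
  also have "(\<Sum>j\<in>{1..<p}. E (of_nat j * a)) = (\<Sum>j\<in>{1..<p}. E a)"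
    by (rule sum.cong) (use E_scale in auto)
  also have "E 0 = of_nat (p ^ (6 * r))" unfolding E_def using card by simp
  finally show ?thesis using 1 by simp
qed

text \<open>\<open>y \<mapsto> y\<^sup>p\<^sup>+\<^sup>1\<close> is \<open>(p + 1)\<close>-to-one on nonzero elements.\<close>

lemma card_Z_mod:
  "\<exists>k. card {y::'k. \<psi> (a * y ^ (p + 1)) = 1} = 1 + (p + 1) * k"
proof -
  let ?Z = "{y::'k. \<psi> (a * y ^ (p + 1)) = 1}"
  let ?Z' = "{y::'k. y \<noteq> 0 \<and> \<psi> (a * y ^ (p + 1)) = 1}"
  have Z: "?Z = insert 0 ?Z'" by auto
  have finZ: "finite ?Z'" using fin by (rule finite_subset[rotated]) simp
  have "card ?Z' = (\<Sum>v\<in>(\<lambda>y. y ^ (p + 1)) ` ?Z'. card {y \<in> ?Z'. y ^ (p + 1) = v})"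
    using sum.image_gen[OF finZ, of "\<lambda>_. 1::nat" "\<lambda>y. y ^ (p + 1)"] by simp
  also have "\<dots> = (\<Sum>v\<in>(\<lambda>y. y ^ (p + 1)) ` ?Z'. p + 1)"
  proof (rule sum.cong)
    fix v assume "v \<in> (\<lambda>y. y ^ (p + 1)) ` ?Z'"
    then obtain w where w: "w \<noteq> 0" "\<psi> (a * w ^ (p + 1)) = 1" "v = w ^ (p + 1)" by auto
    then have "{y \<in> ?Z'. y ^ (p + 1) = v} = {y. y ^ (p + 1) = w ^ (p + 1)}" by auto
    then show "card {y \<in> ?Z'. y ^ (p + 1) = v} = p + 1"
      using card_power_eq_power[OF fin _ w(1), of "p + 1"] unfolding card card_M' by (metis dvd_triv_left)
  qed simp
  finally have "card ?Z' = (p + 1) * card ((\<lambda>y. y ^ (p + 1)) ` ?Z')" by simp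
  then show ?thesis unfolding Z using finZ by (subst card_insert_disjoint) auto
qed

text \<open>The radical of the form behind \<open>E a\<close>: its polar form contributes
  \<psi>((a^p w^(p^2) + a w) z^p), which is 1 for all z exactly if w lies in this set.\<close>

definition Rad :: "'k \<Rightarrow> 'k set" where "Rad a = {w. a ^ p * w ^ (p ^ 2) + a * w = 0}"

text \<open>For w in the radical, u = a w^(p + 1) satisfies u^p = - u. Hence \<psi>(u) = \<psi>(-
  u), so \<psi>(u)^2 = 1; as also \<psi>(u)^p = 1 with p odd, \<psi>(u) = 1.\<close>

lemma psi_Rad:
  assumes "w \<in> Rad a"
  shows "\<psi> (a * w ^ (p + 1)) = 1"
proof -
  let ?u = "a * w ^ (p + 1)"
  have e: "a ^ p * w ^ (p ^ 2) = - (a * w)" using assms unfolding Rad_def by (simp add: eq_neg_iff_add_eq_0)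
  have "?u ^ p = (a ^ p * w ^ (p ^ 2)) * w ^ p"
    by (simp add: power_mult_distrib power_add power2_eq_square flip: power_mult)
  then have "?u ^ p = - ?u" using e by (simp add: mult_ac)
  then have "\<psi> ?u = \<psi> (- ?u)" using psi_frob[of ?u] by simp
  then have "\<psi> ?u ^ 2 = \<psi> ?u * \<psi> (- ?u)" by (simp add: power2_eq_square)
  also have "\<dots> = 1" using psi_add[of ?u "- ?u"] by simp
  finally have sq: "\<psi> ?u ^ 2 = 1" .
  obtain j where "p = 2 * j + 1" using odd_p by (metis oddE)
  then show ?thesis using psi_pow[of ?u] sq by (simp add: power_mult)
qed

text \<open>After y = w + z the exponent is a part free of z plus a part additive in z. The sum over
  z vanishes unless w is in \<open>Rad a\<close>, where the remaining factor is 1 by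
  \<open>psi_Rad\<close>.\<close>

lemma E_cnj: "E a * cnj (E a) = of_nat (p ^ (6 * r)) * of_nat (card (Rad a))"
proof -
  have "E a * cnj (E a) = (\<Sum>y\<in>UNIV. \<Sum>z\<in>UNIV. \<psi> (a * y ^ (p + 1)) * \<psi> (- (a * z ^ (p + 1))))"
    unfolding E_def by (simp add: sum_product psi_neg)
  also have "\<dots> = (\<Sum>z\<in>UNIV. \<Sum>y\<in>UNIV. \<psi> (a * y ^ (p + 1)) * \<psi> (- (a * z ^ (p + 1))))"
    by (rule sum.swap)
  also have "\<dots> = (\<Sum>z\<in>UNIV. \<Sum>w\<in>UNIV. \<psi> (a * w ^ (p + 1)) * \<psi> ((a ^ p * w ^ (p ^ 2) + a * w) * z ^ p))"
  proof (rule sum.cong)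
    fix z :: 'k
    have bij: "bij_betw (\<lambda>w. w + z) UNIV (UNIV::'k set)"
      by (rule bij_betwI[where g = "\<lambda>w. w - z"]) auto
    have "(\<Sum>y\<in>UNIV. \<psi> (a * y ^ (p + 1)) * \<psi> (- (a * z ^ (p + 1))))
       = (\<Sum>w\<in>UNIV. \<psi> (a * (w + z) ^ (p + 1)) * \<psi> (- (a * z ^ (p + 1))))"
      using sum.reindex_bij_betw[OF bij, of "\<lambda>y. \<psi> (a * y ^ (p + 1)) * \<psi> (- (a * z ^ (p + 1)))"] by simp
    also have "\<dots> = (\<Sum>w\<in>UNIV. \<psi> (a * w ^ (p + 1)) * \<psi> ((a ^ p * w ^ (p ^ 2) + a * w) * z ^ p))"
    proof (rule sum.cong)
      fix w :: 'k
      have "\<psi> (a * (w + z) ^ (p + 1)) * \<psi> (- (a * z ^ (p + 1)))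
         = \<psi> (a * (w + z) ^ (p + 1) - a * z ^ (p + 1))"
        by (simp flip: psi_add)
      also have "a * (w + z) ^ (p + 1) - a * z ^ (p + 1) = a * w ^ (p + 1) + (a * w ^ p * z + a * w * z ^ p)"
        by (simp add: frob_add1 algebra_simps)
      also have "\<psi> \<dots> = \<psi> (a * w ^ (p + 1)) * (\<psi> ((a * w ^ p * z) ^ p) * \<psi> (a * w * z ^ p))"
        by (simp add: psi_add psi_frob)
      also have "(a * w ^ p * z) ^ p = a ^ p * w ^ (p ^ 2) * z ^ p"
        by (simp add: power_mult_distrib power2_eq_square flip: power_mult)
      finally show "\<psi> (a * (w + z) ^ (p + 1)) * \<psi> (- (a * z ^ (p + 1)))
         = \<psi> (a * w ^ (p + 1)) * \<psi> ((a ^ p * w ^ (p ^ 2) + a * w) * z ^ p)"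
        by (simp add: distrib_right psi_add)
    qed simp
    finally show "(\<Sum>y\<in>UNIV. \<psi> (a * y ^ (p + 1)) * \<psi> (- (a * z ^ (p + 1))))
       = (\<Sum>w\<in>UNIV. \<psi> (a * w ^ (p + 1)) * \<psi> ((a ^ p * w ^ (p ^ 2) + a * w) * z ^ p))" .
  qed simp
  also have "\<dots> = (\<Sum>w\<in>UNIV. \<psi> (a * w ^ (p + 1)) * (\<Sum>z\<in>UNIV. \<psi> ((a ^ p * w ^ (p ^ 2) + a * w) * z ^ p)))"
    by (subst sum.swap) (simp add: sum_distrib_left)
  also have "\<dots> = (\<Sum>w\<in>UNIV. if w \<in> Rad a then of_nat (p ^ (6 * r)) else 0)"
  proof (rule sum.cong)
    fix w :: 'k
    let ?R = "a ^ p * w ^ (p ^ 2) + a * w"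
    have "(\<Sum>z\<in>UNIV. \<psi> (?R * z ^ p)) = (\<Sum>z\<in>UNIV. \<psi> (?R * z))"
      using sum.reindex_bij_betw[OF frob_bij[of 1], of "\<lambda>z. \<psi> (?R * z)"] by simp
    also have "\<dots> = (if w \<in> Rad a then of_nat (p ^ (6 * r)) else 0)"
      by (simp only: sum_psi Rad_def mem_Collect_eq)
    finally show "\<psi> (a * w ^ (p + 1)) * (\<Sum>z\<in>UNIV. \<psi> (?R * z ^ p)) = (if w \<in> Rad a then of_nat (p ^ (6 * r)) else 0)"
      using psi_Rad[of w a] by simp
  qed simp
  also have "\<dots> = of_nat (p ^ (6 * r)) * of_nat (card (Rad a))"
    using fin by (simp add: sum.If_cases mult.commute)
  finally show ?thesis .
qed

text \<open>A nonzero w lies in the radical iff w^(p^2 - 1) = - a^(1 - p). As p^2 - 1 divides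
  CARD('k) - 1 with quotient M, there are p^2 - 1 solutions or none, according to the M-th power of
  the right-hand side; M is a sum of 3 r odd terms, whence (-1)^M = (-1)^r.\<close>

lemma card_Rad:
  assumes a: "a \<noteq> 0"
  shows "card (Rad a) = (if a ^ ((p - 1) * M) = (- 1) ^ r then p ^ 2 else 1)"
proof -
  let ?c = "- (inverse a ^ (p - 1))"
  have p2: "p ^ 2 = Suc (p ^ 2 - 1)" using p0 by simp
  have ap: "a ^ p = a * a ^ (p - 1)" using p0 by (metis Suc_diff_1 power_Suc)
  have "w \<in> Rad a \<longleftrightarrow> w = 0 \<or> w ^ (p ^ 2 - 1) = ?c" for w
  proof -
    have "w ^ p ^ 2 = w * w ^ (p ^ 2 - 1)" using p2 by (metis power_Suc)
    then have "a ^ p * w ^ (p ^ 2) + a * w = a * w * a ^ (p - 1) * (w ^ (p ^ 2 - 1) + inverse a ^ (p - 1))"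
      using a by (simp add: ap algebra_simps flip: power_mult_distrib)
    then have "w \<in> Rad a \<longleftrightarrow> w = 0 \<or> w ^ (p ^ 2 - 1) + inverse a ^ (p - 1) = 0"
      using a unfolding Rad_def by simp
    then show ?thesis by (simp add: eq_neg_iff_add_eq_0)
  qed
  then have Rad: "Rad a = insert 0 {w. w ^ (p ^ 2 - 1) = ?c}" by auto
  have "p ^ 2 > 1" using p1 one_less_power[of p 2] by simp
  then have "0 \<notin> {w. w ^ (p ^ 2 - 1) = ?c}" using a by (auto simp: power_0_left)
  then have "card (Rad a) = Suc (card {w. w ^ (p ^ 2 - 1) = ?c})"
    unfolding Rad using fin by (simp add: finite_subset[OF subset_UNIV])
  also have "card {w. w ^ (p ^ 2 - 1) = ?c} = (if ?c ^ M = 1 then p ^ 2 - 1 else 0)"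
    by (rule card_power_eq[OF fin]) (use card card_M a in auto)
  also have "?c ^ M = 1 \<longleftrightarrow> a ^ ((p - 1) * M) = (- 1) ^ r"
  proof -
    have "?c ^ M = (- 1) ^ M * inverse (a ^ ((p - 1) * M))"
      by (subst power_minus) (simp add: power_inverse power_mult)
    also have "(- 1 :: 'k) ^ M = (- 1) ^ r" using even_M by (simp add: uminus_power_if)
    finally have "?c ^ M = (- 1) ^ r * inverse (a ^ ((p - 1) * M))" .
    moreover have "x * inverse y = 1 \<longleftrightarrow> y = x" if "y \<noteq> 0" for x y :: 'k
      using that by (auto simp: field_simps)
    ultimately show ?thesis using a by simp
  qed
  finally show ?thesis using p2 by simp
qed

text \<open>\<open>E_count\<close> makes \<open>E a\<close> rational, and \<open>E_cnj\<close> gives its square. The sign is the one for which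
  \<open>E a \<equiv> 1\<close> modulo \<open>p + 1\<close>, up to the common factor \<open>2\<close> of \<open>p - 1\<close> and \<open>p + 1\<close>.\<close>

lemma E_value:
  assumes a: "a \<noteq> 0"
  shows "E a = (if a ^ ((p - 1) * M) = (- 1) ^ r then (- of_nat p) ^ (3 * r + 1) else (- of_nat p) ^ (3 * r))"
proof -
  define n where "n = (if a ^ ((p - 1) * M) = (- 1) ^ r then 3 * r + 1 else 3 * r)"
  obtain k where k: "card {y::'k. \<psi> (a * y ^ (p + 1)) = 1} = 1 + (p + 1) * k"
    using card_Z_mod by blast
  define X :: int where "X = int p * (1 + (int p + 1) * int k) - int p ^ (6 * r)"
  have EX: "(of_nat p - 1) * E a = of_int X"
  proof -
    have "of_nat (p - 1) = (of_nat p - 1 :: complex)" using p0 by (simp add: of_nat_diff)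
    moreover have "of_int X = (of_nat p * of_nat (1 + (p + 1) * k) - of_nat (p ^ (6 * r)) :: complex)"
      unfolding X_def by (simp only: of_int_diff of_int_mult of_int_add of_int_1 of_int_of_nat_eq of_int_power
          of_nat_power of_nat_mult of_nat_add of_nat_1)
    ultimately show ?thesis using E_count[of a, unfolded k] by (simp only:)
  qed
  have pn: "(of_nat p - 1 :: complex) \<noteq> 0" using p1 by (metis of_nat_1 of_nat_eq_iff less_irrefl right_minus_eq)
  have Ea: "E a = of_int X / (of_nat p - 1)" using EX pn by (simp add: field_simps)
  then have "cnj (E a) = E a" by simp
  then have "E a ^ 2 = of_nat (p ^ (6 * r)) * of_nat (card (Rad a))"
    using E_cnj[of a] by (simp add: power2_eq_square)
  also have "\<dots> = ((- of_nat p) ^ n) ^ 2"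
  proof -
    have "((- of_nat p :: complex) ^ n) ^ 2 = of_nat p ^ (2 * n)"
      by (simp add: mult.commute[of 2 n] flip: power_mult)
    then show ?thesis unfolding card_Rad[OF a] n_def by (simp add: power_add power2_eq_square)
  qed
  finally have "E a = (- of_nat p) ^ n \<or> E a = - ((- of_nat p) ^ n)"
    by (simp add: power2_eq_iff)
  \<comment> \<open>Since p = -1 modulo p + 1 and the count in \<open>E_count\<close> is 1 modulo p
    + 1, X = (p - 1) E(a) is -2 there. The wrong sign would make it 2, so p + 1 would divide 4,
    contrary to p \<ge> 5.\<close>
  moreover have "E a \<noteq> - ((- of_nat p) ^ n)"
  proof
    assume "E a = - ((- of_nat p) ^ n)"
    then have "(of_int (- (int p - 1) * (- int p) ^ n) :: complex) = of_int X" unfolding EX[symmetric] by (simp add: algebra_simps)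
    then have eq: "- (int p - 1) * (- int p) ^ n = X" by (simp only: of_int_eq_iff)
    have c: "[int p = -1] (mod (int p + 1))" by (simp add: cong_iff_dvd_diff)
    have "[X = (-1) * (1 + 0 * int k) - (-1) ^ (6 * r)] (mod (int p + 1))"
      unfolding X_def by (intro cong_diff cong_mult cong_add cong_pow c cong_refl) (simp add: cong_def)
    moreover have "[- (int p - 1) * (- int p) ^ n = - (-1 - 1) * (- (-1)) ^ n] (mod (int p + 1))"
      by (intro cong_diff cong_mult cong_pow c cong_refl cong_minus_minus_iff[THEN iffD2])
    ultimately have "[-2 = (2::int)] (mod (int p + 1))"
      using eq by (metis (no_types, lifting) cong_sym cong_trans diff_numeral_special(11) mult_1 mult_minus_left mult_zero_left
        add.right_neutral minus_one_power_iff even_mult_iff even_numeral minus_minus power_one mult.right_neutral one_add_one minus_add_distrib diff_minus_eq_add uminus_add_conv_diff)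
    then have "int p + 1 dvd 4" by (simp add: cong_iff_dvd_diff)
    then show False using p5 by (auto dest: zdvd_imp_le)
  qed
  ultimately show ?thesis unfolding n_def by auto
qed

section \<open>The cubic sum\<close>

definition E3 :: complex where "E3 = (\<Sum>y\<in>UNIV. \<psi> (y ^ 3))"

lemma sum_nonzero: "(\<Sum>b\<in>UNIV - {0::'k}. h b) = (\<Sum>b\<in>UNIV. h b) - (h 0 :: complex)"
  using fin by (simp add: sum_diff1)

lemma sum_scale:
  assumes "(l::'k) \<noteq> 0"
  shows "(\<Sum>b\<in>UNIV - {0::'k}. h (b * l)) = (\<Sum>b\<in>UNIV - {0}. h b :: complex)"
proof -
  have bij: "bij_betw (\<lambda>b. b * l) (UNIV - {0}) (UNIV - {0})"
    by (rule bij_betwI[where g = "\<lambda>z. z / l"]) (use assms in auto)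
  show ?thesis by (rule sum.reindex_bij_betw[OF bij])
qed

text \<open>Since \<open>3\<close> divides \<open>p + 1\<close>, the sum of \<open>E (b\<^sup>3)\<close> over \<open>b \<noteq> 0\<close> equals \<open>(CARD('k) - 1) * E3\<close>.\<close>

lemma E3_value: "E3 = - 2 * (- of_nat p) ^ (3 * r)"
proof -
  let ?Q = "p ^ (6 * r)"
  obtain s where s: "p + 1 = 3 * s"
  proof -
    have "3 dvd p + 1" using p3 by presburger
    then show ?thesis using that by blast
  qed
  have es: "even s" using s odd_p by presburger
  have Q1: "?Q > 1" using p1 r one_less_power[of p "6 * r"] by simp
  \<comment> \<open>As p + 1 = 3 s, b^3 y^(p + 1) is the cube of b y^s. For fixed y \<noteq> 0 the
    products b y^s run through the nonzero elements; for y = 0 they are all 0.\<close>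
  have "(\<Sum>b\<in>UNIV - {0}. E (b ^ 3)) = (\<Sum>y\<in>UNIV. \<Sum>b\<in>UNIV - {0}. \<psi> ((b * y ^ s) ^ 3))"
  proof -
    have "b ^ 3 * y ^ (p + 1) = (b * y ^ s) ^ 3" for b y :: 'k
      unfolding s by (simp add: power_mult_distrib mult.commute flip: power_mult)
    then show ?thesis unfolding E_def using sum.swap[of "\<lambda>b y. \<psi> ((b * y ^ s) ^ 3)" UNIV "UNIV - {0}"] by simp
  qed
  also have "\<dots> = (\<Sum>y\<in>(UNIV::'k set). if y = 0 then of_nat (?Q - 1) else E3 - 1)"
  proof (rule sum.cong)
    fix y :: 'k
    have s0: "s > 0" using s by simp
    show "(\<Sum>b\<in>UNIV - {0}. \<psi> ((b * y ^ s) ^ 3)) = (if y = 0 then of_nat (?Q - 1) else E3 - 1)"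
    proof (cases "y = 0")
      case True
      then show ?thesis using s0 fin card by (simp add: power_0_left card_Diff_subset)
    next
      case False
      then have "(\<Sum>b\<in>UNIV - {0}. \<psi> ((b * y ^ s) ^ 3)) = (\<Sum>b\<in>UNIV - {0}. \<psi> (b ^ 3))"
        by (intro sum_scale[of _ "\<lambda>z. \<psi> (z ^ 3)"]) simp
      also have "\<dots> = E3 - 1" unfolding E3_def by (subst sum_nonzero) simp
      finally show ?thesis using False by simp
    qed
  qed simp
  also have "\<dots> = of_nat (?Q - 1) + (\<Sum>y\<in>UNIV - {0::'k}. E3 - 1)"
    using fin by (subst sum.remove[of _ 0]) (auto intro!: sum.cong)
  also have "\<dots> = of_nat (?Q - 1) * E3"
    using fin card by (simp add: card_Diff_subset algebra_simps)
  finally have 1: "(\<Sum>b\<in>UNIV - {0}. E (b ^ 3)) = of_nat (?Q - 1) * E3" .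
  \<comment> \<open>b^3 satisfies the criterion of \<open>E_value\<close> iff b^D = (-1)^r, which
    holds for D of the D s nonzero b. For odd r this needs 2 D to divide D s, true because s = (p +
    1) / 3 is even.\<close>
  define D where "D = 3 * ((p - 1) * M)"
  have Ds: "?Q - 1 = D * s" unfolding D_def card_M' s by (simp only: mult_ac)
  have cardD: "card {b::'k. b ^ D = (- 1) ^ r} = D"
  proof (cases "even r")
    case True
    then show ?thesis using card_roots_of_unity_field[OF fin, of D] card Ds by simp
  next
    case False
    have "2 * D dvd CARD('k) - 1" using es Ds card by (auto simp: mult_ac elim!: evenE)
    then show ?thesis using card_power_eq_minus_1[OF fin _ two_neq_0, of D] False by simp
  qed
  have D0: "D > 0" using Ds Q1 by (intro Nat.gr0I) auto
  have "(\<Sum>b\<in>UNIV - {0}. E (b ^ 3)) = (\<Sum>b\<in>UNIV - {0::'k}.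
      if b ^ D = (- 1) ^ r then (- of_nat p) ^ (3 * r + 1) else (- of_nat p) ^ (3 * r))"
  proof (rule sum.cong)
    fix b :: 'k assume "b \<in> UNIV - {0}"
    then have "b ^ 3 \<noteq> 0" by simp
    from E_value[OF this] show "E (b ^ 3) = (if b ^ D = (- 1) ^ r then (- of_nat p) ^ (3 * r + 1) else (- of_nat p) ^ (3 * r))"
      unfolding D_def by (simp only: power_mult)
  qed simp
  also have "\<dots> = of_nat D * (- of_nat p) ^ (3 * r + 1) + of_nat (?Q - 1 - D) * (- of_nat p) ^ (3 * r)"
  proof -
    have 1: "(UNIV - {0}) \<inter> {b::'k. b ^ D = (- 1) ^ r} = {b. b ^ D = (- 1) ^ r}"
      using D0 by (auto simp: power_0_left)
    have 2: "(UNIV - {0}) \<inter> - {b::'k. b ^ D = (- 1) ^ r} = (UNIV - {0}) - {b. b ^ D = (- 1) ^ r}"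
      by auto
    have 3: "card ((UNIV - {0}) - {b::'k. b ^ D = (- 1) ^ r}) = ?Q - 1 - D"
      using fin D0 by (subst card_Diff_subset) (auto intro: finite_subset[OF subset_UNIV] simp: card_Diff_subset card cardD power_0_left)
    show ?thesis
      using fin by (subst sum.If_cases) (simp_all only: 1 2 3 cardD sum_constant finite_Diff)
  qed
  finally have 2: "of_nat (?Q - 1) * E3 = of_nat D * (- of_nat p) ^ (3 * r + 1) + of_nat (?Q - 1 - D) * (- of_nat p) ^ (3 * r)"
    unfolding 1 .
  have "D \<le> ?Q - 1" using Ds D0 s by simp
  then have diff: "(of_nat (?Q - 1 - D) :: complex) = of_nat (?Q - 1) - of_nat D" by (rule of_nat_diff)
  have Dp: "of_nat D * (of_nat p + 1) = (3 * of_nat (?Q - 1) :: complex)"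
  proof -
    have "D * (p + 1) = 3 * (?Q - 1)" using Ds s by simp
    then have "(of_nat (D * (p + 1)) :: complex) = of_nat (3 * (?Q - 1))" by (rule arg_cong)
    then show ?thesis by (simp only: of_nat_mult of_nat_add of_nat_1 of_nat_numeral)
  qed
  \<comment> \<open>A fraction 3 / (p + 1) of the nonzero b carries an extra factor - p, which
    changes the mean of the values by the factor 1 - (3 / (p + 1)) (p + 1) = -2.\<close>
  have "of_nat (?Q - 1) * E3 = (- of_nat p) ^ (3 * r) * (of_nat (?Q - 1) - of_nat D * (of_nat p + 1))"
    unfolding 2 diff power_add power_one_right by algebra
  then have "of_nat (?Q - 1) * E3 = of_nat (?Q - 1) * (- 2 * (- of_nat p) ^ (3 * r))"
    unfolding Dp by (simp add: algebra_simps)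
  moreover have "of_nat (?Q - 1) \<noteq> (0::complex)" using Q1 by (metis of_nat_eq_0_iff zero_less_diff less_irrefl)
  ultimately show ?thesis by (metis mult_left_cancel)
qed

end

section \<open>Affine points\<close>

lemma power6_minus_1: "(q::nat) ^ 6 - 1 = (q ^ 2 - 1) * (q ^ 4 + q ^ 2 + 1)"
proof (cases "q = 0")
  case False
  then have "q ^ 6 \<ge> 1" "q ^ 2 \<ge> 1" by simp_all
  moreover have "q ^ 6 + q ^ 4 + q ^ 2 = q ^ 2 * (q ^ 4 + q ^ 2 + 1)"
    by (simp add: algebra_simps flip: power_add)
  ultimately show ?thesis by (simp add: diff_mult_distrib)
qed simp

lemma square_mod_3_imp_dvd:
  assumes "(q::nat) ^ 2 mod 3 = 1"
  shows "3 dvd q ^ 4 + q ^ 2 + 1"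
proof -
  have a: "[q ^ 2 = 1] (mod 3)" using assms by (simp add: cong_def)
  have "[q ^ 4 + q ^ 2 + 1 = 1 ^ 2 + 1 + 1] (mod 3)"
    using cong_add[OF cong_add[OF cong_pow[OF a, of 2] a] cong_refl[of 1]] by (simp flip: power_mult)
  then show ?thesis by (simp add: cong_def mod_eq_0_iff_dvd)
qed

lemma (in field_char_sums) power_r_square_mod_3: "(p ^ r) ^ 2 mod 3 = 1"
proof -
  have "[p = 2] (mod 3)" using p3 by (simp add: cong_def)
  from cong_pow[OF this, of 2] have "[p ^ 2 = 1] (mod 3)" by (simp add: cong_def)
  from cong_pow[OF this, of r] show ?thesis by (simp add: cong_def mult.commute flip: power_mult)
qed

text \<open>Orthogonality detects the equation by a sum over frequencies a. The sum over w vanishes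
  unless a^(q^2) = a; such nonzero a are cubes, so the remaining sum over y is E3 for each of them,
  and a = 0 gives the main term q^6.\<close>

lemma (in field_char_sums) card_additive_curve:
  fixes q :: nat
  assumes q: "q = p ^ r"
  shows "of_nat (card {(w, y). w ^ (q ^ 2) - w = (y::'k) ^ 3}) = (of_nat (q ^ 6) + of_nat (q ^ 2 - 1) * E3 :: complex)"
proof -
  let ?Q = "p ^ (6 * r)"
  let ?S = "{(w, y). w ^ (q ^ 2) - w = (y::'k) ^ 3}"
  have qQ: "?Q = q ^ 6" unfolding q by (simp add: mult.commute flip: power_mult)
  have q2: "q ^ 2 = p ^ (2 * r)" unfolding q by (simp add: mult.commute flip: power_mult)
  have q1: "q > 1" unfolding q using p1 r one_less_power[of p r] by simp
  have q21: "q ^ 2 > 1" using q1 one_less_power[of q 2] by simp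
  have Q0: "of_nat ?Q \<noteq> (0::complex)" using p0 by simp
  define F where "F = {a::'k. a ^ (q ^ 2) = a}"
  have fac: "q ^ 6 - 1 = (q ^ 2 - 1) * (q ^ 4 + q ^ 2 + 1)" by (rule power6_minus_1)
  have three: "3 dvd q ^ 4 + q ^ 2 + 1" using square_mod_3_imp_dvd power_r_square_mod_3 unfolding q by blast
  have a0: "a ^ (q ^ 2 - 1) = 1" if "a \<in> F" "a \<noteq> 0" for a
  proof -
    have "a * a ^ (q ^ 2 - 1) = a ^ Suc (q ^ 2 - 1)" by simp
    also have "Suc (q ^ 2 - 1) = q ^ 2" using q21 by simp
    also have "a ^ (q ^ 2) = a * 1" using that unfolding F_def by simp
    finally have "a * a ^ (q ^ 2 - 1) = a * 1" .
    then show ?thesis using that by simp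
  qed
  \<comment> \<open>Nonzero elements of the subfield satisfy a^(q^2 - 1) = 1, and the index (q^6 -
    1) / (q^2 - 1) = q^4 + q^2 + 1 is divisible by 3.\<close>
  have cube: "\<exists>b::'k. b ^ 3 = a" if "a \<in> F" "a \<noteq> 0" for a
  proof -
    obtain s where s: "q ^ 4 + q ^ 2 + 1 = 3 * s" using three by blast
    have "CARD('k) - 1 = 3 * ((q ^ 2 - 1) * s)" unfolding card qQ fac s by (simp only: mult_ac)
    moreover have "a ^ ((q ^ 2 - 1) * s) = 1" using a0[OF that] by (simp add: power_mult)
    ultimately show ?thesis by (rule ex_power_eq[OF fin])
  qed
  have F: "F = insert 0 {a. a ^ (q ^ 2 - 1) = 1}"
  proof -
    have "a ^ (q ^ 2) = a * a ^ (q ^ 2 - 1)" for a :: 'k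
      using q21 by (metis Suc_diff_1 less_trans power_Suc zero_less_one)
    then show ?thesis unfolding F_def using q21 by auto
  qed
  have cardF: "card (F - {0}) = q ^ 2 - 1"
  proof -
    have "F - {0} = {a. a ^ (q ^ 2 - 1) = 1}" unfolding F using q21 by (auto simp: power_0_left)
    moreover have "(q ^ 2 - 1) dvd CARD('k) - 1" unfolding card qQ fac by simp
    ultimately show ?thesis using card_roots_of_unity_field[OF fin] by simp
  qed
  have E3a: "(\<Sum>y\<in>UNIV. \<psi> (a * y ^ 3)) = E3" if a: "a \<in> F" "a \<noteq> 0" for a
  proof -
    obtain b where b: "b ^ 3 = a" using cube[OF a] by blast
    then have b0: "b \<noteq> 0" using a by auto
    have bij: "bij_betw (\<lambda>y. b * y) UNIV (UNIV::'k set)"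
      by (rule bij_betwI[where g = "\<lambda>z. z / b"]) (use b0 in auto)
    show ?thesis unfolding E3_def
      using sum.reindex_bij_betw[OF bij, of "\<lambda>y. \<psi> (y ^ 3)"] by (simp add: power_mult_distrib b)
  qed
  \<comment> \<open>Under \<psi> the term a w may be replaced by its q^2-th power, which makes the
    argument a multiple of w^(q^2), and w -> w^(q^2) is a bijection.\<close>
  have W: "(\<Sum>w\<in>UNIV. \<psi> (a * w - a * w ^ (q ^ 2))) = (if a \<in> F then of_nat ?Q else 0)" for a :: 'k
  proof -
    have "\<psi> (a * w - a * w ^ (q ^ 2)) = \<psi> ((a ^ (q ^ 2) - a) * w ^ (q ^ 2))" for w
    proof -
      have "\<psi> (a * w - a * w ^ (q ^ 2)) = \<psi> (a * w) * \<psi> (- (a * w ^ (q ^ 2)))"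
        by (simp flip: psi_add)
      also have "\<psi> (a * w) = \<psi> ((a * w) ^ (q ^ 2))" unfolding q2 by (simp only: psi_frob')
      also have "\<psi> ((a * w) ^ (q ^ 2)) * \<psi> (- (a * w ^ (q ^ 2))) = \<psi> ((a ^ (q ^ 2) - a) * w ^ (q ^ 2))"
        by (simp add: power_mult_distrib algebra_simps flip: psi_add)
      finally show ?thesis .
    qed
    then have "(\<Sum>w\<in>UNIV. \<psi> (a * w - a * w ^ (q ^ 2))) = (\<Sum>w\<in>UNIV. \<psi> ((a ^ (q ^ 2) - a) * w))"
      using sum.reindex_bij_betw[OF frob_bij[of "2 * r"], of "\<lambda>z. \<psi> ((a ^ (q ^ 2) - a) * z)"] unfolding q2 by simp
    then show ?thesis by (simp add: sum_psi F_def)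
  qed
  have "of_nat ?Q * of_nat (card ?S) = (\<Sum>(w, y)\<in>UNIV \<times> (UNIV :: 'k set). if w ^ (q ^ 2) - w = y ^ 3 then of_nat ?Q else 0 :: complex)"
  proof -
    have "(\<Sum>(w, y)\<in>UNIV \<times> (UNIV :: 'k set). if w ^ (q ^ 2) - w = y ^ 3 then of_nat ?Q else 0 :: complex)
       = (\<Sum>z\<in>UNIV \<times> (UNIV :: 'k set). if z \<in> ?S then of_nat ?Q else 0)"
      by (rule sum.cong) auto
    also have "\<dots> = of_nat ?Q * of_nat (card ?S)"
      using fin by (simp add: sum.If_cases finite_cartesian_product[of UNIV UNIV, simplified] mult.commute)
    finally show ?thesis by simp
  qed
  also have "\<dots> = (\<Sum>w\<in>UNIV. \<Sum>y\<in>(UNIV::'k set). \<Sum>a\<in>UNIV. \<psi> (a * y ^ 3) * \<psi> (a * w - a * w ^ (q ^ 2)))"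
    unfolding sum.cartesian_product[symmetric]
  proof (intro sum.cong refl)
    fix w y :: 'k
    have "(if w ^ (q ^ 2) - w = y ^ 3 then of_nat ?Q else 0) = (\<Sum>a\<in>UNIV. \<psi> ((y ^ 3 - (w ^ (q ^ 2) - w)) * a))"
      unfolding sum_psi right_minus_eq by (simp only: eq_commute[of "y ^ 3"])
    also have "\<dots> = (\<Sum>a\<in>UNIV. \<psi> (a * y ^ 3) * \<psi> (a * w - a * w ^ (q ^ 2)))"
      by (simp add: algebra_simps flip: psi_add)
    finally show "(if w ^ (q ^ 2) - w = y ^ 3 then of_nat ?Q else 0) = (\<Sum>a\<in>UNIV. \<psi> (a * y ^ 3) * \<psi> (a * w - a * w ^ (q ^ 2)))" .
  qed
  also have "\<dots> = (\<Sum>a\<in>UNIV. \<Sum>y\<in>UNIV. \<Sum>w\<in>(UNIV::'k set). \<psi> (a * y ^ 3) * \<psi> (a * w - a * w ^ (q ^ 2)))"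
  proof -
    have "(\<Sum>w\<in>UNIV. \<Sum>y\<in>(UNIV::'k set). \<Sum>a\<in>UNIV. \<psi> (a * y ^ 3) * \<psi> (a * w - a * w ^ (q ^ 2)))
       = (\<Sum>w\<in>UNIV. \<Sum>a\<in>(UNIV::'k set). \<Sum>y\<in>UNIV. \<psi> (a * y ^ 3) * \<psi> (a * w - a * w ^ (q ^ 2)))"
      by (intro sum.cong refl sum.swap)
    also have "\<dots> = (\<Sum>a\<in>UNIV. \<Sum>w\<in>(UNIV::'k set). \<Sum>y\<in>UNIV. \<psi> (a * y ^ 3) * \<psi> (a * w - a * w ^ (q ^ 2)))"
      by (rule sum.swap)
    also have "\<dots> = (\<Sum>a\<in>UNIV. \<Sum>y\<in>UNIV. \<Sum>w\<in>(UNIV::'k set). \<psi> (a * y ^ 3) * \<psi> (a * w - a * w ^ (q ^ 2)))"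
      by (intro sum.cong refl sum.swap)
    finally show ?thesis .
  qed
  also have "\<dots> = (\<Sum>a\<in>UNIV. if a \<in> F then of_nat ?Q * (\<Sum>y\<in>UNIV. \<psi> (a * y ^ 3)) else 0)"
    by (intro sum.cong refl) (simp add: W mult.commute flip: sum_distrib_left sum_distrib_right)
  also have "\<dots> = of_nat ?Q * (\<Sum>a\<in>F. \<Sum>y\<in>UNIV. \<psi> (a * y ^ 3))"
    using fin by (simp add: sum.If_cases sum_distrib_left)
  finally have "of_nat (card ?S) = (\<Sum>a\<in>F. \<Sum>y\<in>UNIV. \<psi> (a * y ^ 3))"
    using Q0 by (simp only: mult_cancel_left) simp
  also have "\<dots> = (\<Sum>y\<in>(UNIV::'k set). \<psi> (0 * y ^ 3)) + (\<Sum>a\<in>F - {0}. \<Sum>y\<in>UNIV. \<psi> (a * y ^ 3))"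
    by (rule sum.remove) (use fin F in \<open>auto intro: finite_subset[OF subset_UNIV]\<close>)
  also have "\<dots> = of_nat (q ^ 6) + of_nat (q ^ 2 - 1) * E3"
    using E3a cardF card qQ by simp
  finally show ?thesis .
qed

section \<open>Reduction of the curve to two additive equations\<close>

lemma card_pairs_sum:
  assumes "finite (UNIV :: 'k::field set)"
  shows "card {(x, y). (y::'k) ^ 3 = f x} = (\<Sum>x\<in>(UNIV::'k set). card {y. y ^ 3 = f x})"
proof -
  have "{(x, y). (y::'k) ^ 3 = f x} = (SIGMA x : UNIV. {y. y ^ 3 = f x})" by auto
  then show ?thesis using assms by (simp add: card_SigmaI finite_subset[OF subset_UNIV])
qed

lemma card_cube_scale:
  assumes "(u::'k::field) \<noteq> 0"
  shows "card {y. y ^ 3 = u ^ 3 * z} = card {y. y ^ 3 = z}"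
proof -
  have "bij_betw ((*) u) {y. y ^ 3 = z} {y. y ^ 3 = u ^ 3 * z}"
    by (rule bij_betwI[where g = "\<lambda>y. y / u"]) (use assms in \<open>auto simp: power_mult_distrib power_divide\<close>)
  then show ?thesis by (metis bij_betw_same_card)
qed

text \<open>Choose \<open>\<nu>\<close> with \<open>\<nu>\<^sup>m\<^sup>-\<^sup>1 = -1\<close>, a cube that is not a square. Substituting \<open>x = w\<^sup>-\<^sup>2\<close> and \<open>x = \<nu> w\<^sup>-\<^sup>2\<close> covers
  every nonzero \<open>x\<close> twice and turns \<open>x\<^sup>m + x\<close>, up to cubes, into \<open>w\<^bsup>q\<^sup>2\<^esup> + w\<close>, a permutation polynomial,
  and \<open>w\<^bsup>q\<^sup>2\<^esup> - w\<close>.\<close>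

lemma (in field_char_sums) card_affine_points:
  fixes q :: nat
  assumes q: "q = p ^ r"
  shows "int (card {(x, y). (y::'k) ^ 3 = x ^ ((q ^ 2 + 1) div 2) + x})
      = int q ^ 6 + (-1) ^ (r + 1) * (int q ^ 2 - 1) * int q ^ 3"
proof -
  define m where "m = (q ^ 2 + 1) div 2"
  define c :: "'k \<Rightarrow> nat" where "c = (\<lambda>z. card {y. y ^ 3 = z})"
  have qQ: "p ^ (6 * r) = q ^ 6" unfolding q by (simp add: mult.commute flip: power_mult)
  have q2: "q ^ 2 = p ^ (2 * r)" unfolding q by (simp add: mult.commute flip: power_mult)
  have q1: "q > 1" unfolding q using p1 r one_less_power[of p r] by simp
  have q21: "q ^ 2 > 1" using q1 one_less_power[of q 2] by simp
  have oddq: "odd (q ^ 2)" unfolding q using odd_p by simp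
  then have m2: "2 * m = q ^ 2 + 1" unfolding m_def by presburger
  then have m1: "2 * (m - 1) = q ^ 2 - 1" by simp
  have m0: "m > 1" using m2 q21 by linarith
  have q2m3: "q ^ 2 mod 3 = 1" unfolding q by (rule power_r_square_mod_3)
  then obtain e where e: "q ^ 2 + 2 = 3 * e"
  proof -
    have "3 dvd q ^ 2 + 2" using q2m3 by presburger
    then show ?thesis using that by blast
  qed
  define s where "s = q ^ 4 + q ^ 2 + 1"
  have fac: "q ^ 6 - 1 = (q ^ 2 - 1) * s" unfolding s_def by (rule power6_minus_1)
  have odds: "odd s" unfolding s_def using oddq by simp
  have three: "3 dvd s" unfolding s_def by (rule square_mod_3_imp_dvd[OF q2m3])
  have card1: "CARD('k) - 1 = (q ^ 2 - 1) * s" unfolding card qQ by (rule fac)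
  obtain \<nu> :: 'k where nu: "\<nu> ^ (m - 1) = - 1"
  proof -
    have "2 * (m - 1) dvd CARD('k) - 1" unfolding card1 m1 by simp
    then have "card {z::'k. z ^ (m - 1) = - 1} = m - 1"
      by (rule card_power_eq_minus_1[OF fin _ two_neq_0])
    then have "card {z::'k. z ^ (m - 1) = - 1} > 0" using m0 by simp
    then show ?thesis using that by (auto simp: card_gt_0_iff)
  qed
  have nu0: "\<nu> \<noteq> 0" using nu m0 by (auto simp: power_0_left)
  have nuq: "\<nu> ^ (q ^ 2 - 1) = 1"
  proof -
    have "\<nu> ^ ((m - 1) * 2) = 1" unfolding power_mult nu by simp
    then show ?thesis unfolding m1[symmetric] by (simp only: mult.commute[of 2])
  qed
  have num: "\<nu> ^ m = - \<nu>"
  proof -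
    have "\<nu> ^ m = \<nu> ^ (m - 1) * \<nu>" using m0 by (metis Suc_diff_1 less_trans power_Suc2 zero_less_one)
    then show ?thesis using nu by simp
  qed
  obtain b where b: "\<nu> = b ^ 3"
  proof -
    obtain s' where s': "s = 3 * s'" using three by blast
    have "CARD('k) - 1 = 3 * ((q ^ 2 - 1) * s')" using card1 s' by simp
    moreover have "\<nu> ^ ((q ^ 2 - 1) * s') = 1" using nuq by (simp add: power_mult)
    ultimately show ?thesis using ex_power_eq[OF fin] that by metis
  qed
  have b0: "b \<noteq> 0" using nu0 b by auto
  have csc: "c (u ^ 3 * z) = c z" if "u \<noteq> 0" for u z
    unfolding c_def by (rule card_cube_scale[OF that])
  define g where "g = (\<lambda>x. c (x ^ m + x))"
  have vinv: "v ^ (n + 2) * inverse v ^ n = v ^ 2" if "v \<noteq> 0" for v :: 'k and n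
  proof -
    have "v ^ (n + 2) * inverse v ^ n = v ^ 2 * (v * inverse v) ^ n"
      by (simp only: power_add power_mult_distrib mult_ac)
    then show ?thesis using that by simp
  qed
  have vinv1: "v ^ (n + 2) * inverse v = v ^ (n + 1)" if "v \<noteq> 0" for v :: 'k and n
    using that by (simp add: power_add power2_eq_square)
  have sq_m: "(v ^ 2) ^ m = v ^ (q ^ 2 + 1)" for v :: 'k
    unfolding power_mult[symmetric] m2 by (rule refl)
  \<comment> \<open>The factor taken out is v^(q^2 + 2), a cube because q^2 = 1 modulo 3;
    \<open>csc\<close> removes it.\<close>
  have g1: "g (v ^ 2) = c (inverse v ^ (q ^ 2) + inverse v)" if v: "v \<noteq> 0" for v
  proof -
    have "(v ^ 2) ^ m + v ^ 2 = v ^ (q ^ 2 + 1) + v ^ 2" by (simp only: sq_m)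
    also have "\<dots> = v ^ (q ^ 2 + 2) * (inverse v ^ (q ^ 2) + inverse v)"
      by (simp only: distrib_left vinv[OF v] vinv1[OF v]) (rule add.commute)
    also have "v ^ (q ^ 2 + 2) = (v ^ e) ^ 3" unfolding e by (simp add: mult.commute flip: power_mult)
    finally show ?thesis unfolding g_def using csc v by simp
  qed
  have g2: "g (\<nu> * v ^ 2) = c (inverse v ^ (q ^ 2) - inverse v)" if v: "v \<noteq> 0" for v
  proof -
    have "(\<nu> * v ^ 2) ^ m + \<nu> * v ^ 2 = \<nu> * (v ^ 2 - v ^ (q ^ 2 + 1))"
      by (simp only: power_mult_distrib num sq_m) (simp add: right_diff_distrib)
    also have "v ^ 2 - v ^ (q ^ 2 + 1) = v ^ (q ^ 2 + 2) * (inverse v ^ (q ^ 2) - inverse v)"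
      by (simp only: right_diff_distrib vinv[OF v] vinv1[OF v])
    also have "v ^ (q ^ 2 + 2) = (v ^ e) ^ 3" unfolding e by (simp add: mult.commute flip: power_mult)
    also have "\<nu> * ((v ^ e) ^ 3 * (inverse v ^ (q ^ 2) - inverse v)) = (b * v ^ e) ^ 3 * (inverse v ^ (q ^ 2) - inverse v)"
      by (simp add: b power_mult_distrib)
    finally show ?thesis unfolding g_def using csc[of "b * v ^ e"] v b0 by simp
  qed
  have inv_bij: "bij_betw inverse (UNIV - {0}) (UNIV - {0::'k})"
    by (rule bij_betwI[where g = inverse]) auto
  have two_to_one: "(\<Sum>v\<in>UNIV - {0}. g (v ^ 2) + g (\<nu> * v ^ 2)) = 2 * (\<Sum>t\<in>UNIV - {0}. g t)"
  proof -
    let ?U = "UNIV - {0::'k}"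
    have finU: "finite ?U" using fin by simp
    have "(\<Sum>v\<in>?U. g (v ^ 2)) = (\<Sum>t\<in>?U. \<Sum>v\<in>{v \<in> ?U. v ^ 2 = t}. g (v ^ 2))"
      by (rule sum.group[symmetric]) (use finU in auto)
    also have "\<dots> = (\<Sum>t\<in>?U. card {v. v ^ 2 = t} * g t)"
    proof (rule sum.cong)
      fix t assume "t \<in> ?U"
      then have "{v \<in> ?U. v ^ 2 = t} = {v. v ^ 2 = t}" by auto
      then show "(\<Sum>v\<in>{v \<in> ?U. v ^ 2 = t}. g (v ^ 2)) = card {v. v ^ 2 = t} * g t" by simp
    qed simp
    finally have 1: "(\<Sum>v\<in>?U. g (v ^ 2)) = (\<Sum>t\<in>?U. card {v. v ^ 2 = t} * g t)" .
    have "(\<Sum>v\<in>?U. g (\<nu> * v ^ 2)) = (\<Sum>t\<in>?U. \<Sum>v\<in>{v \<in> ?U. \<nu> * v ^ 2 = t}. g (\<nu> * v ^ 2))"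
      by (rule sum.group[symmetric]) (use finU nu0 in auto)
    also have "\<dots> = (\<Sum>t\<in>?U. card {v. v ^ 2 = t / \<nu>} * g t)"
    proof (rule sum.cong)
      fix t assume "t \<in> ?U"
      then have "{v \<in> ?U. \<nu> * v ^ 2 = t} = {v. v ^ 2 = t / \<nu>}" using nu0 by (auto simp: field_simps)
      moreover have "(\<Sum>v\<in>{v \<in> ?U. \<nu> * v ^ 2 = t}. g (\<nu> * v ^ 2)) = (\<Sum>v\<in>{v \<in> ?U. \<nu> * v ^ 2 = t}. g t)"
        by (rule sum.cong) auto
      ultimately show "(\<Sum>v\<in>{v \<in> ?U. \<nu> * v ^ 2 = t}. g (\<nu> * v ^ 2)) = card {v. v ^ 2 = t / \<nu>} * g t" by simp
    qed simp
    finally have 2: "(\<Sum>v\<in>?U. g (\<nu> * v ^ 2)) = (\<Sum>t\<in>?U. card {v. v ^ 2 = t / \<nu>} * g t)" .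
    \<comment> \<open>\<nu> is a non-square: as s is odd, \<nu>^L = -1 for half the order L of the
      multiplicative group. So exactly one of t and t / \<nu> is a square, with two roots.\<close>
    have 3: "card {v. v ^ 2 = t} + card {v. v ^ 2 = t / \<nu>} = 2" if t: "t \<noteq> 0" for t
    proof -
      define L where "L = (m - 1) * s"
      have L: "CARD('k) - 1 = 2 * L" using card1 m1 unfolding L_def by simp
      have nuL: "\<nu> ^ L = - 1" unfolding L_def power_mult nu using odds by simp
      have "t ^ (2 * L) = 1" using power_card_minus_1[OF fin t] L by simp
      then have "(t ^ L) ^ 2 = 1" by (simp add: mult.commute flip: power_mult)
      then have "t ^ L = 1 \<or> t ^ L = - 1" by (simp add: power2_eq_1_iff)
      moreover have "(-1 :: 'k) \<noteq> 1" using two_neq_0 by (metis add.right_inverse one_add_one)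
      ultimately show ?thesis
        using card_power_eq[OF fin L t] card_power_eq[OF fin L, of "t / \<nu>"] t nu0
        by (auto simp: power_divide nuL)
    qed
    have "(\<Sum>v\<in>?U. g (v ^ 2) + g (\<nu> * v ^ 2)) = (\<Sum>t\<in>?U. (card {v. v ^ 2 = t} + card {v. v ^ 2 = t / \<nu>}) * g t)"
      by (simp add: sum.distrib 1 2 add_mult_distrib)
    also have "\<dots> = (\<Sum>t\<in>?U. 2 * g t)" by (rule sum.cong) (use 3 in auto)
    finally show ?thesis by (simp add: sum_distrib_left)
  qed
  have c0: "c 0 = 1"
  proof -
    have "{y::'k. y ^ 3 = 0} = {0}" by auto
    then show ?thesis unfolding c_def by simp
  qed
  have sum_c: "(\<Sum>z\<in>UNIV. c z) = q ^ 6"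
  proof -
    have "(\<Sum>z\<in>UNIV. c z) = (\<Sum>z\<in>UNIV. \<Sum>y\<in>{y. y \<in> (UNIV::'k set) \<and> y ^ 3 = z}. 1)"
      unfolding c_def by simp
    also have "\<dots> = (\<Sum>y\<in>(UNIV::'k set). 1)" by (rule sum.group) (use fin in auto)
    finally show ?thesis using card qQ by simp
  qed
  have split0: "(\<Sum>x\<in>UNIV. h x) = h (0::'k) + (\<Sum>x\<in>UNIV - {0}. h x)" for h :: "'k \<Rightarrow> nat"
    by (rule sum.remove) (use fin in auto)
  \<comment> \<open>The difference w of two elements with the same image satisfies w^(q^2) = - w.
    Applying this three times gives w^(q^6) = - w, while w^(q^6) = w, so 2 w = 0.\<close>
  have plus_bij: "bij_betw (\<lambda>w. w ^ (q ^ 2) + w) UNIV (UNIV::'k set)"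
  proof -
    have "inj (\<lambda>w::'k. w ^ (q ^ 2) + w)"
    proof (rule injI)
      fix a d :: 'k assume "a ^ (q ^ 2) + a = d ^ (q ^ 2) + d"
      then have "(a - d) ^ (q ^ 2) = - (a - d)" unfolding q2 by (simp add: frob_diff algebra_simps)
      then obtain w where w: "w = a - d" and w1: "w ^ (q ^ 2) = - w" by blast
      have w2: "w ^ (q ^ 2) ^ 2 = w" using w1 oddq by (simp add: power2_eq_square power_mult)
      have "w ^ ((q ^ 2) ^ 3) = (w ^ (q ^ 2) ^ 2) ^ (q ^ 2)" by (simp add: power3_eq_cube power2_eq_square flip: power_mult)
      then have "w ^ ((q ^ 2) ^ 3) = - w" using w1 w2 by simp
      moreover have "w ^ ((q ^ 2) ^ 3) = w" using power_card[OF fin, of w] card qQ by (simp flip: power_mult)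
      ultimately have "2 * w = 0" by (simp add: eq_neg_iff_add_eq_0)
      then show "a = d" using two_neq_0 w by simp
    qed
    then show ?thesis using fin by (simp add: finite_UNIV_inj_surj bij_def)
  qed
  have "(\<Sum>v\<in>UNIV - {0}. g (v ^ 2) + g (\<nu> * v ^ 2))
     = (\<Sum>v\<in>UNIV - {0::'k}. c (inverse v ^ (q ^ 2) + inverse v) + c (inverse v ^ (q ^ 2) - inverse v))"
    by (rule sum.cong) (use g1 g2 in auto)
  also have "\<dots> = (\<Sum>w\<in>UNIV - {0::'k}. c (w ^ (q ^ 2) + w) + c (w ^ (q ^ 2) - w))"
    by (rule sum.reindex_bij_betw[OF inv_bij])
  finally have S1: "2 * (\<Sum>t\<in>UNIV - {0}. g t) = (\<Sum>w\<in>UNIV - {0::'k}. c (w ^ (q ^ 2) + w) + c (w ^ (q ^ 2) - w))"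
    unfolding two_to_one .
  have g0: "g 0 = 1" using c0 m0 by (simp add: g_def power_0_left)
  have "(\<Sum>w\<in>(UNIV::'k set). c (w ^ (q ^ 2) + w) + c (w ^ (q ^ 2) - w))
     = 2 + (\<Sum>w\<in>UNIV - {0::'k}. c (w ^ (q ^ 2) + w) + c (w ^ (q ^ 2) - w))"
  proof -
    have z: "(0::'k) ^ (q ^ 2) = 0" by (rule zero_power) (use q21 in linarith)
    show ?thesis
      unfolding split0[of "\<lambda>w. c (w ^ (q ^ 2) + w) + c (w ^ (q ^ 2) - w)"] z by (simp add: c0)
  qed
  then have S2: "2 * (\<Sum>x\<in>UNIV. g x) = (\<Sum>w\<in>(UNIV::'k set). c (w ^ (q ^ 2) + w)) + (\<Sum>w\<in>(UNIV::'k set). c (w ^ (q ^ 2) - w))"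
    using S1 split0[of g] g0 by (simp add: sum.distrib)
  have S3: "(\<Sum>w\<in>(UNIV::'k set). c (w ^ (q ^ 2) + w)) = q ^ 6"
    using sum.reindex_bij_betw[OF plus_bij, of c] sum_c by simp
  have S4: "(\<Sum>w\<in>(UNIV::'k set). c (w ^ (q ^ 2) - w)) = card {(w, y). w ^ (q ^ 2) - w = (y::'k) ^ 3}"
    using card_pairs_sum[OF fin, of "\<lambda>w. w ^ (q ^ 2) - w"] unfolding c_def by (simp add: eq_commute)
  have N2: "2 * (\<Sum>x\<in>UNIV. g x) = q ^ 6 + card {(w, y). w ^ (q ^ 2) - w = (y::'k) ^ 3}"
    using S2 S3 S4 by simp
  define B where "B = card {(w, y). w ^ (q ^ 2) - w = (y::'k) ^ 3}"
  have "(of_int (int B) :: complex) = of_int (int (q ^ 6) + int (q ^ 2 - 1) * (- 2 * (- int p) ^ (3 * r)))"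
    using card_additive_curve[OF q] unfolding E3_value B_def[symmetric] by simp
  then have "int B = int (q ^ 6) + int (q ^ 2 - 1) * (- 2 * (- int p) ^ (3 * r))" by (simp only: of_int_eq_iff)
  moreover have "(- int p) ^ (3 * r) = (-1) ^ r * int q ^ 3"
  proof -
    have "(- int p) ^ (3 * r) = (-1) ^ (3 * r) * int p ^ (3 * r)" by (rule power_minus)
    then show ?thesis unfolding q by (simp add: mult.commute uminus_power_if flip: power_mult)
  qed
  moreover have "int (q ^ 2 - 1) = int q ^ 2 - 1" using q21 by (simp add: of_nat_diff)
  ultimately have "int B = int q ^ 6 - 2 * ((int q ^ 2 - 1) * ((-1) ^ r * int q ^ 3))" by simp
  moreover have "2 * int (\<Sum>x\<in>UNIV. g x) = int q ^ 6 + int B"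
    using N2 unfolding B_def[symmetric] by (metis of_nat_add of_nat_mult of_nat_numeral of_nat_power)
  ultimately have "int (\<Sum>x\<in>UNIV. g x) = int q ^ 6 - (int q ^ 2 - 1) * ((-1) ^ r * int q ^ 3)" by linarith
  moreover have "card {(x, y). (y::'k) ^ 3 = x ^ m + x} = (\<Sum>x\<in>UNIV. g x)"
    unfolding g_def c_def by (rule card_pairs_sum[OF fin])
  ultimately show ?thesis unfolding m_def[symmetric] by (simp add: algebra_simps)
qed

lemma affine_point_count:
  fixes p r q :: nat
  assumes p: "prime p" and p5: "p \<ge> 5" and p3: "p mod 3 = 2" and r: "r \<ge> 1" and q: "q = p ^ r"
    and card: "CARD('k::field) = q ^ 6"
  shows "int (card {(x, y). (y::'k) ^ 3 = x ^ ((q ^ 2 + 1) div 2) + x})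
      = int q ^ 6 + (-1) ^ (r + 1) * (int q ^ 2 - 1) * int q ^ 3"
proof -
  have card': "CARD('k) = p ^ (6 * r)" using card q by (simp add: mult.commute flip: power_mult)
  obtain \<psi> :: "'k \<Rightarrow> complex" where psi: "\<And>a b. \<psi> (a + b) = \<psi> a * \<psi> b" "\<And>a. \<psi> (a ^ p) = \<psi> a"
    "\<And>a. \<psi> a ^ p = 1" "\<exists>a. \<psi> a \<noteq> 1"
    using additive_character_exists[OF p card'] r by auto
  interpret field_char_sums p r \<psi>
    by standard (use p p5 p3 r card' psi in auto)
  show ?thesis by (rule card_affine_points[OF q])
qed

section \<open>Valuation rings over a finite field of constants\<close>

locale const_field =
  fixes \<iota> :: "'k::field \<Rightarrow> 'f::field"
  assumes emb: "field_embedding \<iota>" and fin: "finite (UNIV :: 'k set)"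
begin

lemma iota_1 [simp]: "\<iota> 1 = 1" and iota_add: "\<iota> (a + b) = \<iota> a + \<iota> b" and iota_mult: "\<iota> (a * b) = \<iota> a * \<iota> b"
  using emb unfolding field_embedding_def by auto

lemma iota_0 [simp]: "\<iota> 0 = 0"
  using iota_add[of 0 0] by (metis add_0_right add_left_cancel)

lemma iota_minus: "\<iota> (- a) = - \<iota> a"
  using iota_add[of a "- a"] by (simp add: eq_neg_iff_add_eq_0 add.commute)

lemma iota_diff: "\<iota> (a - b) = \<iota> a - \<iota> b"
  using iota_add[of a "- b"] by (simp add: iota_minus)

lemma iota_eq_0_iff [simp]: "\<iota> a = 0 \<longleftrightarrow> a = 0"
proof
  assume "\<iota> a = 0"
  then show "a = 0" using iota_mult[of a "inverse a"] by (cases "a = 0") auto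
qed simp

lemma iota_inverse: "\<iota> (inverse a) = inverse (\<iota> a)"
proof (cases "a = 0")
  case False
  then have "\<iota> a * \<iota> (inverse a) = 1" by (simp flip: iota_mult)
  then show ?thesis by (metis inverse_unique)
qed simp

lemma iota_divide: "\<iota> (a / b) = \<iota> a / \<iota> b"
  by (simp add: divide_inverse iota_mult iota_inverse)

lemma iota_power: "\<iota> (a ^ n) = \<iota> a ^ n"
  by (induction n) (auto simp: iota_mult)

lemma iota_of_nat: "\<iota> (of_nat n) = of_nat n"
  by (induction n) (auto simp: iota_add)

lemma vs: "vector_space (\<lambda>a z. \<iota> a * z)"
  by standard (auto simp: algebra_simps iota_add iota_mult)

lemma Q_ge_2: "CARD('k) \<ge> 2"
proof -
  have "card {0::'k, 1} \<le> CARD('k)" using fin by (intro card_mono) auto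
  then show ?thesis by simp
qed

lemma Q_power_inj: "CARD('k) ^ a = CARD('k) ^ b \<longleftrightarrow> a = b"
  by (rule power_inject_exp) (use Q_ge_2 in linarith)

lemma Q_power_le: "CARD('k) ^ a \<le> CARD('k) ^ b \<longleftrightarrow> a \<le> b"
  by (rule power_increasing_iff) (use Q_ge_2 in linarith)

lemma card_coeff_functions:
  assumes "finite B"
  shows "card (B \<rightarrow>\<^sub>E (UNIV :: 'k set)) = CARD('k) ^ card B"
  using assms by (simp add: card_PiE)

lemma card_subspace:
  assumes V: "finite V" "module.subspace (\<lambda>a z. \<iota> a * z) V"
  shows "card V = CARD('k) ^ vector_space.dim (\<lambda>a z. \<iota> a * z) V"
proof -
  interpret vector_space "\<lambda>a z. \<iota> a * z" by (rule vs)
  obtain B where B: "B \<subseteq> V" "independent B" "V \<subseteq> span B" "card B = dim V"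
    using basis_exists by blast
  have finB: "finite B" using B V finite_subset by blast
  have VB: "V = span B" using B V span_minimal by blast
  have "bij_betw (\<lambda>c. \<Sum>b\<in>B. \<iota> (c b) * b) (B \<rightarrow>\<^sub>E UNIV) V"
    unfolding bij_betw_def
  proof
    show "inj_on (\<lambda>c. \<Sum>b\<in>B. \<iota> (c b) * b) (B \<rightarrow>\<^sub>E UNIV)"
    proof (rule inj_onI)
      fix c d assume c: "c \<in> B \<rightarrow>\<^sub>E UNIV" and d: "d \<in> B \<rightarrow>\<^sub>E UNIV"
        and e: "(\<Sum>b\<in>B. \<iota> (c b) * b) = (\<Sum>b\<in>B. \<iota> (d b) * b)"
      then have "(\<Sum>b\<in>B. \<iota> (c b - d b) * b) = 0"
        by (simp add: iota_diff left_diff_distrib sum_subtractf)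
      then have "\<forall>b\<in>B. c b - d b = 0"
        using B(2) finB independentD[of B B "\<lambda>b. c b - d b"] by blast
      then show "c = d" using c d by (intro PiE_ext) auto
    qed
    show "(\<lambda>c. \<Sum>b\<in>B. \<iota> (c b) * b) ` (B \<rightarrow>\<^sub>E UNIV) = V"
    proof
      show "(\<lambda>c. \<Sum>b\<in>B. \<iota> (c b) * b) ` (B \<rightarrow>\<^sub>E UNIV) \<subseteq> V"
        unfolding VB span_finite[OF finB] by auto
      show "V \<subseteq> (\<lambda>c. \<Sum>b\<in>B. \<iota> (c b) * b) ` (B \<rightarrow>\<^sub>E UNIV)"
      proof
        fix z assume "z \<in> V"
        then obtain c where c: "z = (\<Sum>b\<in>B. \<iota> (c b) * b)" unfolding VB span_finite[OF finB] by auto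
        then have "z = (\<Sum>b\<in>B. \<iota> (restrict c B b) * b)" by (simp add: restrict_apply cong: sum.cong)
        moreover have "restrict c B \<in> B \<rightarrow>\<^sub>E UNIV" by simp
        ultimately show "z \<in> (\<lambda>c. \<Sum>b\<in>B. \<iota> (c b) * b) ` (B \<rightarrow>\<^sub>E UNIV)" by blast
      qed
    qed
  qed
  then have "card (B \<rightarrow>\<^sub>E (UNIV :: 'k set)) = card V" by (rule bij_betw_same_card)
  then show ?thesis using card_coeff_functions[OF finB] B by simp
qed

end

text \<open>Subtracting one chosen element maps each fibre injectively into K. The map f is
  arbitrary, as it will be a choice of residue representatives.\<close>

lemma card_le_fibres:
  fixes V K :: "'a::ab_group_add set"
  assumes V: "finite V" and T: "finite T" and K: "finite K" and f: "f ` V \<subseteq> T"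
    and d: "\<And>a b. a \<in> V \<Longrightarrow> b \<in> V \<Longrightarrow> f a = f b \<Longrightarrow> a - b \<in> K"
  shows "card V \<le> card K * card T"
proof -
  have "card V = (\<Sum>\<tau>\<in>T. card {a \<in> V. f a = \<tau>})"
    using sum.group[OF V T f, of "\<lambda>_. 1::nat"] by simp
  also have "\<dots> \<le> (\<Sum>\<tau>\<in>T. card K)"
  proof (rule sum_mono)
    fix \<tau> assume "\<tau> \<in> T"
    show "card {a \<in> V. f a = \<tau>} \<le> card K"
    proof (cases "{a \<in> V. f a = \<tau>} = {}")
      case False
      then obtain b where b: "b \<in> V" "f b = \<tau>" by auto
      have "(\<lambda>a. a - b) ` {a \<in> V. f a = \<tau>} \<subseteq> K" using d b by auto
      moreover have "inj_on (\<lambda>a. a - b) {a \<in> V. f a = \<tau>}" by (auto simp: inj_on_def)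
      ultimately show ?thesis using card_inj_on_le[of "\<lambda>a. a - b"] K by blast
    next
      case True
      then show ?thesis unfolding True by simp
    qed
  qed
  also have "\<dots> = card K * card T" by simp
  finally show ?thesis .
qed

locale place = const_field \<iota> for \<iota> :: "'k::field \<Rightarrow> 'f::field" +
  fixes R :: "'f set"
  assumes vr: "valuation_ring \<iota> R"
begin

abbreviation \<mm> :: "'f set" where "\<mm> \<equiv> max_ideal R"

lemma R_iota: "\<iota> c \<in> R" and R_add: "a \<in> R \<Longrightarrow> b \<in> R \<Longrightarrow> a + b \<in> R"
  and R_mult: "a \<in> R \<Longrightarrow> b \<in> R \<Longrightarrow> a * b \<in> R" and R_inv: "a \<in> R \<or> inverse a \<in> R"
  and R_not_UNIV: "R \<noteq> UNIV"
  using vr unfolding valuation_ring_def by auto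

lemma R_0: "0 \<in> R" and R_1: "1 \<in> R" using R_iota[of 0] R_iota[of 1] by auto

lemma R_minus: "a \<in> R \<Longrightarrow> - a \<in> R"
  using R_mult[OF R_iota[of "- 1"]] by (auto simp: iota_minus)

lemma R_diff: "a \<in> R \<Longrightarrow> b \<in> R \<Longrightarrow> a - b \<in> R"
  using R_add[OF _ R_minus] by force

lemma R_power: "a \<in> R \<Longrightarrow> a ^ n \<in> R"
  by (induction n) (auto intro: R_1 R_mult)

lemma R_sum: "(\<And>b. b \<in> B \<Longrightarrow> g b \<in> R) \<Longrightarrow> sum g B \<in> R"
  by (induction B rule: infinite_finite_induct) (auto intro: R_0 R_add)

lemma m_R: "a \<in> \<mm> \<Longrightarrow> a \<in> R" unfolding max_ideal_def by simp
lemma m_0: "0 \<in> \<mm>" unfolding max_ideal_def using R_0 by simp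

lemma unit_iff: "a \<in> R - \<mm> \<longleftrightarrow> a \<noteq> 0 \<and> a \<in> R \<and> inverse a \<in> R"
  unfolding max_ideal_def by auto

lemma unit_1: "1 \<in> R - \<mm>" unfolding unit_iff using R_1 by simp

lemma one_notin_m: "1 \<notin> \<mm>" using unit_1 by simp

lemma unit_mult: "a \<in> R - \<mm> \<Longrightarrow> b \<in> R - \<mm> \<Longrightarrow> a * b \<in> R - \<mm>"
  unfolding unit_iff by (auto intro: R_mult)

lemma unit_inverse: "a \<in> R - \<mm> \<Longrightarrow> inverse a \<in> R - \<mm>"
  unfolding unit_iff by auto

lemma unit_divide: "a \<in> R - \<mm> \<Longrightarrow> b \<in> R - \<mm> \<Longrightarrow> a / b \<in> R - \<mm>"
  unfolding divide_inverse by (intro unit_mult unit_inverse)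

lemma unit_power: "a \<in> R - \<mm> \<Longrightarrow> a ^ n \<in> R - \<mm>"
proof (induction n)
  case 0 then show ?case using unit_1 by simp
next
  case (Suc n) then show ?case using unit_mult by simp
qed

lemma unit_powi: "a \<in> R - \<mm> \<Longrightarrow> a powi n \<in> R - \<mm>"
  unfolding power_int_def using unit_power[of a] unit_power[of "inverse a"] unit_inverse[of a] by auto

lemma unit_iota: "c \<noteq> 0 \<Longrightarrow> \<iota> c \<in> R - \<mm>"
  unfolding unit_iff using R_iota by (auto simp flip: iota_inverse)

lemma m_mult: assumes "a \<in> R" "b \<in> \<mm>" shows "a * b \<in> \<mm>"
proof (rule ccontr)
  assume "a * b \<notin> \<mm>"
  then have "a * b \<in> R - \<mm>" using assms m_R R_mult by auto
  then have n: "a * b \<noteq> 0" "inverse (a * b) \<in> R" unfolding unit_iff by auto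
  then have "inverse b = a * inverse (a * b)" by simp
  then have "inverse b \<in> R" using R_mult[OF assms(1) n(2)] by metis
  then show False using assms n unfolding max_ideal_def by auto
qed

lemma m_mult2: "b \<in> \<mm> \<Longrightarrow> a \<in> R \<Longrightarrow> b * a \<in> \<mm>"
  using m_mult by (simp add: mult.commute)

lemma m_add: assumes "a \<in> \<mm>" "b \<in> \<mm>" shows "a + b \<in> \<mm>"
proof -
  have main: "a + b \<in> \<mm>" if "a / b \<in> R" "b \<in> \<mm>" "b \<noteq> 0" for a b
  proof -
    have "a + b = (a / b + 1) * b" using that by (simp add: field_simps)
    then show ?thesis using m_mult[OF R_add[OF that(1) R_1] that(2)] by simp
  qed
  consider "a = 0" | "b = 0" | "a \<noteq> 0" "b \<noteq> 0" by blast
  then show ?thesis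
  proof cases
    case 3
    have "a / b \<in> R \<or> b / a \<in> R" using R_inv[of "a / b"] by simp
    then show ?thesis using main[of a b] main[of b a] assms 3 by (auto simp: add.commute)
  qed (use assms in auto)
qed

lemma m_minus: "a \<in> \<mm> \<Longrightarrow> - a \<in> \<mm>"
  using m_mult[OF R_iota[of "- 1"], of a] by (simp add: iota_minus)

lemma m_diff: "a \<in> \<mm> \<Longrightarrow> b \<in> \<mm> \<Longrightarrow> a - b \<in> \<mm>"
  using m_add[OF _ m_minus] by force

lemma m_diff_sym: "a - b \<in> \<mm> \<Longrightarrow> b - a \<in> \<mm>"
  using m_minus[of "a - b"] by simp

lemma m_diff_trans: "a - b \<in> \<mm> \<Longrightarrow> b - c \<in> \<mm> \<Longrightarrow> a - c \<in> \<mm>"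
  using m_add[of "a - b" "b - c"] by simp

lemma unit_add_m: assumes "a \<in> R - \<mm>" "b \<in> \<mm>" shows "a + b \<in> R - \<mm>"
proof -
  have "a + b \<in> R" using assms R_add m_R by auto
  moreover have "a + b \<notin> \<mm>" using assms m_diff[of "a + b" b] by auto
  ultimately show ?thesis by simp
qed

lemma m_prime: "a * b \<in> \<mm> \<Longrightarrow> a \<in> R \<Longrightarrow> b \<in> R \<Longrightarrow> a \<in> \<mm> \<or> b \<in> \<mm>"
  using unit_mult by blast

lemma notin_R: "a \<notin> R \<Longrightarrow> inverse a \<in> \<mm>"
  using R_inv[of a] unfolding max_ideal_def by auto

lemma m_power: "a \<in> \<mm> \<Longrightarrow> n > 0 \<Longrightarrow> a ^ n \<in> \<mm>"
  using m_mult2[of a "a ^ (n - 1)"] R_power[of a "n - 1"] m_R by (cases n) auto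

lemma R_of_power: assumes "a ^ n \<in> R" "n > 0" shows "a \<in> R"
proof (rule ccontr)
  assume a: "a \<notin> R"
  then have "inverse a ^ n \<in> \<mm>" using notin_R m_power assms by blast
  then have "a ^ n * inverse a ^ n \<in> \<mm>" using m_mult assms by blast
  moreover have "a \<noteq> 0" using a R_0 by auto
  ultimately show False using one_notin_m by (simp flip: power_mult_distrib)
qed

lemma m_of_power: assumes "a ^ n \<in> \<mm>" "n > 0" shows "a \<in> \<mm>"
proof -
  have "a \<in> R" using assms R_of_power m_R by blast
  then show ?thesis using unit_power[of a n] assms by blast
qed

text \<open>Demanding the decomposition of every nonzero z makes this say that the valuation is
  discrete; in a valuation ring of higher rank, a generator of the maximal ideal gives no such
  decomposition.\<close>

definition unif :: "'f \<Rightarrow> bool" where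
  "unif t \<longleftrightarrow> t \<in> \<mm> \<and> t \<noteq> 0 \<and> (\<forall>z. z \<noteq> 0 \<longrightarrow> (\<exists>n. \<exists>u\<in>R - \<mm>. z = t powi n * u))"

lemma powi_in_m: "t \<in> \<mm> \<Longrightarrow> n > 0 \<Longrightarrow> t powi n \<in> \<mm>"
  using m_power[of t "nat n"] by (simp add: power_int_def)

lemma powi_unit_imp_0:
  assumes t: "t \<in> \<mm>" "t \<noteq> 0" and u: "t powi n \<in> R - \<mm>"
  shows "n = 0"
proof (rule ccontr)
  assume "n \<noteq> 0"
  then consider "n > 0" | "- n > 0" by linarith
  then show False
  proof cases
    case 1 then show False using powi_in_m[OF t(1)] u by blast
  next
    case 2
    then have "t powi (- n) \<in> \<mm>" using powi_in_m[OF t(1)] by blast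
    moreover have "t powi (- n) = inverse (t powi n)" by (rule power_int_minus)
    ultimately show False using unit_inverse[OF u] by auto
  qed
qed

lemma unif_m:
  assumes t: "unif t"
  shows "\<mm> = (\<lambda>a. t * a) ` R"
proof
  have tm: "t \<in> \<mm>" "t \<noteq> 0" using t unfolding unif_def by auto
  show "(\<lambda>a. t * a) ` R \<subseteq> \<mm>" using tm m_mult2 by auto
  show "\<mm> \<subseteq> (\<lambda>a. t * a) ` R"
  proof
    fix z assume z: "z \<in> \<mm>"
    show "z \<in> (\<lambda>a. t * a) ` R"
    proof (cases "z = 0")
      case True then show ?thesis using R_0 by (auto intro!: image_eqI[of _ _ 0])
    next
      case False
      then obtain n u where nu: "u \<in> R - \<mm>" "z = t powi n * u" using t unfolding unif_def by blast
      have "n > 0"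
      proof (rule ccontr)
        assume "\<not> n > 0"
        then have "t powi (- n) \<in> R" using R_power[OF m_R[OF tm(1)], of "nat (- n)"] by (simp add: power_int_def)
        then have "t powi (- n) * z \<in> \<mm>" using m_mult z by blast
        moreover have "t powi (- n) * z = u" using nu tm by (simp add: power_int_minus)
        ultimately show False using nu by blast
      qed
      then have "n = int (Suc (nat (n - 1)))" by simp
      then have "t powi n = t * t ^ nat (n - 1)" by (metis power_Suc power_int_of_nat)
      then have "z = t * (t ^ nat (n - 1) * u)" using nu by (simp add: mult_ac)
      moreover have "t ^ nat (n - 1) * u \<in> R" using R_mult R_power m_R[OF tm(1)] nu by blast
      ultimately show ?thesis by blast
    qed
  qed
qed

text \<open>The description in \<open>place_ord\<close> ranges over all generators of the maximal
  ideal. Each is a unit times t, so all of them give the same exponent.\<close>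

lemma place_ord_eq:
  assumes t: "unif t" and u: "u \<in> R - \<mm>" and z: "z = t powi n * u"
  shows "place_ord R z = n"
  unfolding place_ord_def
proof (rule the_equality)
  show "\<exists>t u. \<mm> = (\<lambda>a. t * a) ` R \<and> u \<in> R - \<mm> \<and> z = t powi n * u"
    using unif_m[OF t] u z by blast
next
  fix k assume "\<exists>t u. \<mm> = (\<lambda>a. t * a) ` R \<and> u \<in> R - \<mm> \<and> z = t powi k * u"
  then obtain t' u' where t': "\<mm> = (\<lambda>a. t' * a) ` R" and u': "u' \<in> R - \<mm>" and z': "z = t' powi k * u'" by blast
  have tm: "t \<in> \<mm>" "t \<noteq> 0" using t unfolding unif_def by auto
  obtain b where b: "b \<in> R" "t = t' * b" using tm t' by auto
  have "t' \<in> \<mm>" using t' R_1 by force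
  then obtain a where a: "a \<in> R" "t' = t * a" using unif_m[OF t] by auto
  have "t * (a * b) = t * 1" using a b by (simp add: mult_ac)
  then have "a * b = 1" using tm by (metis mult_left_cancel)
  then have ua: "a \<in> R - \<mm>" unfolding unit_iff using a b by (metis inverse_unique mult_zero_left zero_neq_one)
  have "t powi n * u = t powi k * (a powi k * u')"
    using z z' a by (simp add: power_int_mult_distrib mult_ac)
  moreover have uu: "a powi k * u' \<in> R - \<mm>" using unit_mult unit_powi ua u' by blast
  ultimately have "t powi (n - k) = (a powi k * u') / u"
    using tm u unfolding unit_iff by (simp add: power_int_diff field_simps)
  then have "t powi (n - k) \<in> R - \<mm>" using unit_divide uu u by simp
  then show "k = n" using powi_unit_imp_0[OF tm] by fastforce
qed

lemma unif_decomp: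
  assumes t: "unif t" and z: "z \<noteq> 0"
  shows "\<exists>u\<in>R - \<mm>. z = t powi (place_ord R z) * u"
  using place_ord_eq[OF t] t z unfolding unif_def by metis

lemma ord_mult:
  assumes t: "unif t" and z: "z \<noteq> 0" and w: "w \<noteq> 0"
  shows "place_ord R (z * w) = place_ord R z + place_ord R w"
proof -
  obtain u u' where u: "u \<in> R - \<mm>" "z = t powi (place_ord R z) * u"
    and u': "u' \<in> R - \<mm>" "w = t powi (place_ord R w) * u'" using unif_decomp[OF t] z w by metis
  have "t \<noteq> 0" using t unfolding unif_def by simp
  then have "z * w = t powi (place_ord R z + place_ord R w) * (u * u')"
    by (subst u(2), subst u'(2)) (simp add: power_int_add mult_ac)
  then show ?thesis using place_ord_eq[OF t unit_mult[OF u(1) u'(1)]] by simp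
qed

lemma ord_ge_iff:
  assumes t: "unif t" and z: "z \<noteq> 0"
  shows "place_ord R z \<ge> n \<longleftrightarrow> z / t powi n \<in> R"
proof -
  have tm: "t \<in> \<mm>" "t \<noteq> 0" using t unfolding unif_def by auto
  obtain u where u: "u \<in> R - \<mm>" "z = t powi (place_ord R z) * u" using unif_decomp[OF t z] by blast
  define k where "k = place_ord R z - n"
  have e: "z / t powi n = t powi k * u"
    by (subst u(2)) (use tm in \<open>simp add: power_int_diff k_def\<close>)
  show ?thesis
  proof
    assume "place_ord R z \<ge> n"
    then have "t powi k \<in> R" using R_power[OF m_R[OF tm(1)]] by (simp add: k_def power_int_def)
    then show "z / t powi n \<in> R" unfolding e using u R_mult by blast
  next
    assume a: "z / t powi n \<in> R"
    show "place_ord R z \<ge> n"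
    proof (rule ccontr)
      assume "\<not> ?thesis"
      then have "- k > 0" by (simp add: k_def)
      then have "t powi (- k) \<in> \<mm>" using powi_in_m tm by blast
      then have "t powi (- k) * (t powi k * u) \<in> \<mm>" using m_mult2 a e by simp
      moreover have "t powi (- k) * (t powi k * u) = u" using tm by (simp add: power_int_minus)
      ultimately show False using u by simp
    qed
  qed
qed

section \<open>Residue degrees by counting\<close>

definition transversal :: "'f set \<Rightarrow> bool" where
  "transversal T \<longleftrightarrow> finite T \<and> T \<subseteq> R \<and> (\<forall>z\<in>R. \<exists>\<tau>\<in>T. z - \<tau> \<in> \<mm>) \<and>
     (\<forall>\<tau>\<in>T. \<forall>\<tau>'\<in>T. \<tau> - \<tau>' \<in> \<mm> \<longrightarrow> \<tau> = \<tau>')"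

lemma transversal_card_le:
  assumes "transversal T" "transversal T'"
  shows "card T \<le> card T'"
proof -
  have "\<forall>\<tau>\<in>T. \<exists>\<tau>'\<in>T'. \<tau> - \<tau>' \<in> \<mm>" using assms unfolding transversal_def by blast
  then obtain f where f: "\<And>\<tau>. \<tau> \<in> T \<Longrightarrow> f \<tau> \<in> T' \<and> \<tau> - f \<tau> \<in> \<mm>" by metis
  have "inj_on f T"
  proof (rule inj_onI)
    fix a b assume "a \<in> T" "b \<in> T" "f a = f b"
    then have "a - b \<in> \<mm>" using f[of a] f[of b] m_diff_trans[of a "f a" b] m_diff_sym[of b "f b"] by simp
    then show "a = b" using assms \<open>a \<in> T\<close> \<open>b \<in> T\<close> unfolding transversal_def by blast
  qed
  then show ?thesis using f assms unfolding transversal_def by (intro card_inj_on_le) auto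
qed

definition indep :: "'f set \<Rightarrow> bool" where
  "indep B \<longleftrightarrow> finite B \<and> B \<subseteq> R \<and> (\<forall>c. (\<Sum>b\<in>B. \<iota> (c b) * b) \<in> \<mm> \<longrightarrow> (\<forall>b\<in>B. c b = 0))"

lemma indepD: "indep B \<Longrightarrow> (\<Sum>b\<in>B. \<iota> (c b) * b) \<in> \<mm> \<Longrightarrow> b \<in> B \<Longrightarrow> c b = 0"
  unfolding indep_def by auto

lemma lincomb_R: "B \<subseteq> R \<Longrightarrow> (\<Sum>b\<in>B. \<iota> (c b) * b) \<in> R"
  by (intro R_sum R_mult R_iota) auto

lemma indep_inj:
  assumes B: "indep B" and c: "c \<in> B \<rightarrow>\<^sub>E UNIV" and d: "d \<in> B \<rightarrow>\<^sub>E UNIV"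
    and e: "(\<Sum>b\<in>B. \<iota> (c b) * b) - (\<Sum>b\<in>B. \<iota> (d b) * b) \<in> \<mm>"
  shows "c = d"
proof -
  have "(\<Sum>b\<in>B. \<iota> (c b - d b) * b) \<in> \<mm>"
    using e by (simp add: iota_diff left_diff_distrib sum_subtractf)
  then have "c b - d b = 0" if "b \<in> B" for b by (rule indepD[OF B _ that, of "\<lambda>b. c b - d b"])
  then show ?thesis using c d by (intro PiE_ext) auto
qed

text \<open>Combinations with coefficients in k represent every residue class once. Counting them
  shows that all residue bases have the same size, which makes \<open>place_degree\<close> well
  defined.\<close>

lemma residue_basis_transversal:
  assumes B: "residue_basis \<iota> R B"
  shows "\<exists>T. transversal T \<and> card T = CARD('k) ^ card B"
proof -
  let ?f = "\<lambda>c. \<Sum>b\<in>B. \<iota> (c b) * b"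
  let ?T = "?f ` (B \<rightarrow>\<^sub>E UNIV)"
  have ind: "indep B" using B unfolding residue_basis_def indep_def by blast
  have finB: "finite B" and BR: "B \<subseteq> R" using B unfolding residue_basis_def by auto
  have "transversal ?T" unfolding transversal_def
  proof (intro conjI ballI impI)
    show "finite ?T" using finB fin by (intro finite_imageI finite_PiE) auto
    show "?T \<subseteq> R" using lincomb_R[OF BR] by auto
    fix z assume "z \<in> R"
    then obtain c where c: "z - ?f c \<in> \<mm>" using B unfolding residue_basis_def by blast
    have e: "?f c = ?f (restrict c B)" by (rule sum.cong) auto
    have "restrict c B \<in> B \<rightarrow>\<^sub>E UNIV" by simp
    then have m: "?f (restrict c B) \<in> ?T" by (rule imageI[of _ _ ?f])
    have "z - ?f (restrict c B) \<in> \<mm>" using c unfolding e .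
    then show "\<exists>\<tau>\<in>?T. z - \<tau> \<in> \<mm>" using m by (rule bexI)
  next
    fix \<tau> \<tau>' assume "\<tau> \<in> ?T" "\<tau>' \<in> ?T" "\<tau> - \<tau>' \<in> \<mm>"
    then show "\<tau> = \<tau>'" using indep_inj[OF ind] by blast
  qed
  moreover have "card ?T = CARD('k) ^ card B"
  proof -
    have "inj_on ?f (B \<rightarrow>\<^sub>E UNIV)" using indep_inj[OF ind] m_0 by (auto intro!: inj_onI)
    then show ?thesis using card_coeff_functions[OF finB] by (simp add: card_image)
  qed
  ultimately show ?thesis by blast
qed

lemma residue_basis_card:
  assumes "residue_basis \<iota> R B" "residue_basis \<iota> R B'"
  shows "card B = card B'"
proof -
  obtain T T' where "transversal T" "card T = CARD('k) ^ card B" "transversal T'" "card T' = CARD('k) ^ card B'"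
    using residue_basis_transversal assms by metis
  then have "CARD('k) ^ card B = CARD('k) ^ card B'" using transversal_card_le by (metis le_antisym)
  then show ?thesis by (simp only: Q_power_inj)
qed

lemma place_degree_eq:
  assumes "residue_basis \<iota> R B"
  shows "place_degree \<iota> R = card B"
  unfolding place_degree_def
proof (rule the_equality)
  show "\<exists>B'. residue_basis \<iota> R B' \<and> card B' = card B" using assms by blast
  show "n = card B" if "\<exists>B'. residue_basis \<iota> R B' \<and> card B' = n" for n
    using that residue_basis_card[OF assms] by auto
qed

text \<open>The finite covering W bounds independent sets B, since card B < CARD('k)^(card B) \<le>
  card W. A largest one spans: otherwise z could be added, because a relation with nonzero
  coefficient at z could be solved for z.\<close>

lemma residue_basis_exists:
  assumes W: "finite W" and cov: "\<And>z. z \<in> R \<Longrightarrow> \<exists>w\<in>W. z - w \<in> \<mm>"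
  shows "\<exists>B. residue_basis \<iota> R B"
proof -
  have bound: "card B \<le> card W" if B: "indep B" for B
  proof -
    let ?f = "\<lambda>c. \<Sum>b\<in>B. \<iota> (c b) * b"
    have finB: "finite B" and BR: "B \<subseteq> R" using B unfolding indep_def by auto
    have "\<forall>c. \<exists>w\<in>W. ?f c - w \<in> \<mm>" using cov lincomb_R[OF BR] by blast
    then obtain g where g: "\<And>c. g c \<in> W \<and> ?f c - g c \<in> \<mm>" by metis
    have "inj_on g (B \<rightarrow>\<^sub>E UNIV)"
    proof (rule inj_onI)
      fix c d :: "'f \<Rightarrow> 'k" assume c: "c \<in> B \<rightarrow>\<^sub>E UNIV" and d: "d \<in> B \<rightarrow>\<^sub>E UNIV" and "g c = g d"
      then have "?f c - ?f d \<in> \<mm>"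
        using g[of c] g[of d] m_diff_trans[of "?f c" "g c" "?f d"] m_diff_sym[of "?f d" "g d"] by simp
      then show "c = d" by (rule indep_inj[OF B c d])
    qed
    then have "card (B \<rightarrow>\<^sub>E (UNIV :: 'k set)) \<le> card W" using g W by (intro card_inj_on_le) auto
    then have "CARD('k) ^ card B \<le> card W" using card_coeff_functions[OF finB] by simp
    moreover have "card B < CARD('k) ^ card B" using Q_ge_2 by (intro power_gt_expt) auto
    ultimately show ?thesis by simp
  qed
  have "indep {}" unfolding indep_def by simp
  then obtain B where B: "indep B" and mx: "\<And>B'. indep B' \<Longrightarrow> card B' \<le> card B"
    using ex_has_greatest_nat[of indep "{}" card "Suc (card W)"] bound le_imp_less_Suc by blast
  have finB: "finite B" and BR: "B \<subseteq> R" using B unfolding indep_def by auto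
  have "\<exists>c. z - (\<Sum>b\<in>B. \<iota> (c b) * b) \<in> \<mm>" if z: "z \<in> R" for z
  proof (rule ccontr)
    assume no: "\<not> ?thesis"
    have zB: "z \<notin> B"
    proof
      assume "z \<in> B"
      have "(\<Sum>b\<in>B. \<iota> (if b = z then 1 else 0) * b) = (\<Sum>b\<in>B. if b = z then z else 0)"
        by (rule sum.cong) auto
      also have "\<dots> = z" using \<open>z \<in> B\<close> finB by simp
      finally show False using no m_0 by (metis diff_self)
    qed
    have "indep (insert z B)" unfolding indep_def
    proof (intro conjI allI impI ballI)
      show "finite (insert z B)" "insert z B \<subseteq> R" using finB BR z by auto
      fix c b assume "(\<Sum>b\<in>insert z B. \<iota> (c b) * b) \<in> \<mm>" and b: "b \<in> insert z B"
      then have s: "\<iota> (c z) * z + (\<Sum>b\<in>B. \<iota> (c b) * b) \<in> \<mm>" using zB finB by simp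
      have "c z = 0"
      proof (rule ccontr)
        assume cz: "c z \<noteq> 0"
        have "\<iota> (inverse (c z)) * (\<iota> (c z) * z + (\<Sum>b\<in>B. \<iota> (c b) * b)) \<in> \<mm>"
          using m_mult[OF R_iota s] .
        moreover have "\<iota> (inverse (c z)) * (\<iota> (c z) * z + (\<Sum>b\<in>B. \<iota> (c b) * b))
            = z - (\<Sum>b\<in>B. \<iota> (- (c b / c z)) * b)"
        proof -
          have "\<iota> (inverse (c z)) * (\<iota> (c z) * z) = z"
            using cz by (simp add: iota_inverse)
          moreover have "\<iota> (inverse (c z)) * (\<Sum>b\<in>B. \<iota> (c b) * b) = - (\<Sum>b\<in>B. \<iota> (- (c b / c z)) * b)"
          proof -
            have "\<iota> (inverse (c z)) * (\<Sum>b\<in>B. \<iota> (c b) * b) = (\<Sum>b\<in>B. \<iota> (c b / c z) * b)"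
              unfolding sum_distrib_left by (rule sum.cong) (simp_all add: iota_mult iota_inverse divide_inverse mult_ac)
            then show ?thesis by (simp add: iota_minus sum_negf)
          qed
          ultimately show ?thesis by (simp add: distrib_left)
        qed
        ultimately have "z - (\<Sum>b\<in>B. \<iota> (- (c b / c z)) * b) \<in> \<mm>" by (simp only:)
        then have "\<exists>c. z - (\<Sum>b\<in>B. \<iota> (c b) * b) \<in> \<mm>" by (rule exI[of _ "\<lambda>b. - (c b / c z)"])
        then show False using no by simp
      qed
      moreover from this have "(\<Sum>b\<in>B. \<iota> (c b) * b) \<in> \<mm>" using s by simp
      then have "\<forall>b\<in>B. c b = 0" using B unfolding indep_def by blast
      ultimately show "c b = 0" using b by blast
    qed
    then have "card (insert z B) \<le> card B" by (rule mx)
    then show False using zB finB by simp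
  qed
  then have "residue_basis \<iota> R B" using B unfolding residue_basis_def indep_def by blast
  then show ?thesis by blast
qed

lemma transversal_exists:
  assumes W: "finite W" and cov: "\<And>z. z \<in> R \<Longrightarrow> \<exists>w\<in>W. z - w \<in> \<mm>"
  shows "\<exists>T. transversal T \<and> card T = CARD('k) ^ place_degree \<iota> R"
  using residue_basis_exists[OF assms] residue_basis_transversal place_degree_eq by metis

lemma transversal_card_ge_2:
  assumes "transversal T"
  shows "card T \<ge> 2"
proof -
  obtain a b where a: "a \<in> T" "0 - a \<in> \<mm>" and b: "b \<in> T" "1 - b \<in> \<mm>"
    using assms R_0 R_1 unfolding transversal_def by meson
  have "a \<noteq> b"
  proof
    assume "a = b"
    then have "1 - 0 \<in> \<mm>" using a b m_diff[of "1 - b" "0 - a"] by simp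
    then show False using one_notin_m by simp
  qed
  then have "card {a, b} = 2" by simp
  moreover have "card {a, b} \<le> card T" using a b assms unfolding transversal_def by (intro card_mono) auto
  ultimately show ?thesis by simp
qed

end

section \<open>The coordinate ring\<close>

text \<open>The form a^3 + b^3 f + c^3 f^2 - 3 a b c f is the norm of a + b y + c y^2 with y^3 = f;
  the left-hand side inserts the coefficients of a product.\<close>

lemma norm_form_mult:
  fixes a b c a' b' c' f :: "'a::idom"
  shows "(a * a' + (b * c' + c * b') * f) ^ 3 + (a * b' + b * a' + c * c' * f) ^ 3 * f
      + (a * c' + b * b' + c * a') ^ 3 * f ^ 2
      - 3 * (a * a' + (b * c' + c * b') * f) * (a * b' + b * a' + c * c' * f) * (a * c' + b * b' + c * a') * f
    = (a ^ 3 + b ^ 3 * f + c ^ 3 * f ^ 2 - 3 * a * b * c * f)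
      * (a' ^ 3 + b' ^ 3 * f + c' ^ 3 * f ^ 2 - 3 * a' * b' * c' * f)"
  by algebra

lemma degree_dominant:
  fixes g :: "'a::comm_ring_1 poly"
  assumes "g \<noteq> 0" "q1 = 0 \<or> degree q1 < degree g" "q2 = 0 \<or> degree q2 < degree g" "q3 = 0 \<or> degree q3 < degree g"
  shows "g + q1 + q2 + q3 \<noteq> 0 \<and> degree (g + q1 + q2 + q3) = degree g"
proof -
  have step: "g + h \<noteq> 0 \<and> degree (g + h) = degree g" if "g \<noteq> 0" "h = 0 \<or> degree h < degree g" for g h :: "'a poly"
    using that degree_add_eq_left[of h g] by (auto simp: add_eq_0_iff)
  show ?thesis using step[of "g + q1 + q2" q3] step[of "g + q1" q2] step[of g q1] assms by auto
qed

text \<open>In \<open>norm_degree\<close>, a, b, c say that a coefficient polynomial is zero, so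
  that its weight u, v or w does not compete for the maximum.\<close>

lemma max_of_three:
  fixes u v w :: nat
  assumes "\<not> (a \<and> b \<and> c)" "u \<noteq> v" "u \<noteq> w" "v \<noteq> w"
  shows "(\<not> a \<and> (\<not> b \<longrightarrow> v < u) \<and> (\<not> c \<longrightarrow> w < u)) \<or> (\<not> b \<and> (\<not> a \<longrightarrow> u < v) \<and> (\<not> c \<longrightarrow> w < v))
    \<or> (\<not> c \<and> (\<not> a \<longrightarrow> u < w) \<and> (\<not> b \<longrightarrow> v < w))"
  using assms by arith

lemma le_iff_all_le_of_max:
  fixes u v w D N :: nat
  assumes "(a \<and> D = u \<and> (b \<longrightarrow> v < u) \<and> (c \<longrightarrow> w < u)) \<or> (b \<and> D = v \<and> (a \<longrightarrow> u < v) \<and> (c \<longrightarrow> w < v))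
    \<or> (c \<and> D = w \<and> (a \<longrightarrow> u < w) \<and> (b \<longrightarrow> v < w))"
  shows "D \<le> N \<longleftrightarrow> (a \<longrightarrow> u \<le> N) \<and> (b \<longrightarrow> v \<le> N) \<and> (c \<longrightarrow> w \<le> N)"
  using assms by arith

text \<open>The congruence of m modulo 3 separates the pole orders of 1, y, y^2 modulo 3. The
  conditions 2 m = 1 and 3 \<noteq> 0 in the field ensure smoothness of the affine curve.\<close>

locale cubic_field = const_field \<iota> for \<iota> :: "'k::field \<Rightarrow> 'f::field" +
  fixes p s m :: nat and x y :: 'f
  assumes p: "prime p" and cardk: "CARD('k) = p ^ s" and m3: "m mod 3 = 1" and m1: "m > 1"
    and m2: "2 * of_nat m = (1 :: 'f)" and three: "(3 :: 'k) \<noteq> 0"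
    and trans: "transcendental_over \<iota> x" and eq: "y ^ 3 = x ^ m + x"
    and gen: "adjoin \<iota> {x, y} = UNIV"
begin

definition e :: "'k poly \<Rightarrow> 'f" where "e A = poly (map_poly \<iota> A) x"

lemma e_0 [simp]: "e 0 = 0" unfolding e_def by simp

lemma e_pCons: "e (pCons c A) = \<iota> c + x * e A"
  unfolding e_def by (simp add: map_poly_pCons)

lemma e_const [simp]: "e [:c:] = \<iota> c" by (simp add: e_pCons)

lemma e_1 [simp]: "e 1 = 1" using e_const[of 1] by (simp del: e_const add: one_pCons)

lemma e_add: "e (A + B) = e A + e B"
  by (induction A B rule: poly_induct2) (auto simp: e_pCons iota_add algebra_simps)

lemma e_smult: "e (smult c A) = \<iota> c * e A"
  by (induction A) (auto simp: e_pCons iota_mult algebra_simps)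

lemma e_mult: "e (A * B) = e A * e B"
  by (induction A) (auto simp: e_pCons e_add e_smult algebra_simps)

lemma e_minus: "e (- A) = - e A"
  using e_add[of A "- A"] by (simp add: eq_neg_iff_add_eq_0 add.commute)

lemma e_diff: "e (A - B) = e A - e B"
  using e_add[of A "- B"] by (simp add: e_minus)

lemma e_power: "e (A ^ n) = e A ^ n"
  by (induction n) (auto simp: e_mult)

lemma e_monom: "e (monom c n) = \<iota> c * x ^ n"
  by (induction n) (auto simp: monom_0 monom_Suc e_pCons)

lemma e_of_nat: "e (of_nat n) = of_nat n"
  by (induction n) (auto simp: e_add)

lemma e_eq_0_iff [simp]: "e A = 0 \<longleftrightarrow> A = 0"
  using trans unfolding transcendental_over_def e_def by auto

definition fX :: "'k poly" where "fX = monom 1 m + monom 1 1"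

lemma e_fX: "e fX = y ^ 3"
  unfolding fX_def eq by (simp add: e_add e_monom)

lemma degree_fX: "degree fX = m"
  unfolding fX_def using m1 by (subst degree_add_eq_left) (auto simp: degree_monom_eq)

lemma fX_0: "fX \<noteq> 0" using degree_fX m1 by auto

definition P :: "'k poly \<Rightarrow> 'k poly \<Rightarrow> 'k poly \<Rightarrow> 'f" where
  "P A B C = e A + e B * y + e C * y ^ 2"

definition Nm :: "'k poly \<Rightarrow> 'k poly \<Rightarrow> 'k poly \<Rightarrow> 'k poly" where
  "Nm A B C = A ^ 3 + B ^ 3 * fX + C ^ 3 * fX ^ 2 - 3 * A * B * C * fX"

lemma P_add: "P A B C + P A' B' C' = P (A + A') (B + B') (C + C')"
  unfolding P_def by (simp add: e_add algebra_simps)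

lemma P_diff: "P A B C - P A' B' C' = P (A - A') (B - B') (C - C')"
  unfolding P_def by (simp add: e_diff algebra_simps)

lemma P_mult: "P A B C * P A' B' C' =
    P (A * A' + (B * C' + C * B') * fX) (A * B' + B * A' + C * C' * fX) (A * C' + B * B' + C * A')"
  unfolding P_def by (simp add: e_add e_mult e_fX algebra_simps power2_eq_square power3_eq_cube)

text \<open>The cofactor is the product of the conjugates under y -> zeta y and y -> zeta^2 y, for a
  primitive cube root of unity zeta, multiplied out so that zeta disappears. Thus \<open>Nm\<close>
  is the norm from k(x, y) to k(x).\<close>

lemma P_conj: "P A B C * P (A ^ 2 - B * C * fX) (C ^ 2 * fX - A * B) (B ^ 2 - A * C) = e (Nm A B C)"
proof -
  have e3: "e 3 = 3" using e_of_nat[of 3] by simp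
  show ?thesis
    unfolding P_def Nm_def e_add e_diff e_mult e_power e_fX e3 by algebra
qed

text \<open>The three terms of \<open>A + B y + C y\<^sup>2\<close> have pairwise different pole orders
  \<open>3 deg A\<close>, \<open>3 deg B + m\<close>, \<open>3 deg C + 2 m\<close> at infinity, because \<open>m \<equiv> 1 (mod 3)\<close>.\<close>

lemma norm_degree:
  assumes "\<not> (A = 0 \<and> B = 0 \<and> C = 0)"
  shows "Nm A B C \<noteq> 0 \<and>
    ((A \<noteq> 0 \<and> degree (Nm A B C) = 3 * degree A \<and>
        (B \<noteq> 0 \<longrightarrow> 3 * degree B + m < 3 * degree A) \<and> (C \<noteq> 0 \<longrightarrow> 3 * degree C + 2 * m < 3 * degree A)) \<or>
     (B \<noteq> 0 \<and> degree (Nm A B C) = 3 * degree B + m \<and>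
        (A \<noteq> 0 \<longrightarrow> 3 * degree A < 3 * degree B + m) \<and> (C \<noteq> 0 \<longrightarrow> 3 * degree C + 2 * m < 3 * degree B + m)) \<or>
     (C \<noteq> 0 \<and> degree (Nm A B C) = 3 * degree C + 2 * m \<and>
        (A \<noteq> 0 \<longrightarrow> 3 * degree A < 3 * degree C + 2 * m) \<and> (B \<noteq> 0 \<longrightarrow> 3 * degree B + m < 3 * degree C + 2 * m)))"
proof -
  define T1 where "T1 = A ^ 3"
  define T2 where "T2 = B ^ 3 * fX"
  define T3 where "T3 = C ^ 3 * fX ^ 2"
  define T4 where "T4 = - (3 * A * B * C * fX)"
  have N: "Nm A B C = T1 + T2 + T3 + T4" unfolding Nm_def T1_def T2_def T3_def T4_def by simp
  have d1: "T1 = 0 \<longleftrightarrow> A = 0" "A \<noteq> 0 \<Longrightarrow> degree T1 = 3 * degree A"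
    unfolding T1_def by (auto simp: degree_power_eq)
  have d2: "T2 = 0 \<longleftrightarrow> B = 0" "B \<noteq> 0 \<Longrightarrow> degree T2 = 3 * degree B + m"
    unfolding T2_def using fX_0 by (auto simp: degree_power_eq degree_mult_eq degree_fX)
  have d3: "T3 = 0 \<longleftrightarrow> C = 0" "C \<noteq> 0 \<Longrightarrow> degree T3 = 3 * degree C + 2 * m"
    unfolding T3_def using fX_0 by (auto simp: degree_power_eq degree_mult_eq degree_fX)
  have d4: "A = 0 \<or> B = 0 \<or> C = 0 \<Longrightarrow> T4 = 0" unfolding T4_def by auto
  \<comment> \<open>The bound is the mean of the three degrees 3 deg A, 3 deg B + m, 3 deg C + 2 m.
    These are distinct, so the mixed term stays below their maximum.\<close>
  have d4': "degree T4 \<le> degree A + degree B + degree C + m"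
  proof -
    have "T4 = smult (- 3) (A * B * C * fX)" unfolding T4_def
      by (simp add: mult.assoc numeral_poly)
    then have "degree T4 \<le> degree (A * B * C * fX)" using degree_smult_le by metis
    also have "\<dots> \<le> degree (A * B * C) + degree fX" by (rule degree_mult_le)
    also have "\<dots> \<le> degree (A * B) + degree C + degree fX" using degree_mult_le[of "A * B" C] by simp
    also have "\<dots> \<le> degree A + degree B + degree C + degree fX" using degree_mult_le[of A B] by simp
    finally show ?thesis using degree_fX by simp
  qed
  have ne: "3 * degree A \<noteq> 3 * degree B + m" "3 * degree A \<noteq> 3 * degree C + 2 * m"
    "3 * degree B + m \<noteq> 3 * degree C + 2 * m" using m3 by presburger+
  consider (1) "A \<noteq> 0" "B \<noteq> 0 \<longrightarrow> 3 * degree B + m < 3 * degree A" "C \<noteq> 0 \<longrightarrow> 3 * degree C + 2 * m < 3 * degree A"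
    | (2) "B \<noteq> 0" "A \<noteq> 0 \<longrightarrow> 3 * degree A < 3 * degree B + m" "C \<noteq> 0 \<longrightarrow> 3 * degree C + 2 * m < 3 * degree B + m"
    | (3) "C \<noteq> 0" "A \<noteq> 0 \<longrightarrow> 3 * degree A < 3 * degree C + 2 * m" "B \<noteq> 0 \<longrightarrow> 3 * degree B + m < 3 * degree C + 2 * m"
    using max_of_three[OF assms ne] by blast
  then show ?thesis
  proof cases
    case 1
    have "T2 = 0 \<or> degree T2 < degree T1" "T3 = 0 \<or> degree T3 < degree T1" using 1 d1 d2 d3 by auto
    moreover have "T4 = 0 \<or> degree T4 < degree T1" using 1 d1 d4 d4' by fastforce
    ultimately have "T1 + T2 + T3 + T4 \<noteq> 0 \<and> degree (T1 + T2 + T3 + T4) = degree T1"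
      using degree_dominant[of T1 T2 T3 T4] 1 d1 by simp
    then show ?thesis using 1 d1 unfolding N by auto
  next
    case 2
    have "T1 = 0 \<or> degree T1 < degree T2" "T3 = 0 \<or> degree T3 < degree T2" using 2 d1 d2 d3 by auto
    moreover have "T4 = 0 \<or> degree T4 < degree T2" using 2 d2 d4 d4' by fastforce
    ultimately have "T2 + T1 + T3 + T4 \<noteq> 0 \<and> degree (T2 + T1 + T3 + T4) = degree T2"
      using degree_dominant[of T2 T1 T3 T4] 2 d2 by simp
    then show ?thesis using 2 d2 unfolding N by (auto simp: add_ac)
  next
    case 3
    have "T1 = 0 \<or> degree T1 < degree T3" "T2 = 0 \<or> degree T2 < degree T3" using 3 d1 d2 d3 by auto
    moreover have "T4 = 0 \<or> degree T4 < degree T3" using 3 d3 d4 d4' by fastforce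
    ultimately have "T3 + T1 + T2 + T4 \<noteq> 0 \<and> degree (T3 + T1 + T2 + T4) = degree T3"
      using degree_dominant[of T3 T1 T2 T4] 3 d3 by simp
    then show ?thesis using 3 d3 unfolding N by (auto simp: add_ac)
  qed
qed

lemma Nm_0 [simp]: "Nm 0 0 0 = 0" unfolding Nm_def by simp
lemma P_0 [simp]: "P 0 0 0 = 0" unfolding P_def by simp

text \<open>A nonzero norm excludes P A B C = 0. So 1, y, y^2 are independent over k[x], by a
  comparison of pole orders instead of the irreducibility of Y^3 - X^m - X.\<close>

lemma P_eq_0_iff: "P A B C = 0 \<longleftrightarrow> A = 0 \<and> B = 0 \<and> C = 0"
proof
  assume "P A B C = 0"
  then have "e (Nm A B C) = 0" using P_conj[of A B C] by simp
  then show "A = 0 \<and> B = 0 \<and> C = 0" using norm_degree by auto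
qed auto

lemma P_inj: "P A B C = P A' B' C' \<longleftrightarrow> A = A' \<and> B = B' \<and> C = C'"
  using P_eq_0_iff[of "A - A'" "B - B'" "C - C'"] by (auto simp flip: P_diff)

definition \<O> :: "'f set" where "\<O> = {z. \<exists>A B C. z = P A B C}"

lemma O_P: "P A B C \<in> \<O>" unfolding \<O>_def by blast

lemma O_add: "a \<in> \<O> \<Longrightarrow> b \<in> \<O> \<Longrightarrow> a + b \<in> \<O>"
  unfolding \<O>_def using P_add by blast

lemma O_diff: "a \<in> \<O> \<Longrightarrow> b \<in> \<O> \<Longrightarrow> a - b \<in> \<O>"
  unfolding \<O>_def using P_diff by blast

lemma O_mult: "a \<in> \<O> \<Longrightarrow> b \<in> \<O> \<Longrightarrow> a * b \<in> \<O>"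
  unfolding \<O>_def using P_mult by blast

lemma O_e: "e A \<in> \<O>" using O_P[of A 0 0] by (simp add: P_def)
lemma O_iota: "\<iota> c \<in> \<O>" using O_e[of "[:c:]"] by simp
lemma O_0: "0 \<in> \<O>" using O_e[of 0] by simp
lemma O_1: "1 \<in> \<O>" using O_e[of 1] by simp
lemma O_x: "x \<in> \<O>" using O_e[of "[:0, 1:]"] by (simp add: e_pCons)
lemma O_y: "y \<in> \<O>" using O_P[of 0 1 0] by (simp add: P_def)
lemma O_minus: "a \<in> \<O> \<Longrightarrow> - a \<in> \<O>" using O_diff[OF O_0] by force
lemma O_power: "a \<in> \<O> \<Longrightarrow> a ^ n \<in> \<O>" by (induction n) (auto intro: O_1 O_mult)
lemma O_of_nat: "of_nat n \<in> \<O>" using O_iota[of "of_nat n"] by (simp add: iota_of_nat)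
lemma O_prod: "(\<And>b. b \<in> B \<Longrightarrow> g b \<in> \<O>) \<Longrightarrow> prod g B \<in> \<O>"
  by (induction B rule: infinite_finite_induct) (auto intro: O_1 O_mult)

lemmas O_intros = O_add O_diff O_mult O_e O_iota O_0 O_1 O_x O_y O_minus O_power O_of_nat

lemma O_induct [consumes 1, case_names iota x y add mult]:
  assumes z: "z \<in> \<O>" and iota: "\<And>c. G (\<iota> c)" and x: "G x" and y: "G y"
    and add: "\<And>a b. a \<in> \<O> \<Longrightarrow> b \<in> \<O> \<Longrightarrow> G a \<Longrightarrow> G b \<Longrightarrow> G (a + b)"
    and mult: "\<And>a b. a \<in> \<O> \<Longrightarrow> b \<in> \<O> \<Longrightarrow> G a \<Longrightarrow> G b \<Longrightarrow> G (a * b)"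
  shows "G z"
proof -
  have Ge: "G (e A)" for A
  proof (induction A)
    case 0 then show ?case using iota[of 0] by simp
  next
    case (pCons c A) then show ?case unfolding e_pCons by (intro add mult iota x O_intros)
  qed
  obtain A B C where "z = P A B C" using z unfolding \<O>_def by blast
  moreover have "G (P A B C)" unfolding P_def power2_eq_square
    by (intro add mult Ge y O_intros)
  ultimately show ?thesis by simp
qed

section \<open>Pole orders at infinity and dimension counts\<close>

definition nm :: "'f \<Rightarrow> 'k poly" where "nm z = (THE N. \<exists>A B C. z = P A B C \<and> N = Nm A B C)"

lemma nm_P: "nm (P A B C) = Nm A B C"
  unfolding nm_def by (rule the_equality) (auto simp: P_inj)

lemma nm_mult: assumes "z \<in> \<O>" "w \<in> \<O>" shows "nm (z * w) = nm z * nm w"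
proof -
  obtain A B C A' B' C' where "z = P A B C" "w = P A' B' C'" using assms unfolding \<O>_def by blast
  then show ?thesis by (simp only: P_mult nm_P) (simp only: Nm_def norm_form_mult)
qed

lemma nm_eq_0_iff: assumes "z \<in> \<O>" shows "nm z = 0 \<longleftrightarrow> z = 0"
proof -
  obtain A B C where "z = P A B C" using assms unfolding \<O>_def by blast
  then show ?thesis using norm_degree[of A B C] by (auto simp: nm_P P_eq_0_iff)
qed

text \<open>The pole order at infinity; the place itself appears only later.\<close>

definition d :: "'f \<Rightarrow> nat" where "d z = degree (nm z)"

lemma d_mult: "z \<in> \<O> \<Longrightarrow> w \<in> \<O> \<Longrightarrow> z \<noteq> 0 \<Longrightarrow> w \<noteq> 0 \<Longrightarrow> d (z * w) = d z + d w"
  unfolding d_def by (simp add: nm_mult degree_mult_eq nm_eq_0_iff)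

lemma nm_e: "nm (e A) = A ^ 3"
  using nm_P[of A 0 0] by (simp add: P_def Nm_def)

lemma d_e: "d (e A) = 3 * degree A"
  unfolding d_def nm_e by (cases "A = 0") (auto simp: degree_power_eq)

lemma d_x: "d x = 3"
  using d_e[of "[:0, 1:]"] by (simp add: e_pCons)

lemma d_iota: "d (\<iota> c) = 0"
  using d_e[of "[:c:]"] by simp

definition L :: "nat \<Rightarrow> 'f set" where "L N = {z \<in> \<O>. z = 0 \<or> d z \<le> N}"

lemma P_in_L_iff: "P A B C \<in> L N \<longleftrightarrow> (A \<noteq> 0 \<longrightarrow> 3 * degree A \<le> N) \<and> (B \<noteq> 0 \<longrightarrow> 3 * degree B + m \<le> N)
    \<and> (C \<noteq> 0 \<longrightarrow> 3 * degree C + 2 * m \<le> N)"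
proof (cases "A = 0 \<and> B = 0 \<and> C = 0")
  case True
  then show ?thesis using O_0 unfolding L_def by simp
next
  case False
  then have "P A B C \<noteq> 0" by (simp add: P_eq_0_iff)
  then have "P A B C \<in> L N \<longleftrightarrow> degree (Nm A B C) \<le> N" using O_P[of A B C] unfolding L_def d_def by (simp add: nm_P)
  then show ?thesis using le_iff_all_le_of_max[OF norm_degree[OF False, THEN conjunct2]] by simp
qed

lemma L_O: "z \<in> L N \<Longrightarrow> z \<in> \<O>" unfolding L_def by simp

lemma L_diff: assumes "z \<in> L N" "w \<in> L N" shows "z - w \<in> L N"
proof -
  obtain A B C A' B' C' where e: "z = P A B C" "w = P A' B' C'"
    using L_O[OF assms(1)] L_O[OF assms(2)] unfolding \<O>_def by blast
  have deg: "3 * degree (A - A') + k \<le> N" if "A - A' \<noteq> 0" "A \<noteq> 0 \<longrightarrow> 3 * degree A + k \<le> N" "A' \<noteq> 0 \<longrightarrow> 3 * degree A' + k \<le> N"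
    for A A' :: "'k poly" and k
  proof -
    have "degree (A - A') \<le> max (degree A) (degree A')" by (rule degree_diff_le_max)
    then show ?thesis using that by (cases "A = 0"; cases "A' = 0") auto
  qed
  show ?thesis using assms deg[of A A' 0] deg[of B B' m] deg[of C C' "2 * m"] unfolding e P_diff P_in_L_iff by auto
qed

lemma L_mult_iota: "z \<in> L N \<Longrightarrow> \<iota> c * z \<in> L N"
  using d_mult[OF O_iota, of z c] O_mult[OF O_iota, of z c] O_0 unfolding L_def
  by (cases "c = 0"; cases "z = 0") (auto simp: d_iota)

lemma L_add: "z \<in> L N \<Longrightarrow> w \<in> L N \<Longrightarrow> z + w \<in> L N"
  using L_diff[of z N "- w"] L_mult_iota[of w N "- 1"] by (simp add: iota_minus)

lemma L_mono: "N \<le> N' \<Longrightarrow> L N \<subseteq> L N'" unfolding L_def by auto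

lemma L_0: "0 \<in> L N" unfolding L_def using O_0 by simp

lemma card_polys_degree_le: "card {A :: 'k poly. degree A \<le> n} = CARD('k) ^ (n + 1) \<and> finite {A :: 'k poly. degree A \<le> n}"
proof (induction n)
  case 0
  have "{A :: 'k poly. degree A \<le> 0} = (\<lambda>c. [:c:]) ` UNIV"
    by (auto elim: degree_eq_zeroE)
  moreover have "inj (\<lambda>c::'k. [:c:])" by (rule injI) simp
  ultimately show ?case using fin by (simp add: card_image)
next
  case (Suc n)
  have "bij_betw (\<lambda>(c, A). pCons c A) (UNIV \<times> {A :: 'k poly. degree A \<le> n}) {A. degree A \<le> Suc n}"
    unfolding bij_betw_def
  proof
    show "inj_on (\<lambda>(c, A). pCons c A) (UNIV \<times> {A :: 'k poly. degree A \<le> n})" by (auto simp: inj_on_def)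
    show "(\<lambda>(c, A). pCons c A) ` (UNIV \<times> {A :: 'k poly. degree A \<le> n}) = {A. degree A \<le> Suc n}"
    proof
      show "(\<lambda>(c, A). pCons c A) ` (UNIV \<times> {A :: 'k poly. degree A \<le> n}) \<subseteq> {A. degree A \<le> Suc n}"
        by (auto simp: degree_pCons_eq_if)
      show "{A. degree A \<le> Suc n} \<subseteq> (\<lambda>(c, A). pCons c A) ` (UNIV \<times> {A :: 'k poly. degree A \<le> n})"
      proof
        fix A :: "'k poly" assume A: "A \<in> {A. degree A \<le> Suc n}"
        obtain c B where B: "A = pCons c B" by (metis pCons_cases)
        then have "degree B \<le> n" using A by (auto simp: degree_pCons_eq_if split: if_splits)
        then show "A \<in> (\<lambda>(c, A). pCons c A) ` (UNIV \<times> {A :: 'k poly. degree A \<le> n})" using B by auto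
      qed
    qed
  qed
  then have "card {A :: 'k poly. degree A \<le> Suc n} = card ((UNIV :: 'k set) \<times> {A :: 'k poly. degree A \<le> n})"
    "finite {A :: 'k poly. degree A \<le> Suc n}"
    using Suc fin bij_betw_same_card bij_betw_finite by (metis, metis finite_cartesian_product)
  then show ?case using Suc by (simp add: card_cartesian_product)
qed

lemma L_image:
  assumes N: "2 * m \<le> N"
  shows "L N = (\<lambda>(A, B, C). P A B C) ` ({A. degree A \<le> N div 3} \<times> {B. degree B \<le> (N - m) div 3} \<times> {C. degree C \<le> (N - 2 * m) div 3})"
proof -
  have d1: "(A \<noteq> 0 \<longrightarrow> 3 * degree A \<le> N) \<longleftrightarrow> degree A \<le> N div 3" for A :: "'k poly" by auto
  have d2: "(A \<noteq> 0 \<longrightarrow> 3 * degree A + k \<le> N) \<longleftrightarrow> degree A \<le> (N - k) div 3" if "k \<le> N" for A :: "'k poly" and k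
    using that by auto
  have "P A B C \<in> L N \<longleftrightarrow> degree A \<le> N div 3 \<and> degree B \<le> (N - m) div 3 \<and> degree C \<le> (N - 2 * m) div 3" for A B C
    unfolding P_in_L_iff d1 using d2[of m B] d2[of "2 * m" C] N by simp
  then show ?thesis using L_O unfolding \<O>_def by (auto simp: image_iff) blast
qed

text \<open>The degree bounds are N, N - m and N - 2 m divided by 3 and rounded down. These numbers
  lie in the three different classes modulo 3, so the rounding costs exactly 1 in total and the
  dimension is (3 N - 3 m) / 3 - 1 + 3.\<close>

lemma card_L:
  assumes N: "2 * m \<le> N"
  shows "card (L N) = CARD('k) ^ (N + 2 - m)" and "finite (L N)"
proof -
  let ?S = "{A :: 'k poly. degree A \<le> N div 3} \<times> {B :: 'k poly. degree B \<le> (N - m) div 3} \<times> {C :: 'k poly. degree C \<le> (N - 2 * m) div 3}"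
  have "inj_on (\<lambda>(A, B, C). P A B C) ?S" by (auto simp: inj_on_def P_inj)
  then have "card (L N) = card ?S" unfolding L_image[OF N] by (rule card_image)
  also have "\<dots> = CARD('k) ^ ((N div 3 + 1) + ((N - m) div 3 + 1) + ((N - 2 * m) div 3 + 1))"
    by (simp only: card_cartesian_product card_polys_degree_le[THEN conjunct1] power_add mult.assoc)
  also have "(N div 3 + 1) + ((N - m) div 3 + 1) + ((N - 2 * m) div 3 + 1) = N + 2 - m"
  proof -
    obtain l where l: "m = 3 * l + 1" using m3 by (metis mult_div_mod_eq)
    obtain n where n: "N = 2 * m + n" using N le_Suc_ex by blast
    have "N div 3 = 2 * l + (n + 2) div 3" "(N - m) div 3 = l + (n + 1) div 3" "(N - 2 * m) div 3 = n div 3"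
      unfolding n l by simp_all
    moreover have "(n + 2) div 3 + (n + 1) div 3 + n div 3 = n"
    proof -
      obtain k j where kj: "n = 3 * k + j" "j < 3" by (metis mult_div_mod_eq mod_less_divisor zero_less_numeral)
      then have "j = 0 \<or> j = 1 \<or> j = 2" by linarith
      moreover have D: "(3 * k + c) div 3 = k + c div 3" for c by simp
      ultimately show ?thesis unfolding kj(1) add.assoc D by (elim disjE) simp_all
    qed
    ultimately show ?thesis unfolding n l by simp
  qed
  finally show "card (L N) = CARD('k) ^ (N + 2 - m)" .
  show "finite (L N)" unfolding L_image[OF N] using card_polys_degree_le by (intro finite_imageI finite_cartesian_product) auto
qed

lemma finite_L: "finite (L N)"
  using card_L(2)[of "N + 2 * m"] L_mono[of N "N + 2 * m"] finite_subset by auto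

lemma fraction: "\<exists>a\<in>\<O>. \<exists>b\<in>\<O>. b \<noteq> 0 \<and> z = a / b"
proof -
  let ?S = "{z. \<exists>a\<in>\<O>. \<exists>b\<in>\<O>. b \<noteq> 0 \<and> z = a / b}"
  have OS: "a \<in> ?S" if "a \<in> \<O>" for a
    by (rule CollectI, rule bexI[of _ a], rule bexI[of _ 1]) (use that O_1 in auto)
  have "is_subfield ?S" unfolding is_subfield_def
  proof (intro conjI ballI)
    show "0 \<in> ?S" "1 \<in> ?S" using OS O_0 O_1 by blast+
    fix a b assume "a \<in> ?S" "b \<in> ?S"
    then obtain u v u' v' where h: "u \<in> \<O>" "v \<in> \<O>" "v \<noteq> 0" "a = u / v" "u' \<in> \<O>" "v' \<in> \<O>" "v' \<noteq> 0" "b = u' / v'" by auto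
    have "a + b = (u * v' + u' * v) / (v * v')" "a * b = (u * u') / (v * v')"
      using h by (auto simp: field_simps)
    moreover have "u * v' + u' * v \<in> \<O>" "u * u' \<in> \<O>" "v * v' \<in> \<O>" "v * v' \<noteq> 0" using h by (auto intro: O_intros)
    ultimately show "a + b \<in> ?S" "a * b \<in> ?S" by blast+
  next
    fix a assume "a \<in> ?S"
    then obtain u v where h: "u \<in> \<O>" "v \<in> \<O>" "v \<noteq> 0" "a = u / v" by auto
    have "- a = (- u) / v" using h by simp
    then show "- a \<in> ?S" using h O_minus by blast
    show "inverse a \<in> ?S"
    proof (cases "u = 0")
      case True
      then show ?thesis using h OS[OF O_0] by simp
    next
      case False
      then have "inverse a = v / u" using h by simp
      then show ?thesis using h False by blast
    qed
  qed
  moreover have "range \<iota> \<subseteq> ?S" "{x, y} \<subseteq> ?S" using OS O_iota O_x O_y by blast+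
  ultimately have "adjoin \<iota> {x, y} \<subseteq> ?S" unfolding adjoin_def by blast
  then show ?thesis using gen by auto
qed

text \<open>This bounds the size of O / h O: for large N the sums \<tau> + h z with z in L(N) are
  distinct elements of L(N + d h), and the dimensions of the two spaces differ by d h.\<close>

lemma separated_card_le:
  assumes T: "finite T" "T \<subseteq> \<O>" and h: "h \<in> \<O>" "h \<noteq> 0"
    and sep: "\<And>\<tau> \<tau>' g. \<tau> \<in> T \<Longrightarrow> \<tau>' \<in> T \<Longrightarrow> g \<in> \<O> \<Longrightarrow> \<tau> - \<tau>' = h * g \<Longrightarrow> \<tau> = \<tau>'"
  shows "card T \<le> CARD('k) ^ d h"
proof -
  define N where "N = 2 * m + (\<Sum>\<tau>\<in>T. d \<tau>)"
  have TL: "T \<subseteq> L (N + d h)"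
  proof
    fix \<tau> assume \<tau>: "\<tau> \<in> T"
    then have "d \<tau> \<le> (\<Sum>\<tau>\<in>T. d \<tau>)" using T by (intro member_le_sum) auto
    then show "\<tau> \<in> L (N + d h)" using \<tau> T unfolding L_def N_def by auto
  qed
  have hL: "h * z \<in> L (N + d h)" if "z \<in> L N" for z
    using that h d_mult[of h z] O_mult[of h z] O_0 unfolding L_def by (cases "z = 0") auto
  let ?f = "\<lambda>(\<tau>, z). \<tau> + h * z"
  have "inj_on ?f (T \<times> L N)"
  proof (rule inj_onI, clarify)
    fix \<tau> z \<tau>' z' assume a: "\<tau> \<in> T" "z \<in> L N" "\<tau>' \<in> T" "z' \<in> L N" "\<tau> + h * z = \<tau>' + h * z'"
    then have "\<tau> - \<tau>' = h * (z' - z)" by (simp add: algebra_simps)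
    moreover have "z' - z \<in> \<O>" using a L_O O_diff by blast
    ultimately have "\<tau> = \<tau>'" using sep a by blast
    then show "\<tau> = \<tau>' \<and> z = z'" using a h by simp
  qed
  moreover have "?f ` (T \<times> L N) \<subseteq> L (N + d h)" using TL hL L_add by fastforce
  ultimately have "card (T \<times> L N) \<le> card (L (N + d h))"
    using finite_L card_inj_on_le by blast
  then have "card T * CARD('k) ^ (N + 2 - m) \<le> CARD('k) ^ (N + d h + 2 - m)"
    using card_L(1)[of N] card_L(1)[of "N + d h"] by (simp add: card_cartesian_product N_def)
  also have "N + d h + 2 - m = d h + (N + 2 - m)" unfolding N_def by simp
  finally have "card T * CARD('k) ^ (N + 2 - m) \<le> CARD('k) ^ d h * CARD('k) ^ (N + 2 - m)" by (simp add: power_add)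
  then show ?thesis using Q_ge_2 by simp
qed

text \<open>A set of pairwise incongruent elements of maximal size meets every class.\<close>

lemma finite_cover:
  assumes h: "h \<in> \<O>" "h \<noteq> 0"
  shows "\<exists>W. finite W \<and> W \<subseteq> \<O> \<and> (\<forall>z\<in>\<O>. \<exists>w\<in>W. \<exists>g\<in>\<O>. z - w = h * g)"
proof -
  define S where "S T \<longleftrightarrow> finite T \<and> T \<subseteq> \<O> \<and>
    (\<forall>\<tau>\<in>T. \<forall>\<tau>'\<in>T. (\<exists>g\<in>\<O>. \<tau> - \<tau>' = h * g) \<longrightarrow> \<tau> = \<tau>')" for T
  have bound: "card T < Suc (CARD('k) ^ d h)" if "S T" for T
    using that separated_card_le[of T h] h unfolding S_def by (meson le_imp_less_Suc)
  have "S {}" unfolding S_def by simp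
  then obtain T where T: "S T" and mx: "\<And>T'. S T' \<Longrightarrow> card T' \<le> card T"
    using ex_has_greatest_nat[of S "{}" card] bound by blast
  have "\<exists>w\<in>T. \<exists>g\<in>\<O>. z - w = h * g" if z: "z \<in> \<O>" for z
  proof (rule ccontr)
    assume no: "\<not> ?thesis"
    have sym: "\<exists>g\<in>\<O>. a - b = h * g \<Longrightarrow> \<exists>g\<in>\<O>. b - a = h * g" for a b
    proof -
      assume "\<exists>g\<in>\<O>. a - b = h * g"
      then obtain g' where "g' \<in> \<O>" "a - b = h * g'" by blast
      then have "b - a = h * (- g')" "- g' \<in> \<O>" using O_minus by (auto simp: algebra_simps)
      then show ?thesis by blast
    qed
    have zT: "z \<notin> T" using no O_0 by (metis diff_self mult_zero_right)
    have "S (insert z T)" unfolding S_def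
    proof (intro conjI ballI impI)
      show "finite (insert z T)" "insert z T \<subseteq> \<O>" using T z unfolding S_def by auto
      fix a b assume ab: "a \<in> insert z T" "b \<in> insert z T" and ex: "\<exists>g\<in>\<O>. a - b = h * g"
      consider "a \<in> T" "b \<in> T" | "a = z" "b = z" | "a = z" "b \<in> T" | "a \<in> T" "b = z" using ab by blast
      then show "a = b"
      proof cases
        case 1 then show ?thesis using T ex unfolding S_def by blast
      next
        case 3 then show ?thesis using no ex by blast
      next
        case 4 then show ?thesis using no sym[OF ex] by blast
      qed simp
    qed
    then have "card (insert z T) \<le> card T" by (rule mx)
    then show False using zT T unfolding S_def by simp
  qed
  then show ?thesis using T unfolding S_def by blast
qed

end

section \<open>Finite places\<close>

context cubic_field
begin

lemma char_F: "CHAR('f) = p"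
proof (rule CHAR_eqI)
  have ch: "CHAR('k) = p" by (rule CHAR_eq_of_card_power[OF p cardk])
  have "(of_nat p :: 'k) = 0" using ch by (metis of_nat_CHAR)
  then show "of_nat p = (0::'f)" by (metis iota_of_nat iota_0)
  fix n assume "of_nat n = (0::'f)"
  then have "\<iota> (of_nat n) = 0" by (simp add: iota_of_nat)
  then have "(of_nat n :: 'k) = 0" by simp
  then show "p dvd n" by (simp only: of_nat_eq_0_iff_char_dvd ch)
qed

lemma frob_add: "(a + b :: 'f) ^ (p ^ i) = a ^ (p ^ i) + b ^ (p ^ i)"
  using freshmans_dream'[where 'a = 'f] p char_F by simp

lemma frob_diff: "(a - b :: 'f) ^ (p ^ i) = a ^ (p ^ i) - b ^ (p ^ i)"
  using frob_add[of "a - b" b i] by (simp add: algebra_simps)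

lemma iota_power_card: "\<iota> c ^ (CARD('k) ^ n) = \<iota> c"
proof (induction n)
  case (Suc n)
  have "\<iota> c ^ (CARD('k) ^ Suc n) = (\<iota> c ^ (CARD('k) ^ n)) ^ CARD('k)" by (simp add: mult.commute flip: power_mult)
  also have "\<dots> = \<iota> (c ^ CARD('k))" using Suc by (simp add: iota_power)
  finally show ?case using power_card[OF fin] by simp
qed simp

section \<open>Localization at a nonzero prime ideal of O\<close>

definition prime_id :: "'f set \<Rightarrow> bool" where
  "prime_id I \<longleftrightarrow> I \<subseteq> \<O> \<and> 0 \<in> I \<and> (\<forall>a\<in>I. \<forall>b\<in>I. a + b \<in> I) \<and> (\<forall>a\<in>I. \<forall>b\<in>\<O>. a * b \<in> I) \<and>
     1 \<notin> I \<and> (\<forall>a\<in>\<O>. \<forall>b\<in>\<O>. a * b \<in> I \<longrightarrow> a \<in> I \<or> b \<in> I) \<and> (\<exists>z\<in>I. z \<noteq> 0)"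

lemma taylor: assumes "h \<in> \<O>"
  shows "\<exists>w\<in>\<O>. (x + h) ^ n = x ^ n + of_nat n * x ^ (n - 1) * h + h * (h * w)"
proof (induction n)
  case 0 then show ?case using O_0 by auto
next
  case (Suc n)
  then obtain w where w: "w \<in> \<O>" "(x + h) ^ n = x ^ n + of_nat n * x ^ (n - 1) * h + h * (h * w)" by blast
  have xn: "of_nat n * x ^ (n - 1) * x = of_nat n * x ^ n" by (cases n) auto
  have "(x + h) ^ Suc n = (x ^ n + of_nat n * x ^ (n - 1) * h + h * (h * w)) * (x + h)"
    by (simp add: w(2) mult.commute)
  also have "\<dots> = x ^ Suc n + (of_nat n * x ^ (n - 1) * x + x ^ n) * h + h * (h * (of_nat n * x ^ (n - 1) + w * x + h * w))"
    by (simp add: algebra_simps)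
  also have "\<dots> = x ^ Suc n + of_nat (Suc n) * x ^ (Suc n - 1) * h + h * (h * (of_nat n * x ^ (n - 1) + w * x + h * w))"
    unfolding xn by (simp add: algebra_simps)
  finally show ?case using w(1) assms by (auto intro!: bexI O_intros)
qed

end

locale cubic_prime = cubic_field \<iota> p s m x y for \<iota> :: "'k::field \<Rightarrow> 'f::field" and p s m x y +
  fixes I :: "'f set"
  assumes prime_id: "prime_id I"
begin

lemma I_O: "a \<in> I \<Longrightarrow> a \<in> \<O>" and I_0: "0 \<in> I" and I_add: "a \<in> I \<Longrightarrow> b \<in> I \<Longrightarrow> a + b \<in> I"
  and I_mult: "a \<in> I \<Longrightarrow> b \<in> \<O> \<Longrightarrow> a * b \<in> I" and I_1: "1 \<notin> I"
  and I_prime: "a \<in> \<O> \<Longrightarrow> b \<in> \<O> \<Longrightarrow> a * b \<in> I \<Longrightarrow> a \<in> I \<or> b \<in> I"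
  and I_nz: "\<exists>z\<in>I. z \<noteq> 0"
  using prime_id unfolding prime_id_def by blast+

lemma I_mult2: "a \<in> \<O> \<Longrightarrow> b \<in> I \<Longrightarrow> a * b \<in> I"
  using I_mult[of b a] by (simp add: mult.commute)

lemma I_minus: "a \<in> I \<Longrightarrow> - a \<in> I"
  using I_mult[of a "- 1"] O_minus[OF O_1] by simp

lemma I_diff: "a \<in> I \<Longrightarrow> b \<in> I \<Longrightarrow> a - b \<in> I"
  using I_add[OF _ I_minus] by force

lemma I_power: "a \<in> I \<Longrightarrow> n > 0 \<Longrightarrow> a ^ n \<in> I"
  using I_mult[of a "a ^ (n - 1)"] I_O O_power by (cases n) auto

lemma I_of_power: "a \<in> \<O> \<Longrightarrow> a ^ n \<in> I \<Longrightarrow> a \<in> I"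
proof (induction n)
  case 0 then show ?case using I_1 by simp
next
  case (Suc n) then show ?case using I_prime[of a "a ^ n"] O_power by auto
qed

lemma U_mult: "a \<in> \<O> - I \<Longrightarrow> b \<in> \<O> - I \<Longrightarrow> a * b \<in> \<O> - I"
  using I_prime O_mult by blast

lemma U_power: "a \<in> \<O> - I \<Longrightarrow> a ^ n \<in> \<O> - I"
  using I_of_power O_power by blast

lemma U_nz: "a \<in> \<O> - I \<Longrightarrow> a \<noteq> 0" using I_0 by blast

lemma U_iota: assumes "c \<noteq> 0" shows "\<iota> c \<in> \<O> - I"
proof -
  have "\<iota> c \<notin> I"
  proof
    assume "\<iota> c \<in> I"
    then have "\<iota> c * \<iota> (inverse c) \<in> I" using I_mult O_iota by blast
    then show False using assms I_1 by (simp flip: iota_mult)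
  qed
  then show ?thesis using O_iota by blast
qed

lemma U_add: assumes "a \<in> \<O> - I" "b \<in> I" shows "a + b \<in> \<O> - I"
proof -
  have "a + b \<notin> I" using assms I_diff[of "a + b" b] by auto
  then show ?thesis using assms O_add I_O by blast
qed

lemma cover: "\<exists>W. finite W \<and> W \<subseteq> \<O> \<and> (\<forall>z\<in>\<O>. \<exists>w\<in>W. z - w \<in> I)"
proof -
  obtain h where h: "h \<in> I" "h \<noteq> 0" using I_nz by blast
  obtain W where "finite W" "W \<subseteq> \<O>" "\<forall>z\<in>\<O>. \<exists>w\<in>W. \<exists>g\<in>\<O>. z - w = h * g"
    using finite_cover[OF I_O[OF h(1)] h(2)] by blast
  then show ?thesis using I_mult[OF h(1)] by metis
qed

text \<open>Pigeonhole in pairs of residue classes. Two sequences are treated at once because a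
  single power of Frobenius has to fix the classes of both x and y.\<close>

lemma power_congruent:
  fixes g g' :: "nat \<Rightarrow> 'f"
  assumes "\<And>n. g n \<in> \<O>" "\<And>n. g' n \<in> \<O>"
  shows "\<exists>i j. i < j \<and> g j - g i \<in> I \<and> g' j - g' i \<in> I"
proof -
  obtain W where W: "finite W" "\<forall>z\<in>\<O>. \<exists>w\<in>W. z - w \<in> I" using cover by blast
  then have "\<forall>n. \<exists>w. w \<in> W \<times> W \<and> g n - fst w \<in> I \<and> g' n - snd w \<in> I"
    using assms by (metis SigmaI fst_conv snd_conv)
  then obtain f where f: "\<And>n. f n \<in> W \<times> W \<and> g n - fst (f n) \<in> I \<and> g' n - snd (f n) \<in> I" by metis
  have "\<not> inj f"
  proof
    assume "inj f"
    moreover have "range f \<subseteq> W \<times> W" using f by blast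
    then have "finite (range f)" by (rule finite_subset[OF _ finite_cartesian_product[OF W(1) W(1)]])
    ultimately show False using finite_imageD infinite_UNIV_nat by blast
  qed
  then obtain i j where ij: "i \<noteq> j" "f i = f j" unfolding inj_def by blast
  have d: "g j - g i \<in> I \<and> g' j - g' i \<in> I" if "f i = f j" for i j
    using that f[of i] f[of j] I_diff[of "g j - fst (f j)" "g i - fst (f i)"] I_diff[of "g' j - snd (f j)" "g' i - snd (f i)"]
    by simp
  show ?thesis
  proof (cases "i < j")
    case True then show ?thesis using d ij by blast
  next
    case False
    then have "j < i" using ij by simp
    then show ?thesis using d[of j i] ij by metis
  qed
qed

text \<open>The residue ring is a finite domain: two powers b^i and b^j agree modulo I, and
  cancelling b^i leaves b^(j - i) = 1.\<close>

lemma U_inverse: assumes "b \<in> \<O> - I" shows "\<exists>b'\<in>\<O>. b * b' - 1 \<in> I"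
proof -
  obtain i j where ij: "i < j" "b ^ j - b ^ i \<in> I"
    using power_congruent[of "\<lambda>n. b ^ n" "\<lambda>n. b ^ n"] assms O_power by blast
  have "b ^ j = b ^ i * b ^ (j - i)" using ij(1) by (simp flip: power_add)
  then have "b ^ i * (b ^ (j - i) - 1) \<in> I" using ij(2) by (simp add: right_diff_distrib)
  moreover have "b ^ i \<in> \<O> - I" using U_power assms by blast
  moreover have "b ^ (j - i) - 1 \<in> \<O>" using assms by (auto intro: O_intros)
  ultimately have "b ^ (j - i) - 1 \<in> I" using I_prime by blast
  moreover have "b ^ (j - i) = b * b ^ (j - i - 1)" using ij(1) by (metis Suc_diff_1 power_Suc zero_less_diff)
  ultimately show ?thesis using assms O_power by auto
qed

text \<open>Pigeonhole gives exponents i < j with equal classes. Raising to the power CARD('k)^i is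
  additive, and modulo a prime ideal only 0 is sent to 0, so it can be cancelled.\<close>

lemma frobenius_fixes_residues:
  "\<exists>n. n > 0 \<and> x ^ (CARD('k) ^ n) - x \<in> I \<and> y ^ (CARD('k) ^ n) - y \<in> I"
proof -
  have "\<exists>i j. i < j \<and> x ^ (CARD('k) ^ j) - x ^ (CARD('k) ^ i) \<in> I \<and> y ^ (CARD('k) ^ j) - y ^ (CARD('k) ^ i) \<in> I"
    by (rule power_congruent[of "\<lambda>n. x ^ (CARD('k) ^ n)" "\<lambda>n. y ^ (CARD('k) ^ n)"]) (auto intro: O_intros)
  then obtain i j where ij: "i < j" "x ^ (CARD('k) ^ j) - x ^ (CARD('k) ^ i) \<in> I" "y ^ (CARD('k) ^ j) - y ^ (CARD('k) ^ i) \<in> I"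
    by blast
  have red: "z ^ (CARD('k) ^ (j - i)) - z \<in> I" if z: "z \<in> \<O>" "z ^ (CARD('k) ^ j) - z ^ (CARD('k) ^ i) \<in> I" for z
  proof -
    have "CARD('k) ^ j = CARD('k) ^ (j - i) * CARD('k) ^ i" using ij(1) by (simp flip: power_add)
    then have "(z ^ (CARD('k) ^ (j - i))) ^ (CARD('k) ^ i) - z ^ (CARD('k) ^ i) \<in> I" using z(2) by (simp flip: power_mult)
    moreover have "CARD('k) ^ i = p ^ (s * i)" by (simp add: cardk power_mult)
    ultimately have "(z ^ (CARD('k) ^ (j - i)) - z) ^ (CARD('k) ^ i) \<in> I" by (simp add: frob_diff)
    then show ?thesis by (rule I_of_power[rotated]) (use z in \<open>auto intro: O_intros\<close>)
  qed
  show ?thesis using red[OF O_x] red[OF O_y] ij by (intro exI[of _ "j - i"]) auto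
qed

text \<open>Let \<open>N\<close> be a power of \<open>CARD('k)\<close> such that \<open>z \<mapsto> z\<^sup>N\<close> fixes the residue field. The elements
  \<open>h = x\<^sup>N - x\<close> and \<open>\<epsilon> = y\<^sup>N - y\<close> generate the prime locally, since \<open>z\<^sup>N\<close> arises from \<open>z = z(x, y)\<close> by
  substituting \<open>x + h\<close> for \<open>x\<close> and \<open>y + \<epsilon>\<close> for \<open>y\<close>. The equation \<open>(y + \<epsilon>)\<^sup>3 = f (x + h)\<close>, where
  \<open>f = X\<^sup>m + X\<close> is separable, makes one of the two a local multiple of the other.\<close>

lemma local_uniformizer: "\<exists>t\<in>I. \<forall>z\<in>I. \<exists>u\<in>\<O> - I. \<exists>w\<in>\<O>. u * z = t * w"
proof -
  obtain n where n: "n > 0" "x ^ (CARD('k) ^ n) - x \<in> I" "y ^ (CARD('k) ^ n) - y \<in> I"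
    using frobenius_fixes_residues by blast
  define N where "N = CARD('k) ^ n"
  define h where "h = x ^ N - x"
  define \<epsilon> where "\<epsilon> = y ^ N - y"
  have hI: "h \<in> I" and eI: "\<epsilon> \<in> I" using n unfolding h_def \<epsilon>_def N_def by auto
  have hO: "h \<in> \<O>" and eO: "\<epsilon> \<in> \<O>" using hI eI I_O by auto
  have N1: "N > 1" unfolding N_def using Q_ge_2 n by (intro one_less_power) auto
  have Np: "N = p ^ (s * n)" unfolding N_def cardk by (simp add: power_mult)
  have Nadd: "(a + b) ^ N = a ^ N + b ^ N" for a b :: 'f unfolding Np by (rule frob_add)
  have G: "\<exists>a\<in>\<O>. \<exists>b\<in>\<O>. z ^ N - z = h * a + \<epsilon> * b" if "z \<in> \<O>" for z
    using that
  proof (induction z rule: O_induct)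
    case (iota c)
    have "\<iota> c ^ N - \<iota> c = h * 0 + \<epsilon> * 0" using iota_power_card unfolding N_def by simp
    then show ?case using O_0 by blast
  next
    case x
    have "x ^ N - x = h * 1 + \<epsilon> * 0" unfolding h_def by simp
    then show ?case using O_0 O_1 by blast
  next
    case y
    have "y ^ N - y = h * 0 + \<epsilon> * 1" unfolding \<epsilon>_def by simp
    then show ?case using O_0 O_1 by blast
  next
    case (add z w)
    then obtain a b a' b' where h: "a \<in> \<O>" "b \<in> \<O>" "a' \<in> \<O>" "b' \<in> \<O>"
      "z ^ N - z = h * a + \<epsilon> * b" "w ^ N - w = h * a' + \<epsilon> * b'" by blast
    have "(z + w) ^ N - (z + w) = (z ^ N - z) + (w ^ N - w)" by (simp add: Nadd)
    also have "\<dots> = h * (a + a') + \<epsilon> * (b + b')" unfolding h by (simp add: algebra_simps)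
    finally show ?case using h O_add by blast
  next
    case (mult z w)
    then obtain a b a' b' where h: "a \<in> \<O>" "b \<in> \<O>" "a' \<in> \<O>" "b' \<in> \<O>"
      "z ^ N - z = h * a + \<epsilon> * b" "w ^ N - w = h * a' + \<epsilon> * b'" by blast
    have "(z * w) ^ N - z * w = z ^ N * (w ^ N - w) + w * (z ^ N - z)" by (simp add: power_mult_distrib algebra_simps)
    also have "\<dots> = h * (z ^ N * a' + w * a) + \<epsilon> * (z ^ N * b' + w * b)" unfolding h by (simp add: algebra_simps)
    finally have e: "(z * w) ^ N - z * w = h * (z ^ N * a' + w * a) + \<epsilon> * (z ^ N * b' + w * b)" .
    have "z ^ N * a' + w * a \<in> \<O>" "z ^ N * b' + w * b \<in> \<O>" using h mult.hyps by (auto intro!: O_intros)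
    then show ?case using e by blast
  qed
  obtain w where w: "w \<in> \<O>" "(x + h) ^ m = x ^ m + of_nat m * x ^ (m - 1) * h + h * (h * w)"
    using taylor[OF hO] by blast
  \<comment> \<open>Modulo I, c1 is 3 y^2 and c2 is the derivative m x^(m - 1) + 1: the relation
    between \<epsilon> and h has the partial derivatives of the curve equation as
    coefficients.\<close>
  define c1 where "c1 = 3 * y ^ 2 + 3 * y * \<epsilon> + \<epsilon> ^ 2"
  define c2 where "c2 = of_nat m * x ^ (m - 1) + 1 + h * w"
  have O3: "3 \<in> \<O>" using O_of_nat[of 3] by simp
  have c1O: "c1 \<in> \<O>" and c2O: "c2 \<in> \<O>"
    unfolding c1_def c2_def using w eO hO O3 by (auto intro!: O_intros)
  have rel: "\<epsilon> * c1 = h * c2"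
  proof -
    have "(y + \<epsilon>) ^ 3 = (y ^ 3) ^ N" unfolding \<epsilon>_def by (simp add: mult.commute flip: power_mult)
    also have "\<dots> = (x ^ N) ^ m + x ^ N" unfolding eq Nadd by (simp add: mult.commute flip: power_mult)
    also have "\<dots> = (x + h) ^ m + (x + h)" unfolding h_def by simp
    also have "\<dots> = y ^ 3 + h * c2" unfolding w(2) eq c2_def by (simp add: algebra_simps)
    finally have "(y + \<epsilon>) ^ 3 = y ^ 3 + h * c2" .
    moreover have "(y + \<epsilon>) ^ 3 = y ^ 3 + \<epsilon> * c1" unfolding c1_def by algebra
    ultimately show ?thesis by simp
  qed
  \<comment> \<open>z^N - z is z times z^(N - 1) - 1, and the latter is a local unit because z^(N -
    1) lies in I.\<close>
  have dec: "\<exists>u\<in>\<O> - I. \<exists>a\<in>\<O>. \<exists>b\<in>\<O>. u * z = h * a + \<epsilon> * b" if z: "z \<in> I" for z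
  proof -
    have "z ^ (N - 1) \<in> I" using z N1 by (intro I_power) auto
    then have "- 1 + z ^ (N - 1) \<in> \<O> - I" using U_add[OF U_iota[of "- 1"]] by (simp add: iota_minus)
    moreover have "z ^ N = z * z ^ (N - 1)" using N1 by (metis Suc_diff_1 less_trans power_Suc zero_less_one)
    then have "(- 1 + z ^ (N - 1)) * z = z ^ N - z" by (simp add: algebra_simps)
    ultimately show ?thesis using G[OF I_O[OF z]] by metis
  qed
  show ?thesis
  proof (cases "y \<in> I")
    case False
    have U3: "3 \<in> \<O> - I" using U_iota[OF three] iota_of_nat[of 3] by simp
    have "3 * y ^ 2 \<in> \<O> - I" using U_mult[OF U3 U_power[of y 2]] False O_y by blast
    moreover have "3 * y * \<epsilon> + \<epsilon> ^ 2 \<in> I" using I_add I_mult2[OF _ eI] I_power[OF eI] O_mult[OF O3 O_y] by simp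
    ultimately have c1: "c1 \<in> \<O> - I" using U_add unfolding c1_def by (metis add.assoc)
    have "\<exists>u\<in>\<O> - I. \<exists>w\<in>\<O>. u * z = h * w" if z: "z \<in> I" for z
    proof -
      obtain u a b where u: "u \<in> \<O> - I" "a \<in> \<O>" "b \<in> \<O>" "u * z = h * a + \<epsilon> * b" using dec[OF z] by blast
      have "(c1 * u) * z = c1 * (h * a) + (\<epsilon> * c1) * b" using u(4) by (simp add: algebra_simps)
      also have "\<dots> = h * (c1 * a + c2 * b)" unfolding rel by (simp add: algebra_simps)
      finally show ?thesis using U_mult[OF c1 u(1)] u c1O c2O by (meson O_add O_mult)
    qed
    then show ?thesis using hI by blast
  next
    case True
    \<comment> \<open>If y is in I then x = 0 or x^(m - 1) = -1 modulo I. The derivative is 1 in the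
      first case; in the second, 2 m = 1 makes its double x^(m - 1) + 2 = 1.\<close>
    have c2: "c2 \<in> \<O> - I"
    proof -
      have hw: "h * w \<in> I" using I_mult hI w by blast
      have "x * (x ^ (m - 1) + 1) = y ^ 3"
        unfolding eq using m1 by (simp add: distrib_left flip: power_Suc)
      then have "x * (x ^ (m - 1) + 1) \<in> I" using I_power[OF True, of 3] by simp
      then have "x \<in> I \<or> x ^ (m - 1) + 1 \<in> I" by (intro I_prime) (auto intro: O_intros)
      then show ?thesis
      proof
        assume "x \<in> I"
        then have "x ^ (m - 1) \<in> I" using m1 by (intro I_power) auto
        then have "of_nat m * x ^ (m - 1) + h * w \<in> I" using I_add I_mult2 O_of_nat hw by blast
        moreover have "1 \<in> \<O> - I" using O_1 I_1 by blast
        ultimately show ?thesis using U_add[of 1] unfolding c2_def by (metis add.assoc add.commute)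
      next
        assume a: "x ^ (m - 1) + 1 \<in> I"
        have "2 * c2 = (2 * of_nat m) * x ^ (m - 1) + 2 + 2 * (h * w)" unfolding c2_def by (simp add: algebra_simps)
        also have "\<dots> = 1 + ((x ^ (m - 1) + 1) + 2 * (h * w))" unfolding m2 by simp
        finally have e: "2 * c2 = 1 + ((x ^ (m - 1) + 1) + 2 * (h * w))" .
        have "(x ^ (m - 1) + 1) + 2 * (h * w) \<in> I" using I_add[OF a I_mult2[OF O_of_nat[of 2] hw]] by simp
        moreover have "1 \<in> \<O> - I" using O_1 I_1 by blast
        ultimately have "2 * c2 \<in> \<O> - I" unfolding e by (intro U_add)
        moreover have "c2 \<in> I \<Longrightarrow> 2 * c2 \<in> I" using I_mult2[OF O_of_nat[of 2]] by simp
        ultimately show ?thesis using c2O by blast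
      qed
    qed
    have e_y: "\<epsilon> = y * (y ^ (N - 1) - 1)"
    proof -
      have "y ^ N = y * y ^ (N - 1)" using N1 by (metis Suc_diff_1 less_trans power_Suc zero_less_one)
      then show ?thesis unfolding \<epsilon>_def by (simp add: algebra_simps)
    qed
    have "\<exists>u\<in>\<O> - I. \<exists>w\<in>\<O>. u * z = y * w" if z: "z \<in> I" for z
    proof -
      obtain u a b where u: "u \<in> \<O> - I" "a \<in> \<O>" "b \<in> \<O>" "u * z = h * a + \<epsilon> * b" using dec[OF z] by blast
      have "(c2 * u) * z = (h * c2) * a + \<epsilon> * (c2 * b)" using u(4) by (simp add: algebra_simps)
      also have "\<dots> = \<epsilon> * (c1 * a + c2 * b)" unfolding rel[symmetric] by (simp add: algebra_simps)
      also have "\<dots> = y * ((y ^ (N - 1) - 1) * (c1 * a + c2 * b))" unfolding e_y by (simp add: algebra_simps)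
      finally have e: "(c2 * u) * z = y * ((y ^ (N - 1) - 1) * (c1 * a + c2 * b))" .
      have "(y ^ (N - 1) - 1) * (c1 * a + c2 * b) \<in> \<O>" using u c1O c2O by (auto intro!: O_intros)
      then show ?thesis using U_mult[OF c2 u(1)] e by blast
    qed
    then show ?thesis using True by blast
  qed
qed

definition loc :: "'f set" where "loc = {z. \<exists>a\<in>\<O>. \<exists>b\<in>\<O> - I. z = a / b}"

text \<open>If \<open>t\<^sup>n\<close> divides \<open>z\<close> locally, then \<open>1, t, \<dots>, t\<^sup>n\<close> are pairwise incongruent modulo \<open>z \<O>\<close>, which bounds \<open>n\<close>.\<close>

lemma local_decomposition:
  assumes t: "t \<in> I" "\<forall>z\<in>I. \<exists>u\<in>\<O> - I. \<exists>w\<in>\<O>. u * z = t * w" and z: "z \<in> \<O>" "z \<noteq> 0"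
  shows "\<exists>n. \<exists>u\<in>\<O> - I. \<exists>u'\<in>\<O> - I. u * z = t ^ n * u'"
proof -
  let ?S = "\<lambda>n. \<exists>u\<in>\<O> - I. \<exists>w\<in>\<O>. u * z = t ^ n * w"
  have tO: "t \<in> \<O>" using t I_O by blast
  have bound: "n < CARD('k) ^ d z" if Sn: "?S n" for n
  proof -
    obtain u w where u: "u \<in> \<O> - I" "w \<in> \<O>" "u * z = t ^ n * w" using Sn by blast
    have t0: "t \<noteq> 0" using u(3) U_nz[OF u(1)] z I_nz t(2) U_nz by (metis mult_eq_0_iff)
    \<comment> \<open>After multiplication by u, the factor t^i can be cancelled. The left-hand side
      becomes u (1 - t^(j - i)), a local unit, while the right-hand side keeps a factor t^(n - i) in
      I.\<close>
    have key: False if ij: "i < j" "j \<le> n" "g \<in> \<O>" "t ^ i - t ^ j = z * g" for i j g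
    proof -
      have tj: "t ^ j = t ^ i * t ^ (j - i)" and tn: "t ^ n = t ^ i * t ^ (n - i)" using ij by (simp_all flip: power_add)
      have "u * (t ^ i - t ^ j) = t ^ n * w * g" using ij(4) u(3) by (simp add: mult_ac)
      then have "t ^ i * (u * (1 - t ^ (j - i))) = t ^ i * (t ^ (n - i) * (w * g))"
        unfolding tj tn by (simp add: algebra_simps)
      then have e: "u * (1 - t ^ (j - i)) = t ^ (n - i) * (w * g)" using t0 by simp
      have "t ^ (n - i) * (w * g) \<in> I" using ij u I_power[OF t(1)] I_mult O_mult by simp
      moreover have "1 + - (t ^ (j - i)) \<in> \<O> - I" using ij O_1 I_1 I_power[OF t(1)] I_minus by (intro U_add) auto
      then have "u * (1 - t ^ (j - i)) \<in> \<O> - I" using U_mult[OF u(1)] by simp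
      ultimately show False using e by simp
    qed
    have sym: "g \<in> \<O> \<Longrightarrow> t ^ i - t ^ j = z * g \<Longrightarrow> t ^ j - t ^ i = z * (- g)" for i j g
      by (simp add: algebra_simps)
    have ne: "i = j" if ij: "i \<le> n" "j \<le> n" "g \<in> \<O>" "t ^ i - t ^ j = z * g" for i j g
      using key[of i j g] key[of j i "- g"] ij O_minus sym[OF ij(3,4)] by (meson linorder_neqE_nat)
    let ?T = "(\<lambda>i. t ^ i) ` {..n}"
    have "inj_on (\<lambda>i. t ^ i) {..n}" using ne[of _ _ 0] O_0 by (auto intro!: inj_onI)
    then have "card ?T = n + 1" by (simp add: card_image)
    moreover have "card ?T \<le> CARD('k) ^ d z"
    proof (rule separated_card_le[OF _ _ z])
      show "?T \<subseteq> \<O>" using tO O_power by auto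
      show "\<tau> = \<tau>'" if "\<tau> \<in> ?T" "\<tau>' \<in> ?T" "g \<in> \<O>" "\<tau> - \<tau>' = z * g" for \<tau> \<tau>' g
        using that ne by auto
    qed simp
    ultimately show ?thesis by simp
  qed
  have "?S 0" by (rule bexI[of _ 1], rule bexI[of _ z]) (use z O_1 I_1 in auto)
  then obtain n where n: "?S n" and mx: "\<And>k. ?S k \<Longrightarrow> k \<le> n"
    using ex_has_greatest_nat[of ?S 0 id "CARD('k) ^ d z"] bound by auto
  obtain u w where u: "u \<in> \<O> - I" "w \<in> \<O>" "u * z = t ^ n * w" using n by blast
  have "w \<notin> I"
  proof
    assume "w \<in> I"
    then obtain u' w' where u': "u' \<in> \<O> - I" "w' \<in> \<O>" "u' * w = t * w'" using t(2) by blast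
    have "(u' * u) * z = t ^ n * (u' * w)" using u(3) by (simp add: mult_ac)
    also have "\<dots> = t ^ Suc n * w'" unfolding u'(3) by (simp add: mult_ac)
    finally have "?S (Suc n)" using U_mult[OF u'(1) u(1)] u'(2) by blast
    then show False using mx by fastforce
  qed
  then show ?thesis using u by blast
qed

text \<open>By \<open>local_decomposition\<close>, numerators and denominators are powers of t up to
  local units. So every nonzero element is t^n times a unit with n an integer, and it or its inverse
  is in \<open>loc\<close>.\<close>

lemma loc_valuation:
  shows "valuation_ring \<iota> loc" and "x \<in> loc" and "max_ideal loc \<inter> \<O> = I"
  and "\<exists>t\<in>I. place.unif loc t"
proof -
  obtain t where t: "t \<in> I" "\<forall>z\<in>I. \<exists>u\<in>\<O> - I. \<exists>w\<in>\<O>. u * z = t * w" using local_uniformizer by blast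
  have tO: "t \<in> \<O>" using t I_O by blast
  obtain z0 where z0: "z0 \<in> I" "z0 \<noteq> 0" using I_nz by blast
  have t0: "t \<noteq> 0"
  proof -
    obtain u w where "u \<in> \<O> - I" "u * z0 = t * w" using t(2) z0 by blast
    then show ?thesis using z0 U_nz by (metis mult_eq_0_iff)
  qed
  have U1: "1 \<in> \<O> - I" using O_1 I_1 by blast
  have O_loc: "a \<in> loc" if "a \<in> \<O>" for a unfolding loc_def using that U1 by force
  have loc_mult: "a * b \<in> loc" and loc_add: "a + b \<in> loc" if ab: "a \<in> loc" "b \<in> loc" for a b
  proof -
    obtain u v u' v' where h: "u \<in> \<O>" "v \<in> \<O> - I" "a = u / v" "u' \<in> \<O>" "v' \<in> \<O> - I" "b = u' / v'"
      using ab unfolding loc_def by blast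
    have "a * b = (u * u') / (v * v')" "a + b = (u * v' + u' * v) / (v * v')"
      using h U_nz[OF h(2)] U_nz[OF h(5)] by (auto simp: field_simps)
    moreover have "v * v' \<in> \<O> - I" using U_mult h by blast
    moreover have "u * u' \<in> \<O>" "u * v' + u' * v \<in> \<O>" using h by (auto intro: O_intros)
    ultimately show "a * b \<in> loc" "a + b \<in> loc" unfolding loc_def by blast+
  qed
  have m_notin: "inverse z \<notin> loc" if z: "z \<in> I" "z \<noteq> 0" for z
  proof
    assume "inverse z \<in> loc"
    then obtain a b where "a \<in> \<O>" "b \<in> \<O> - I" "inverse z = a / b" unfolding loc_def by blast
    then have "b = z * a" using z U_nz by (simp add: field_simps)
    then show False using I_mult z \<open>a \<in> \<O>\<close> \<open>b \<in> \<O> - I\<close> by blast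
  qed
  have decomp: "\<exists>n. \<exists>u\<in>\<O> - I. \<exists>u'\<in>\<O> - I. z = t powi n * (u / u')" if z: "z \<noteq> 0" for z
  proof -
    obtain a b where ab: "a \<in> \<O>" "b \<in> \<O>" "b \<noteq> 0" "z = a / b" using fraction by blast
    then have a0: "a \<noteq> 0" using z by auto
    obtain n u v where u: "u \<in> \<O> - I" "v \<in> \<O> - I" "u * a = t ^ n * v" using local_decomposition[OF t ab(1) a0] by blast
    obtain n' u' v' where u': "u' \<in> \<O> - I" "v' \<in> \<O> - I" "u' * b = t ^ n' * v'" using local_decomposition[OF t ab(2,3)] by blast
    have "a = t ^ n * v / u" "b = t ^ n' * v' / u'" using u u' U_nz by (auto simp: field_simps)
    then have "z = (t ^ n * v / u) / (t ^ n' * v' / u')" using ab(4) by simp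
    also have "\<dots> = (t ^ n / t ^ n') * ((v * u') / (u * v'))" by (simp add: divide_inverse mult_ac)
    also have "t ^ n / t ^ n' = t powi (int n - int n')" using t0 by (simp add: power_int_diff)
    finally have "z = t powi (int n - int n') * ((v * u') / (u * v'))" .
    then show ?thesis using U_mult u u' by blast
  qed
  have U_loc: "u / u' \<in> loc" if "u \<in> \<O> - I" "u' \<in> \<O> - I" for u u' unfolding loc_def using that by blast
  have pow_loc: "t ^ n \<in> loc" for n using O_loc tO O_power by blast
  show vr: "valuation_ring \<iota> loc" unfolding valuation_ring_def
  proof (intro conjI ballI allI)
    have "x \<noteq> \<iota> c" for c
    proof
      assume "x = \<iota> c"
      then have "e [:- c, 1:] = 0" unfolding e_pCons[of "- c"] e_const iota_minus iota_1 by (simp only: mult_1_right ab_left_minus)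
      then show False by simp
    qed
    then show "range \<iota> \<subset> loc" using O_loc O_iota O_x by blast
    show "loc \<subset> UNIV" using m_notin[OF t(1) t0] by blast
    fix a show "a \<in> loc \<or> inverse a \<in> loc"
    proof (cases "a = 0")
      case True then show ?thesis using O_loc O_0 by simp
    next
      case False
      then obtain n u u' where u: "u \<in> \<O> - I" "u' \<in> \<O> - I" "a = t powi n * (u / u')" using decomp by blast
      show ?thesis
      proof (cases "n \<ge> 0")
        case True
        then have "t powi n \<in> loc" using pow_loc by (simp add: power_int_def)
        then show ?thesis using u loc_mult U_loc by blast
      next
        case False
        then have "t powi (- n) \<in> loc" using pow_loc by (simp add: power_int_def)
        moreover have "inverse a = t powi (- n) * (u' / u)" unfolding u(3) by (simp only: inverse_mult_distrib inverse_divide power_int_minus)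
        ultimately show ?thesis using u loc_mult U_loc by metis
      qed
    qed
  qed (use loc_add loc_mult in auto)
  interpret pl: place \<iota> loc by standard (rule vr)
  show "x \<in> loc" using O_loc O_x by blast
  have Um: "u / u' \<in> loc - pl.\<mm>" if "u \<in> \<O> - I" "u' \<in> \<O> - I" for u u'
    using U_loc[OF that] U_loc[OF that(2,1)] U_nz[OF that(1)] U_nz[OF that(2)] unfolding pl.unit_iff by simp
  show mI: "pl.\<mm> \<inter> \<O> = I"
  proof
    show "pl.\<mm> \<inter> \<O> \<subseteq> I"
    proof
      fix a assume a: "a \<in> pl.\<mm> \<inter> \<O>"
      show "a \<in> I"
      proof (rule ccontr)
        assume "a \<notin> I"
        then have "a / 1 \<in> loc - pl.\<mm>" using Um U1 a by blast
        then show False using a by simp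
      qed
    qed
    show "I \<subseteq> pl.\<mm> \<inter> \<O>" using I_O O_loc m_notin unfolding max_ideal_def by blast
  qed
  have "pl.unif t" unfolding pl.unif_def
  proof (intro conjI allI impI)
    show "t \<in> pl.\<mm>" using mI t(1) by blast
    fix z :: 'f assume "z \<noteq> 0"
    then obtain n u u' where "u \<in> \<O> - I" "u' \<in> \<O> - I" "z = t powi n * (u / u')" using decomp by blast
    then show "\<exists>n. \<exists>u\<in>loc - pl.\<mm>. z = t powi n * u" using Um by blast
  qed (rule t0)
  then show "\<exists>t\<in>I. pl.unif t" using t by blast
qed

end

section \<open>Finite places as localizations of O\<close>

context cubic_field
begin

definition finite_place :: "'f set \<Rightarrow> bool" where
  "finite_place R \<longleftrightarrow> valuation_ring \<iota> R \<and> x \<in> R"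

lemma finite_place_O: assumes "finite_place R" shows "\<O> \<subseteq> R"
proof
  interpret place \<iota> R using assms unfolding finite_place_def by unfold_locales auto
  have x: "x \<in> R" using assms unfolding finite_place_def by simp
  have "y ^ 3 \<in> R" unfolding eq using R_add R_power x by simp
  then have y: "y \<in> R" using R_of_power[of y 3] by simp
  fix z assume "z \<in> \<O>"
  then show "z \<in> R" by (induction z rule: O_induct) (auto intro: R_iota x y R_add R_mult)
qed

lemma finite_place_prime: assumes "finite_place R" shows "prime_id (max_ideal R \<inter> \<O>)"
proof -
  interpret place \<iota> R using assms unfolding finite_place_def by unfold_locales auto
  have OR: "\<O> \<subseteq> R" by (rule finite_place_O[OF assms])
  \<comment> \<open>If no nonzero element of O were in the maximal ideal, all of them would be units
    of R, and every fraction would be in R.\<close>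
  have "\<exists>z\<in>\<mm> \<inter> \<O>. z \<noteq> 0"
  proof (rule ccontr)
    assume no: "\<not> ?thesis"
    have "z \<in> R" for z
    proof -
      obtain a b where ab: "a \<in> \<O>" "b \<in> \<O>" "b \<noteq> 0" "z = a / b" using fraction by blast
      then have "b \<in> R - \<mm>" using no OR by blast
      then show ?thesis using ab OR R_mult unfolding unit_iff divide_inverse by blast
    qed
    then show False using R_not_UNIV by blast
  qed
  then show ?thesis unfolding prime_id_def
  proof (intro conjI ballI impI)
    show "0 \<in> \<mm> \<inter> \<O>" using m_0 O_0 by blast
    show "1 \<notin> \<mm> \<inter> \<O>" using one_notin_m by blast
    fix a b
    show "a + b \<in> \<mm> \<inter> \<O>" if "a \<in> \<mm> \<inter> \<O>" "b \<in> \<mm> \<inter> \<O>" using that m_add O_add by blast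
    show "a * b \<in> \<mm> \<inter> \<O>" if "a \<in> \<mm> \<inter> \<O>" "b \<in> \<O>" using that m_mult2 O_mult OR by blast
    show "a \<in> \<mm> \<inter> \<O> \<or> b \<in> \<mm> \<inter> \<O>" if "a \<in> \<O>" "b \<in> \<O>" "a * b \<in> \<mm> \<inter> \<O>"
      using that m_prime[of a b] OR by blast
  qed auto
qed

text \<open>A valuation ring is not properly dominated by another: if z is in R but not in
  \<open>loc\<close>, then inverse z = a / b with a in the prime and b outside it, and b = z a would
  lie in the maximal ideal of R.\<close>

lemma finite_place_loc: assumes "finite_place R" shows "R = cubic_prime.loc \<iota> x y (max_ideal R \<inter> \<O>)"
proof -
  interpret place \<iota> R using assms unfolding finite_place_def by unfold_locales auto
  have OR: "\<O> \<subseteq> R" by (rule finite_place_O[OF assms])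
  interpret I: cubic_prime \<iota> p s m x y "\<mm> \<inter> \<O>" by unfold_locales (rule finite_place_prime[OF assms])
  interpret pl: place \<iota> I.loc by unfold_locales (rule I.loc_valuation(1))
  have "z \<in> R" if z: "z \<in> I.loc" for z
  proof -
    obtain a b where ab: "a \<in> \<O>" "b \<in> \<O> - \<mm> \<inter> \<O>" "z = a / b" using z unfolding I.loc_def by blast
    then have "b \<in> R - \<mm>" using OR by blast
    then show ?thesis using ab OR R_mult unfolding unit_iff divide_inverse by blast
  qed
  moreover have "z \<in> I.loc" if z: "z \<in> R" for z
  proof (rule ccontr)
    assume n: "z \<notin> I.loc"
    then have z0: "z \<noteq> 0" using pl.R_0 by blast
    obtain a b where ab: "a \<in> \<O>" "b \<in> \<O> - \<mm> \<inter> \<O>" "inverse z = a / b"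
      using pl.R_inv n unfolding I.loc_def by blast
    have "a \<in> \<mm> \<inter> \<O>"
    proof (rule ccontr)
      assume "a \<notin> \<mm> \<inter> \<O>"
      moreover have "z = b / a" using ab(3) by (metis inverse_divide inverse_inverse_eq)
      ultimately show False using ab n unfolding I.loc_def by blast
    qed
    moreover have "b = z * a" using ab I.U_nz[OF ab(2)] z0 by (simp add: field_simps)
    ultimately have "b \<in> \<mm>" using m_mult z by blast
    then show False using ab by blast
  qed
  ultimately show ?thesis by blast
qed

lemma finite_place_unif: assumes "finite_place R" shows "\<exists>t\<in>\<O>. place.unif R t"
proof -
  interpret I: cubic_prime \<iota> p s m x y "max_ideal R \<inter> \<O>" by unfold_locales (rule finite_place_prime[OF assms])
  show ?thesis using I.loc_valuation(4) finite_place_loc[OF assms] by auto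
qed

text \<open>Elements outside a nonzero prime of O are invertible modulo it, so these primes are
  maximal and an inclusion of centres is an equality. The centre determines the place by
  \<open>finite_place_loc\<close>.\<close>

lemma finite_place_eq:
  assumes "finite_place R" "finite_place R'" "max_ideal R' \<inter> \<O> \<subseteq> max_ideal R \<inter> \<O>"
  shows "R = R'"
proof -
  interpret I: cubic_prime \<iota> p s m x y "max_ideal R \<inter> \<O>" by unfold_locales (rule finite_place_prime[OF assms(1)])
  interpret I': cubic_prime \<iota> p s m x y "max_ideal R' \<inter> \<O>" by unfold_locales (rule finite_place_prime[OF assms(2)])
  have "max_ideal R \<inter> \<O> \<subseteq> max_ideal R' \<inter> \<O>"
  proof (rule ccontr)
    assume "\<not> ?thesis"
    then obtain b where b: "b \<in> max_ideal R \<inter> \<O>" "b \<in> \<O> - max_ideal R' \<inter> \<O>" by blast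
    obtain b' where b': "b' \<in> \<O>" "b * b' - 1 \<in> max_ideal R' \<inter> \<O>" using I'.U_inverse[OF b(2)] by blast
    have "b * b' - (b * b' - 1) \<in> max_ideal R \<inter> \<O>" using I.I_diff I.I_mult[OF b(1) b'(1)] b'(2) assms(3) by blast
    then show False using I.I_1 by simp
  qed
  then have "max_ideal R \<inter> \<O> = max_ideal R' \<inter> \<O>" using assms(3) by blast
  then show ?thesis using finite_place_loc[OF assms(1)] finite_place_loc[OF assms(2)] by simp
qed

lemma finite_place_residues: assumes "finite_place R"
  shows "\<forall>z\<in>R. \<exists>a\<in>\<O>. z - a \<in> max_ideal R"
    and "\<exists>W. finite W \<and> (\<forall>z\<in>R. \<exists>w\<in>W. z - w \<in> max_ideal R)"
proof -
  interpret place \<iota> R using assms unfolding finite_place_def by unfold_locales auto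
  interpret I: cubic_prime \<iota> p s m x y "\<mm> \<inter> \<O>" by unfold_locales (rule finite_place_prime[OF assms])
  have OR: "\<O> \<subseteq> R" by (rule finite_place_O[OF assms])
  show 1: "\<forall>z\<in>R. \<exists>a\<in>\<O>. z - a \<in> \<mm>"
  proof
    fix z assume "z \<in> R"
    then obtain a b where ab: "a \<in> \<O>" "b \<in> \<O> - \<mm> \<inter> \<O>" "z = a / b"
      using finite_place_loc[OF assms] unfolding I.loc_def by blast
    obtain b' where b': "b' \<in> \<O>" "b * b' - 1 \<in> \<mm> \<inter> \<O>" using I.U_inverse[OF ab(2)] by blast
    have bu: "b \<in> R - \<mm>" using ab(2) OR by blast
    have "inverse b * (a * (b * b' - 1)) \<in> \<mm>"
      using bu b' ab(1) OR m_mult unfolding unit_iff by blast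
    moreover have "inverse b * (a * (b * b' - 1)) = a * b' - z"
      using I.U_nz[OF ab(2)] ab(3) by (simp add: field_simps)
    ultimately have "z - a * b' \<in> \<mm>" using m_diff_sym by simp
    then show "\<exists>a\<in>\<O>. z - a \<in> \<mm>" using O_mult ab b' by blast
  qed
  obtain W where W: "finite W" "\<forall>z\<in>\<O>. \<exists>w\<in>W. z - w \<in> \<mm> \<inter> \<O>" using I.cover by blast
  have "\<exists>w\<in>W. z - w \<in> \<mm>" if "z \<in> R" for z
    using 1 W(2) m_diff_trans that by (meson IntD1)
  then show "\<exists>W. finite W \<and> (\<forall>z\<in>R. \<exists>w\<in>W. z - w \<in> \<mm>)" using W by blast
qed

text \<open>If \<open>z\<close> is regular at all finite places, then the ideal of denominators of \<open>z\<close> lies in no maximal ideal.\<close>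

lemma integrally_closed:
  assumes z: "\<And>R. finite_place R \<Longrightarrow> z \<in> R"
  shows "z \<in> \<O>"
proof (rule ccontr)
  assume nz: "z \<notin> \<O>"
  define D where "D = {b \<in> \<O>. b * z \<in> \<O>}"
  obtain a0 b0 where ab0: "a0 \<in> \<O>" "b0 \<in> \<O>" "b0 \<noteq> 0" "z = a0 / b0" using fraction by blast
  then have b0D: "b0 \<in> D" unfolding D_def by simp
  \<comment> \<open>An ideal J containing b0 is determined by its intersection with the finite set W
    of representatives modulo b0 O. Maximizing the size of this intersection yields a maximal
    element among the proper ideals containing D.\<close>
  obtain W where W: "finite W" "W \<subseteq> \<O>" "\<forall>z\<in>\<O>. \<exists>w\<in>W. \<exists>g\<in>\<O>. z - w = b0 * g"
    using finite_cover[OF ab0(2,3)] by blast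
  define S where "S J \<longleftrightarrow> J \<subseteq> \<O> \<and> D \<subseteq> J \<and> (\<forall>a\<in>J. \<forall>b\<in>J. a + b \<in> J) \<and> (\<forall>a\<in>J. \<forall>b\<in>\<O>. a * b \<in> J) \<and> 1 \<notin> J" for J
  have "S D" unfolding S_def
  proof (intro conjI ballI)
    fix a b assume a: "a \<in> D"
    then have aD: "a \<in> \<O>" "a * z \<in> \<O>" unfolding D_def by auto
    show "a + b \<in> D" if "b \<in> D" using aD that O_add unfolding D_def by (simp add: distrib_right)
    show "a * b \<in> D" if "b \<in> \<O>"
    proof -
      have e: "a * b * z = (a * z) * b" by simp
      have "a * b * z \<in> \<O>" unfolding e by (rule O_mult[OF aD(2) that])
      then show ?thesis using O_mult[OF aD(1) that] unfolding D_def by blast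
    qed
  qed (use nz in \<open>auto simp: D_def\<close>)
  moreover have "card (J \<inter> W) < Suc (card W)" for J using W by (simp add: card_mono le_imp_less_Suc)
  ultimately obtain J where J: "S J" and mx: "\<And>J'. S J' \<Longrightarrow> card (J' \<inter> W) \<le> card (J \<inter> W)"
    using ex_has_greatest_nat[of S D "\<lambda>J. card (J \<inter> W)" "Suc (card W)"] by blast
  have JO: "J \<subseteq> \<O>" and DJ: "D \<subseteq> J" and Jadd: "\<And>a b. a \<in> J \<Longrightarrow> b \<in> J \<Longrightarrow> a + b \<in> J"
    and Jmult: "\<And>a b. a \<in> J \<Longrightarrow> b \<in> \<O> \<Longrightarrow> a * b \<in> J" and J1: "1 \<notin> J" using J unfolding S_def by auto
  have maximal: "J' = J" if S': "S J'" and sub: "J \<subseteq> J'" for J'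
  proof -
    have "J' \<inter> W = J \<inter> W"
      using mx[OF S'] sub W by (intro card_seteq[symmetric]) auto
    moreover have "c \<in> J" if c: "c \<in> J'" for c
    proof -
      obtain w g where w: "w \<in> W" "g \<in> \<O>" "c - w = b0 * g"
      proof -
        have "c \<in> \<O>" using c S' unfolding S_def by blast
        then show ?thesis using W(3) that by blast
      qed
      have bg: "b0 * g \<in> J" using Jmult DJ b0D w by blast
      have "(b0 * g) * (- 1) \<in> J" using Jmult[OF bg] O_minus[OF O_1] by blast
      then have "c + (b0 * g) * (- 1) \<in> J'" using S' sub c unfolding S_def by blast
      moreover have "c + (b0 * g) * (- 1) = w" unfolding w(3)[symmetric] by simp
      ultimately have "w \<in> J" using w(1) \<open>J' \<inter> W = J \<inter> W\<close> by blast
      then have "w + b0 * g \<in> J" using Jadd bg by blast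
      then show ?thesis unfolding w(3)[symmetric] by simp
    qed
    ultimately show ?thesis using sub by blast
  qed
  have J0: "0 \<in> J" using Jmult[of b0 0] DJ b0D O_0 by auto
  have "prime_id J" unfolding prime_id_def
  proof (intro conjI ballI impI)
    fix a b assume ab: "a \<in> \<O>" "b \<in> \<O>" "a * b \<in> J"
    show "a \<in> J \<or> b \<in> J"
    proof (rule ccontr)
      assume n: "\<not> (a \<in> J \<or> b \<in> J)"
      let ?J' = "{c + a * g | c g. c \<in> J \<and> g \<in> \<O>}"
      have sub: "J \<subseteq> ?J'" using O_0 by (force intro: exI[of _ 0])
      have "a = 0 + a * 1" by simp
      then have "a \<in> ?J'" using J0 O_1 by blast
      then have "?J' \<noteq> J" using n by blast
      then have nS: "\<not> S ?J'" using maximal sub by blast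
      have c1: "?J' \<subseteq> \<O>" using JO ab(1) by (auto intro: O_intros)
      have c2: "u + v \<in> ?J'" if uv: "u \<in> ?J'" "v \<in> ?J'" for u v
      proof -
        obtain c g c' g' where h: "u = c + a * g" "c \<in> J" "g \<in> \<O>" "v = c' + a * g'" "c' \<in> J" "g' \<in> \<O>" using uv by blast
        have "u + v = (c + c') + a * (g + g')" unfolding h by (simp add: algebra_simps)
        then show ?thesis using h Jadd O_add by blast
      qed
      have c3: "u * v \<in> ?J'" if uv: "u \<in> ?J'" "v \<in> \<O>" for u v
      proof -
        obtain c g where h: "u = c + a * g" "c \<in> J" "g \<in> \<O>" using uv by blast
        have "u * v = c * v + a * (g * v)" unfolding h by (simp add: algebra_simps)
        then show ?thesis using h Jmult O_mult uv(2) by blast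
      qed
      have "1 \<in> ?J'"
      proof (rule ccontr)
        assume n1: "1 \<notin> ?J'"
        have "S ?J'" unfolding S_def
          by (intro conjI ballI c1 order_trans[OF DJ sub] n1 c2 c3)
        then show False using nS by simp
      qed
      then obtain c g where cg: "1 = c + a * g" "c \<in> J" "g \<in> \<O>" by blast
      have "b = c * b + (a * b) * g" using arg_cong[OF cg(1), of "\<lambda>z. z * b"] by (simp add: algebra_simps)
      then show False using n Jadd Jmult cg ab by metis
    qed
  qed (use JO J0 Jadd Jmult J1 DJ b0D ab0 in auto)
  then interpret I: cubic_prime \<iota> p s m x y J by unfold_locales
  \<comment> \<open>As z is regular at the place of J, it has a denominator outside J. But all
    denominators in O lie in D, hence in J.\<close>
  have "finite_place I.loc" unfolding finite_place_def using I.loc_valuation(1,2) by blast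
  then have "z \<in> I.loc" by (rule z)
  then obtain a b where ab: "a \<in> \<O>" "b \<in> \<O> - J" "z = a / b" unfolding I.loc_def by blast
  then have "b * z = a" using I.U_nz by simp
  then have "b \<in> D" unfolding D_def using ab by simp
  then show False using ab DJ by blast
qed

end

section \<open>The place at infinity and the rational points\<close>

context place
begin

lemma place_degree_1I:
  assumes "\<forall>z\<in>R. \<exists>c. z - \<iota> c \<in> \<mm>"
  shows "place_degree \<iota> R = 1"
proof -
  have "residue_basis \<iota> R {1}" unfolding residue_basis_def
  proof (intro conjI ballI allI impI)
    show "{1} \<subseteq> R" using R_1 by simp
    fix z assume "z \<in> R"
    then obtain c where "z - \<iota> c \<in> \<mm>" using assms by blast
    then show "\<exists>c. z - (\<Sum>b\<in>{1}. \<iota> (c b) * b) \<in> \<mm>" by (intro exI[of _ "\<lambda>_. c"]) simp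
  next
    fix c and b :: 'f assume "(\<Sum>b\<in>{1}. \<iota> (c b) * b) \<in> \<mm>" and b: "b \<in> {1}"
    then have "\<iota> (c 1) \<in> \<mm>" by simp
    then have "c 1 = 0" using unit_iota by blast
    then show "c b = 0" using b by simp
  qed simp
  then show ?thesis using place_degree_eq by fastforce
qed

text \<open>The covering W provides a residue basis, so that \<open>place_degree\<close> has its
  intended meaning. Its single element is proportional to 1 modulo the maximal ideal, hence
  constants represent all classes.\<close>

lemma place_degree_1D:
  assumes "finite W" "\<And>z. z \<in> R \<Longrightarrow> \<exists>w\<in>W. z - w \<in> \<mm>" and deg: "place_degree \<iota> R = 1" and z: "z \<in> R"
  shows "\<exists>c. z - \<iota> c \<in> \<mm>"
proof -
  obtain B where B: "residue_basis \<iota> R B" using residue_basis_exists[OF assms(1,2)] by blast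
  then have "card B = 1" using place_degree_eq deg by simp
  then obtain b where b: "B = {b}" by (metis card_1_singletonE)
  have ex: "\<exists>c. z - \<iota> c * b \<in> \<mm>" if "z \<in> R" for z
  proof -
    obtain c where "z - (\<Sum>b\<in>{b}. \<iota> (c b) * b) \<in> \<mm>" using B \<open>z \<in> R\<close> unfolding residue_basis_def b by blast
    then show ?thesis by (intro exI[of _ "c b"]) simp
  qed
  obtain c1 where c1: "1 - \<iota> c1 * b \<in> \<mm>" using ex[OF R_1] by blast
  then have "c1 \<noteq> 0" using one_notin_m by auto
  obtain c2 where c2: "z - \<iota> c2 * b \<in> \<mm>" using ex[OF z] by blast
  have "(z - \<iota> c2 * b) - \<iota> (c2 / c1) * (1 - \<iota> c1 * b) \<in> \<mm>"
    using m_diff[OF c2 m_mult[OF R_iota c1]] .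
  moreover have "(z - \<iota> c2 * b) - \<iota> (c2 / c1) * (1 - \<iota> c1 * b) = z - \<iota> (c2 / c1)"
    using \<open>c1 \<noteq> 0\<close> by (simp add: iota_divide right_diff_distrib)
  ultimately show ?thesis by auto
qed

lemma m_cong_mult:
  assumes "z - a \<in> \<mm>" "w - b \<in> \<mm>" "a \<in> R" "w \<in> R"
  shows "z * w - a * b \<in> \<mm>"
proof -
  have "(z - a) * w + a * (w - b) \<in> \<mm>" using assms m_add m_mult m_mult2 by blast
  then show ?thesis by (simp add: algebra_simps)
qed

lemma m_cong_R: "z - a \<in> \<mm> \<Longrightarrow> a \<in> R \<Longrightarrow> z \<in> R"
  using R_add[OF m_R[of "z - a"]] by force

lemma m_cong_iota_mult: "z - \<iota> a \<in> \<mm> \<Longrightarrow> w - \<iota> b \<in> \<mm> \<Longrightarrow> z * w - \<iota> (a * b) \<in> \<mm>"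
  unfolding iota_mult by (rule m_cong_mult) (auto intro: R_iota m_cong_R[OF _ R_iota])

lemma m_cong_iota_add: "z - \<iota> a \<in> \<mm> \<Longrightarrow> w - \<iota> b \<in> \<mm> \<Longrightarrow> (z + w) - \<iota> (a + b) \<in> \<mm>"
  using m_add[of "z - \<iota> a" "w - \<iota> b"] by (simp add: iota_add algebra_simps)

lemma m_cong_iota_power: "z - \<iota> a \<in> \<mm> \<Longrightarrow> z ^ n - \<iota> (a ^ n) \<in> \<mm>"
proof (induction n)
  case 0 then show ?case using m_0 by simp
next
  case (Suc n) then show ?case using m_cong_iota_mult[of z a "z ^ n" "a ^ n"] by simp
qed

lemma m_iota_eq: "z - \<iota> a \<in> \<mm> \<Longrightarrow> z - \<iota> b \<in> \<mm> \<Longrightarrow> a = b"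
proof (rule ccontr)
  assume a: "z - \<iota> a \<in> \<mm>" "z - \<iota> b \<in> \<mm>" and "a \<noteq> b"
  then have "\<iota> (b - a) \<in> R - \<mm>" by (intro unit_iota) simp
  moreover have "\<iota> (b - a) \<in> \<mm>" using m_diff[OF a] by (simp add: iota_diff)
  ultimately show False by blast
qed

end

context cubic_field
begin

lemma L_mult: "a \<in> L N \<Longrightarrow> b \<in> L K \<Longrightarrow> a * b \<in> L (N + K)"
  using d_mult[of a b] O_mult[of a b] O_0 unfolding L_def by (cases "a = 0"; cases "b = 0") auto

lemma L_self: "a \<in> \<O> \<Longrightarrow> a \<in> L (d a)"
  unfolding L_def by simp

lemma x_nz: "x \<noteq> 0"
  using e_eq_0_iff[of "[:0, 1:]"] by (simp add: e_pCons del: e_eq_0_iff)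

lemma x_not_iota: "x \<noteq> \<iota> c"
proof
  assume "x = \<iota> c"
  then have "e [:- c, 1:] = 0" unfolding e_pCons[of "- c"] e_const iota_minus iota_1 by (simp only: mult_1_right ab_left_minus)
  then show False by simp
qed

definition Rinf :: "'f set" where "Rinf = {z. \<exists>b\<in>\<O>. b \<noteq> 0 \<and> (\<exists>a\<in>L (d b). z = a / b)}"

lemma RinfI: "a \<in> L (d b) \<Longrightarrow> b \<in> \<O> \<Longrightarrow> b \<noteq> 0 \<Longrightarrow> a / b \<in> Rinf"
  unfolding Rinf_def by blast

lemma Rinf_valuation: "valuation_ring \<iota> Rinf" and x_notin_Rinf: "x \<notin> Rinf"
proof -
  show x: "x \<notin> Rinf"
  proof
    assume "x \<in> Rinf"
    then obtain a b where ab: "b \<in> \<O>" "b \<noteq> 0" "a \<in> L (d b)" "x = a / b" unfolding Rinf_def by blast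
    then have a: "a = x * b" by simp
    then have "d a = 3 + d b" "a \<noteq> 0" using d_mult[OF O_x ab(1) x_nz ab(2)] d_x x_nz ab by auto
    then show False using ab(3) unfolding L_def by simp
  qed
  have iota: "\<iota> c \<in> Rinf" for c
  proof -
    have "\<iota> c \<in> L (d 1)" using O_iota d_iota[of c] unfolding L_def by simp
    then show ?thesis using RinfI[of "\<iota> c" 1] O_1 by simp
  qed
  show "valuation_ring \<iota> Rinf" unfolding valuation_ring_def
  proof (intro conjI ballI allI)
    have inv: "inverse x \<in> Rinf"
    proof -
      have "1 \<in> L (d x)" using O_1 d_iota[of 1] unfolding L_def by simp
      moreover have "inverse x = 1 / x" by (simp add: divide_inverse)
      ultimately show ?thesis unfolding Rinf_def using O_x x_nz by blast
    qed
    have "inverse x \<noteq> \<iota> c" for c using x_not_iota[of "inverse c"] by (metis inverse_inverse_eq iota_inverse)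
    then show "range \<iota> \<subset> Rinf" using iota inv by blast
    show "Rinf \<subset> UNIV" using x by blast
    fix z w assume "z \<in> Rinf" "w \<in> Rinf"
    then obtain a b a' b' where h: "b \<in> \<O>" "b \<noteq> 0" "a \<in> L (d b)" "z = a / b" "b' \<in> \<O>" "b' \<noteq> 0" "a' \<in> L (d b')" "w = a' / b'"
      unfolding Rinf_def by blast
    have bb: "b * b' \<in> \<O>" "b * b' \<noteq> 0" "d (b * b') = d b + d b'" using h O_mult d_mult by auto
    have "z * w = (a * a') / (b * b')" "z + w = (a * b' + b * a') / (b * b')" using h by (auto simp: field_simps)
    moreover have "a * a' \<in> L (d (b * b'))" "a * b' + b * a' \<in> L (d (b * b'))"
      unfolding bb(3) using h by (auto intro: L_mult L_self L_add)
    ultimately show "z + w \<in> Rinf" "z * w \<in> Rinf" unfolding Rinf_def using bb by blast+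
  next
    fix z
    obtain a b where ab: "a \<in> \<O>" "b \<in> \<O>" "b \<noteq> 0" "z = a / b" using fraction by blast
    show "z \<in> Rinf \<or> inverse z \<in> Rinf"
    proof (cases "a \<in> L (d b)")
      case True then show ?thesis using ab unfolding Rinf_def by blast
    next
      case False
      then have "a \<noteq> 0" "b \<in> L (d a)" using ab L_0 unfolding L_def by auto
      moreover have "inverse z = b / a" using ab by simp
      ultimately show ?thesis using ab unfolding Rinf_def by blast
    qed
  qed
qed

end

locale infinite_place = cubic_field \<iota> p s m x y + place \<iota> R
  for \<iota> :: "'k::field \<Rightarrow> 'f::field" and p s m x y and R :: "'f set" +
  assumes x_R: "x \<notin> R"
begin

text \<open>\<open>t\<close> is a uniformizer at infinity with \<open>x t\<^sup>3 \<equiv> 1\<close> and \<open>y t\<^sup>m \<equiv> 1\<close>; \<open>lead z n c\<close> says that \<open>z\<close> has leading term \<open>c t\<^sup>-\<^sup>n\<close>.\<close>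

definition t :: 'f where "t = x ^ (m div 3) / y"

definition lead :: "'f \<Rightarrow> nat \<Rightarrow> 'k \<Rightarrow> bool" where "lead z n c \<longleftrightarrow> c \<noteq> 0 \<and> z * t ^ n - \<iota> c \<in> \<mm>"

lemma m_eq: "m = 3 * (m div 3) + 1" using m3 by (metis mult_div_mod_eq)

lemma t_facts: "t \<in> \<mm>" "t \<noteq> 0" "x * t ^ 3 - 1 \<in> \<mm>" "y \<noteq> 0"
proof -
  \<comment> \<open>y^3 = x^m v with v a unit, and 3 (m div 3) + 1 = m. Thus x t^3 is the inverse of
    v, which is 1 modulo the maximal ideal.\<close>
  define v where "v = 1 + inverse x ^ (m - 1)"
  have s: "inverse x ^ (m - 1) \<in> \<mm>" using notin_R[OF x_R] m1 by (intro m_power) auto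
  have v: "v \<in> R - \<mm>" unfolding v_def by (rule unit_add_m[OF unit_1 s])
  have v0: "v \<noteq> 0" using v unfolding unit_iff by simp
  have xm: "x ^ m = x * x ^ (m - 1)" using m1 by (metis Suc_diff_1 less_trans power_Suc zero_less_one)
  have y3: "y ^ 3 = x ^ m * v"
    unfolding eq v_def xm using x_nz by (simp add: field_simps)
  then have "y ^ 3 \<noteq> 0" using v0 x_nz by simp
  then show y0: "y \<noteq> 0" by auto
  have "x * t ^ 3 = x * x ^ (3 * (m div 3)) / y ^ 3"
    unfolding t_def by (simp add: power_divide mult.commute flip: power_mult)
  also have "x * x ^ (3 * (m div 3)) = x ^ m" by (metis m_eq power_add power_one_right mult.commute)
  finally have u: "x * t ^ 3 = inverse v" unfolding y3 using x_nz v0 by (simp add: divide_inverse)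
  have "inverse v * (1 - v) = inverse v - 1" using v0 by (simp add: right_diff_distrib)
  moreover have "inverse v * (1 - v) \<in> \<mm>"
    using m_mult[of "inverse v" "1 - v"] v m_minus[OF s] unfolding unit_iff v_def by simp
  ultimately show "x * t ^ 3 - 1 \<in> \<mm>" unfolding u by simp
  have "t ^ 3 = (x * t ^ 3) * inverse x" using x_nz by simp
  then have "t ^ 3 = inverse v * inverse x" unfolding u .
  then have "t ^ 3 \<in> \<mm>" using m_mult[of "inverse v" "inverse x"] v notin_R[OF x_R] unfolding unit_iff by simp
  then show "t \<in> \<mm>" by (rule m_of_power) simp
  show "t \<noteq> 0" unfolding t_def using x_nz y0 by simp
qed

lemma lead_mult: "lead z n c \<Longrightarrow> lead w k c' \<Longrightarrow> lead (z * w) (n + k) (c * c')"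
  unfolding lead_def using m_cong_iota_mult[of "z * t ^ n" c "w * t ^ k" c'] by (simp add: power_add mult_ac)

lemma lead_iota: "c \<noteq> 0 \<Longrightarrow> lead (\<iota> c) 0 c"
  unfolding lead_def using m_0 by simp

lemma lead_x: "lead x 3 1"
  unfolding lead_def using t_facts by simp

lemma lead_power: "lead z n c \<Longrightarrow> lead (z ^ k) (k * n) (c ^ k)"
proof (induction k)
  case 0 show ?case using lead_iota[of 1] by simp
next
  case (Suc k) then show ?case using lead_mult[of z n c "z ^ k"] by simp
qed

lemma lead_y: "lead y m 1"
proof -
  have "y * t ^ m = x ^ (m div 3) * t ^ (m div 3 * 3)"
  proof -
    have "y * t ^ m = (y * t) * t ^ (m div 3 * 3)" by (subst m_eq) (simp add: mult_ac)
    also have "y * t = x ^ (m div 3)" unfolding t_def using t_facts(4) by simp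
    finally show ?thesis .
  qed
  then show ?thesis using lead_power[OF lead_x, of "m div 3"] unfolding lead_def by simp
qed

lemma lead_R: "lead z n c \<Longrightarrow> z * t ^ n \<in> R - \<mm>"
  using unit_add_m[of "\<iota> c" "z * t ^ n - \<iota> c"] unit_iota unfolding lead_def by simp

lemma lead_small: assumes "lead w k c" "k < n" shows "w * t ^ n \<in> \<mm>"
proof -
  have "t ^ n = t ^ k * t ^ (n - k)" using assms(2) by (simp flip: power_add)
  then have "w * t ^ n = (w * t ^ k) * t ^ (n - k)" by simp
  moreover have "(w * t ^ k) * t ^ (n - k) \<in> \<mm>"
    using lead_R[OF assms(1)] m_power[OF t_facts(1), of "n - k"] assms(2) m_mult by simp
  ultimately show ?thesis by (simp only:)
qed

lemma lead_add: assumes "lead z n c" "w * t ^ n \<in> \<mm>" shows "lead (z + w) n c"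
  using assms m_add[of "z * t ^ n - \<iota> c" "w * t ^ n"] unfolding lead_def by (simp add: algebra_simps)

lemma lead_e: "A \<noteq> 0 \<Longrightarrow> lead (e A) (3 * degree A) (lead_coeff A)"
proof (induction A)
  case (pCons c A)
  show ?case
  proof (cases "A = 0")
    case True
    then show ?thesis using pCons.prems lead_iota[of c] by simp
  next
    case False
    have 1: "lead (x * e A) (3 + 3 * degree A) (1 * lead_coeff A)"
      by (rule lead_mult[OF lead_x]) (use pCons.IH False in simp)
    have "\<iota> c * t ^ (3 + 3 * degree A) \<in> \<mm>"
      by (cases "c = 0") (use m_0 lead_small[OF lead_iota] in auto)
    from lead_add[OF 1 this] show ?thesis using False by (simp add: e_pCons add.commute)
  qed
qed simp

lemma lead_P:
  assumes nz: "\<not> (A = 0 \<and> B = 0 \<and> C = 0)"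
  shows "\<exists>c. lead (P A B C) (degree (Nm A B C)) c"
proof -
  have 1: "A \<noteq> 0 \<Longrightarrow> lead (e A) (3 * degree A) (lead_coeff A)" by (rule lead_e)
  have 2: "B \<noteq> 0 \<Longrightarrow> lead (e B * y) (3 * degree B + m) (lead_coeff B)"
    using lead_mult[OF lead_e lead_y] by simp
  have 3: "C \<noteq> 0 \<Longrightarrow> lead (e C * y ^ 2) (3 * degree C + 2 * m) (lead_coeff C)"
    using lead_mult[OF lead_e lead_power[OF lead_y, of 2]] by simp
  have s1: "e A * t ^ n \<in> \<mm>" if "A \<noteq> 0 \<longrightarrow> 3 * degree A < n" for n
    using that lead_small[OF 1] m_0 by (cases "A = 0") auto
  have s2: "e B * y * t ^ n \<in> \<mm>" if "B \<noteq> 0 \<longrightarrow> 3 * degree B + m < n" for n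
    using that lead_small[OF 2] m_0 by (cases "B = 0") auto
  have s3: "e C * y ^ 2 * t ^ n \<in> \<mm>" if "C \<noteq> 0 \<longrightarrow> 3 * degree C + 2 * m < n" for n
    using that lead_small[OF 3] m_0 by (cases "C = 0") auto
  from norm_degree[OF nz, THEN conjunct2] show ?thesis
  proof (elim disjE conjE)
    assume h: "A \<noteq> 0" "degree (Nm A B C) = 3 * degree A" "B \<noteq> 0 \<longrightarrow> 3 * degree B + m < 3 * degree A"
      "C \<noteq> 0 \<longrightarrow> 3 * degree C + 2 * m < 3 * degree A"
    then show ?thesis unfolding P_def h(2) using lead_add[OF lead_add[OF 1 s2] s3] by blast
  next
    assume h: "B \<noteq> 0" "degree (Nm A B C) = 3 * degree B + m" "A \<noteq> 0 \<longrightarrow> 3 * degree A < 3 * degree B + m"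
      "C \<noteq> 0 \<longrightarrow> 3 * degree C + 2 * m < 3 * degree B + m"
    then show ?thesis unfolding P_def h(2) using lead_add[OF lead_add[OF 2 s1] s3] by (metis add.commute)
  next
    assume h: "C \<noteq> 0" "degree (Nm A B C) = 3 * degree C + 2 * m" "A \<noteq> 0 \<longrightarrow> 3 * degree A < 3 * degree C + 2 * m"
      "B \<noteq> 0 \<longrightarrow> 3 * degree B + m < 3 * degree C + 2 * m"
    then have "lead (e C * y ^ 2 + e A + e B * y) (3 * degree C + 2 * m) (lead_coeff C)"
      using lead_add[OF lead_add[OF 3 s1] s2] by blast
    then show ?thesis unfolding P_def h(2) by (metis add.commute add.left_commute)
  qed
qed

lemma lead_O: assumes "z \<in> \<O>" "z \<noteq> 0" shows "\<exists>c. lead z (d z) c"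
proof -
  obtain A B C where z: "z = P A B C" using assms unfolding \<O>_def by blast
  then show ?thesis using lead_P[of A B C] assms(2) unfolding d_def by (auto simp: nm_P P_eq_0_iff)
qed

lemma quotient_decomp:
  assumes "a \<in> \<O>" "b \<in> \<O>" "a \<noteq> 0" "b \<noteq> 0"
  shows "a / b = t powi (int (d b) - int (d a)) * ((a * t ^ d a) / (b * t ^ d b))"
    and "(a * t ^ d a) / (b * t ^ d b) \<in> R - \<mm>"
proof -
  show "a / b = t powi (int (d b) - int (d a)) * ((a * t ^ d a) / (b * t ^ d b))"
    using t_facts(2) by (simp add: power_int_diff)
  show "(a * t ^ d a) / (b * t ^ d b) \<in> R - \<mm>"
    using lead_O assms lead_R unit_divide by meson
qed

lemma unif_t: "unif t"
  unfolding unif_def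
proof (intro conjI allI impI t_facts(1,2))
  fix z :: 'f assume z: "z \<noteq> 0"
  obtain a b where ab: "a \<in> \<O>" "b \<in> \<O>" "b \<noteq> 0" "z = a / b" using fraction by blast
  then have "a \<noteq> 0" using z by auto
  then show "\<exists>n. \<exists>u\<in>R - \<mm>. z = t powi n * u" using quotient_decomp[OF ab(1,2)] ab by blast
qed

lemma ord_quotient:
  assumes "a \<in> \<O>" "b \<in> \<O>" "a \<noteq> 0" "b \<noteq> 0"
  shows "place_ord R (a / b) = int (d b) - int (d a)"
  using place_ord_eq[OF unif_t quotient_decomp(2)[OF assms] quotient_decomp(1)[OF assms]] .

lemma in_R_iff_ord: "z \<noteq> 0 \<Longrightarrow> z \<in> R \<longleftrightarrow> place_ord R z \<ge> 0"
  using ord_ge_iff[OF unif_t, of z 0] by simp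

text \<open>The order of a / b is d b - d a for every valuation ring that omits x, so membership
  depends on pole orders in O alone and only one such ring exists.\<close>

lemma R_eq_Rinf: "R = Rinf"
proof -
  have "z \<in> R \<longleftrightarrow> z \<in> Rinf" for z
  proof (cases "z = 0")
    case True
    have "0 \<in> Rinf" using RinfI[of 0 1] O_1 L_0 by simp
    then show ?thesis using R_0 True by simp
  next
    case False
    obtain a b where ab: "a \<in> \<O>" "b \<in> \<O>" "b \<noteq> 0" "z = a / b" using fraction by blast
    then have a0: "a \<noteq> 0" using False by auto
    have zR: "z \<in> R \<longleftrightarrow> d a \<le> d b" using in_R_iff_ord[OF False] ord_quotient[OF ab(1,2) a0 ab(3)] ab(4) by simp
    have "z \<in> Rinf \<Longrightarrow> z \<in> R"
    proof -
      assume "z \<in> Rinf"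
      then obtain a' b' where h: "b' \<in> \<O>" "b' \<noteq> 0" "a' \<in> L (d b')" "z = a' / b'" unfolding Rinf_def by blast
      then have "a' \<noteq> 0" "a' \<in> \<O>" "d a' \<le> d b'" using False unfolding L_def by auto
      then show "z \<in> R" using in_R_iff_ord[OF False] ord_quotient[of a' b'] h by simp
    qed
    moreover have "z \<in> Rinf" if "z \<in> R"
      unfolding Rinf_def using that zR ab unfolding L_def by blast
    ultimately show ?thesis by blast
  qed
  then show ?thesis by blast
qed

text \<open>For a unit a / b the pole orders agree, and the residue is the quotient of the leading
  coefficients of a and b.\<close>

lemma residue_iota: assumes "z \<in> R" shows "\<exists>c. z - \<iota> c \<in> \<mm>"
proof (cases "z \<in> \<mm>")
  case True
  then show ?thesis by (intro exI[of _ 0]) simp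
next
  case False
  then have z0: "z \<noteq> 0" using m_0 by blast
  obtain a b where ab: "a \<in> \<O>" "b \<in> \<O>" "b \<noteq> 0" "z = a / b" using fraction by blast
  then have a0: "a \<noteq> 0" using z0 by auto
  have "z \<in> R - \<mm>" using assms False by simp
  then have "place_ord R z = 0" using place_ord_eq[OF unif_t, of z z 0] by simp
  then have dd: "d a = d b" using ord_quotient[OF ab(1,2) a0 ab(3)] ab(4) by simp
  obtain c where c: "lead a (d a) c" using lead_O ab a0 by blast
  obtain c' where c': "lead b (d b) c'" using lead_O ab by blast
  let ?u = "b * t ^ d b"
  have u: "?u \<in> R - \<mm>" by (rule lead_R[OF c'])
  have c0: "c' \<noteq> 0" using c' unfolding lead_def by simp
  have "(a * t ^ d a - \<iota> c) - \<iota> (c / c') * (?u - \<iota> c') \<in> \<mm>"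
    using c c' m_diff m_mult[OF R_iota] unfolding lead_def by blast
  then have "inverse ?u * ((a * t ^ d a - \<iota> c) - \<iota> (c / c') * (?u - \<iota> c')) \<in> \<mm>"
    using m_mult u unfolding unit_iff by blast
  moreover have "inverse ?u * ((a * t ^ d a - \<iota> c) - \<iota> (c / c') * (?u - \<iota> c')) = z - \<iota> (c / c')"
  proof -
    have "\<iota> (c / c') * \<iota> c' = \<iota> c" using c0 by (simp flip: iota_mult)
    then have "(a * t ^ d a - \<iota> c) - \<iota> (c / c') * (?u - \<iota> c') = a * t ^ d a - \<iota> (c / c') * ?u"
      by (simp add: right_diff_distrib)
    also have "a * t ^ d a - \<iota> (c / c') * ?u = z * ?u - \<iota> (c / c') * ?u" using ab dd by simp
    also have "\<dots> = (z - \<iota> (c / c')) * ?u" by (rule left_diff_distrib[symmetric])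
    finally have f: "(a * t ^ d a - \<iota> c) - \<iota> (c / c') * (?u - \<iota> c') = (z - \<iota> (c / c')) * ?u" .
    have "?u \<noteq> 0" using u unfolding unit_iff by simp
    moreover have "inverse u * (w * u) = w" if "u \<noteq> 0" for u w :: 'f using that by simp
    ultimately show ?thesis unfolding f by blast
  qed
  ultimately show ?thesis by auto
qed

lemma degree_1: "place_degree \<iota> R = 1"
  using place_degree_1I residue_iota by blast

end

context cubic_field
begin

lemma infinite_place_Rinf: "infinite_place \<iota> p s m x y Rinf"
  by unfold_locales (use Rinf_valuation x_notin_Rinf in auto)

lemma infinite_place_unique: "valuation_ring \<iota> R \<Longrightarrow> x \<notin> R \<Longrightarrow> R = Rinf"
proof -
  assume "valuation_ring \<iota> R" "x \<notin> R"
  then interpret infinite_place \<iota> p s m x y R by unfold_locales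
  show ?thesis by (rule R_eq_Rinf)
qed

section \<open>The places of the affine rational points\<close>

definition val :: "'k \<Rightarrow> 'k \<Rightarrow> 'k poly \<Rightarrow> 'k poly \<Rightarrow> 'k poly \<Rightarrow> 'k" where
  "val a b A B C = poly A a + poly B a * b + poly C a * b ^ 2"

definition point_ideal :: "'k \<Rightarrow> 'k \<Rightarrow> 'f set" where
  "point_ideal a b = {z. \<exists>A B C. z = P A B C \<and> val a b A B C = 0}"

lemma point_ideal_P: "P A B C \<in> point_ideal a b \<longleftrightarrow> val a b A B C = 0"
  unfolding point_ideal_def by (auto simp: P_inj)

lemma val_mult:
  assumes "b ^ 3 = a ^ m + a"
  shows "val a b (A * A' + (B * C' + C * B') * fX) (A * B' + B * A' + C * C' * fX) (A * C' + B * B' + C * A')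
    = val a b A B C * val a b A' B' C'"
proof -
  have f: "poly fX a = b ^ 3" unfolding fX_def assms by (simp add: poly_monom)
  show ?thesis unfolding val_def poly_add poly_mult f by algebra
qed

lemma prime_id_point:
  assumes ab: "b ^ 3 = a ^ m + a"
  shows "prime_id (point_ideal a b)"
  unfolding prime_id_def
proof (intro conjI ballI impI)
  show "point_ideal a b \<subseteq> \<O>" unfolding point_ideal_def \<O>_def by blast
  show "0 \<in> point_ideal a b" using point_ideal_P[of 0 0 0 a b] by (simp add: val_def)
  have "P 1 0 0 = 1" by (simp add: P_def)
  then show "1 \<notin> point_ideal a b" using point_ideal_P[of 1 0 0 a b] by (simp add: val_def)
  have "P [:- a, 1:] 0 0 \<in> point_ideal a b" by (simp add: point_ideal_P val_def)
  moreover have "P [:- a, 1:] 0 0 \<noteq> 0" by (simp add: P_eq_0_iff)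
  ultimately show "\<exists>z\<in>point_ideal a b. z \<noteq> 0" by blast
  fix z w
  { assume "z \<in> point_ideal a b" "w \<in> point_ideal a b"
    then obtain A B C A' B' C' where h: "z = P A B C" "val a b A B C = 0" "w = P A' B' C'" "val a b A' B' C' = 0"
      unfolding point_ideal_def by blast
    have "val a b (A + A') (B + B') (C + C') = val a b A B C + val a b A' B' C'"
      unfolding val_def by (simp add: algebra_simps)
    then show "z + w \<in> point_ideal a b" unfolding h P_add point_ideal_P using h by simp }
  { assume "z \<in> point_ideal a b" "w \<in> \<O>"
    then obtain A B C A' B' C' where h: "z = P A B C" "val a b A B C = 0" "w = P A' B' C'"
      unfolding point_ideal_def \<O>_def by blast
    show "z * w \<in> point_ideal a b" unfolding h P_mult point_ideal_P val_mult[OF ab] using h by simp }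
  { assume "z \<in> \<O>" "w \<in> \<O>" and zw: "z * w \<in> point_ideal a b"
    then obtain A B C A' B' C' where h: "z = P A B C" "w = P A' B' C'"
      unfolding \<O>_def by blast
    show "z \<in> point_ideal a b \<or> w \<in> point_ideal a b"
      using zw unfolding h P_mult point_ideal_P val_mult[OF ab] by simp }
qed

lemma place_at_point:
  assumes "finite_place R" "x - \<iota> a \<in> max_ideal R" "y - \<iota> b \<in> max_ideal R"
  shows "P A B C - \<iota> (val a b A B C) \<in> max_ideal R"
proof -
  interpret place \<iota> R using assms unfolding finite_place_def by unfold_locales auto
  have e: "e A - \<iota> (poly A a) \<in> \<mm>" for A
  proof (induction A)
    case 0 then show ?case using m_0 by simp
  next
    case (pCons c A)
    have "\<iota> c - \<iota> c \<in> \<mm>" using m_0 by simp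
    from m_cong_iota_add[OF this m_cong_iota_mult[OF assms(2) pCons.IH]] show ?case by (simp add: e_pCons)
  qed
  show ?thesis unfolding P_def val_def
    by (intro m_cong_iota_add m_cong_iota_mult e m_cong_iota_power assms)
qed

definition Rpt :: "'k \<times> 'k \<Rightarrow> 'f set" where
  "Rpt ab = cubic_prime.loc \<iota> x y (point_ideal (fst ab) (snd ab))"

lemma Rp_facts:
  assumes ab: "b ^ 3 = a ^ m + a"
  shows "finite_place (Rpt (a, b))" "max_ideal (Rpt (a, b)) \<inter> \<O> = point_ideal a b"
    "x - \<iota> a \<in> max_ideal (Rpt (a, b))" "y - \<iota> b \<in> max_ideal (Rpt (a, b))"
    "place_degree \<iota> (Rpt (a, b)) = 1"
proof -
  interpret I: cubic_prime \<iota> p s m x y "point_ideal a b"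
    by unfold_locales (rule prime_id_point[OF ab])
  have R: "Rpt (a, b) = I.loc" unfolding Rpt_def by simp
  show fp: "finite_place (Rpt (a, b))" unfolding finite_place_def R using I.loc_valuation by blast
  show mI: "max_ideal (Rpt (a, b)) \<inter> \<O> = point_ideal a b" unfolding R by (rule I.loc_valuation(3))
  have "x - \<iota> a = P [:- a, 1:] 0 0" by (simp add: P_def e_pCons[of "- a"] iota_minus)
  then have "x - \<iota> a \<in> point_ideal a b" by (simp add: point_ideal_P val_def)
  then show xa: "x - \<iota> a \<in> max_ideal (Rpt (a, b))" using mI by blast
  have "y - \<iota> b = P [:- b:] 1 0" by (simp add: P_def iota_minus)
  then have "y - \<iota> b \<in> point_ideal a b" by (simp add: point_ideal_P val_def)
  then show yb: "y - \<iota> b \<in> max_ideal (Rpt (a, b))" using mI by blast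
  interpret pl: place \<iota> "Rpt (a, b)" using fp unfolding finite_place_def by unfold_locales auto
  have "\<exists>c. z - \<iota> c \<in> pl.\<mm>" if z: "z \<in> Rpt (a, b)" for z
  proof -
    obtain w where w: "w \<in> \<O>" "z - w \<in> pl.\<mm>" using finite_place_residues(1)[OF fp] z by blast
    obtain A B C where "w = P A B C" using w unfolding \<O>_def by blast
    then have "w - \<iota> (val a b A B C) \<in> pl.\<mm>" using place_at_point[OF fp xa yb] by simp
    then show ?thesis using pl.m_diff_trans w by blast
  qed
  then show "place_degree \<iota> (Rpt (a, b)) = 1" using pl.place_degree_1I by blast
qed

text \<open>At a finite place of degree 1, x and y are congruent to constants a and b, and (a, b)
  lies on the curve. The centre contains the kernel of evaluation at this point, so
  \<open>finite_place_eq\<close> identifies the place.\<close>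

lemma rational_places:
  "{R \<in> places \<iota>. place_degree \<iota> R = 1} = insert Rinf (Rpt ` {(a, b). b ^ 3 = a ^ m + a})"
proof
  show "insert Rinf (Rpt ` {(a, b). b ^ 3 = a ^ m + a}) \<subseteq> {R \<in> places \<iota>. place_degree \<iota> R = 1}"
    using Rp_facts(1,5) infinite_place.degree_1[OF infinite_place_Rinf] Rinf_valuation
    unfolding places_def finite_place_def by auto
  show "{R \<in> places \<iota>. place_degree \<iota> R = 1} \<subseteq> insert Rinf (Rpt ` {(a, b). b ^ 3 = a ^ m + a})"
  proof
    fix R assume "R \<in> {R \<in> places \<iota>. place_degree \<iota> R = 1}"
    then have vr: "valuation_ring \<iota> R" and deg: "place_degree \<iota> R = 1" unfolding places_def by auto
    show "R \<in> insert Rinf (Rpt ` {(a, b). b ^ 3 = a ^ m + a})"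
    proof (cases "x \<in> R")
      case False then show ?thesis using infinite_place_unique[OF vr] by blast
    next
      case True
      then have fp: "finite_place R" unfolding finite_place_def using vr by blast
      interpret place \<iota> R by unfold_locales (rule vr)
      obtain W where W: "finite W" "\<forall>z\<in>R. \<exists>w\<in>W. z - w \<in> \<mm>" using finite_place_residues(2)[OF fp] by blast
      have res: "\<exists>c. z - \<iota> c \<in> \<mm>" if "z \<in> R" for z
        by (rule place_degree_1D[OF W(1) _ deg that]) (use W(2) in blast)
      obtain a where a: "x - \<iota> a \<in> \<mm>" using res[OF True] by blast
      obtain b where b: "y - \<iota> b \<in> \<mm>" using res[of y] finite_place_O[OF fp] O_y by blast
      have "y ^ 3 - \<iota> (b ^ 3) \<in> \<mm>" by (rule m_cong_iota_power[OF b])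
      moreover have "y ^ 3 - \<iota> (a ^ m + a) \<in> \<mm>" unfolding eq by (intro m_cong_iota_add m_cong_iota_power a)
      ultimately have ab: "b ^ 3 = a ^ m + a" by (rule m_iota_eq)
      have "point_ideal a b \<subseteq> \<mm> \<inter> \<O>"
      proof
        fix z assume "z \<in> point_ideal a b"
        then obtain A B C where "z = P A B C" "val a b A B C = 0" unfolding point_ideal_def by blast
        then show "z \<in> \<mm> \<inter> \<O>" using place_at_point[OF fp a b, of A B C] O_P by simp
      qed
      then have "R = Rpt (a, b)" using finite_place_eq[OF fp Rp_facts(1)[OF ab]] Rp_facts(2)[OF ab] by simp
      then show ?thesis using ab by blast
    qed
  qed
qed

lemma num_rational_points_eq:
  "num_rational_points \<iota> = card {(a, b). (b::'k) ^ 3 = a ^ m + a} + 1"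
proof -
  let ?S = "{(a, b). (b::'k) ^ 3 = a ^ m + a}"
  have "inj_on Rpt ?S"
  proof (rule inj_onI, clarify)
    fix a b a' b' :: 'k assume h: "b ^ 3 = a ^ m + a" "b' ^ 3 = a' ^ m + a'" "Rpt (a, b) = Rpt (a', b')"
    interpret place \<iota> "Rpt (a, b)" using Rp_facts(1)[OF h(1)] unfolding finite_place_def by unfold_locales auto
    show "a = a' \<and> b = b'" using m_iota_eq Rp_facts(3,4)[OF h(1)] Rp_facts(3,4)[OF h(2)] h(3) by metis
  qed
  then have "card (Rpt ` ?S) = card ?S" by (rule card_image)
  moreover have "Rinf \<notin> Rpt ` ?S" using Rp_facts(1) x_notin_Rinf unfolding finite_place_def by auto
  moreover have "finite ?S" by (rule finite_subset[OF subset_UNIV]) (simp add: finite_prod fin)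
  ultimately show ?thesis unfolding num_rational_points_def rational_places by simp
qed

end

section \<open>Orders of vanishing and dimensions\<close>

context place
begin

lemma unit_prod: "(\<And>b. b \<in> B \<Longrightarrow> g b \<in> R - \<mm>) \<Longrightarrow> prod g B \<in> R - \<mm>"
proof (induction B rule: infinite_finite_induct)
  case (insert b B)
  then have "g b * prod g B \<in> R - \<mm>" by (intro unit_mult) auto
  then show ?case using insert.hyps by simp
qed (use unit_1 in auto)

lemma divide_power_R_mono:
  assumes t: "t \<in> R" "t \<noteq> 0" and z: "z / t ^ n \<in> R" and kn: "k \<le> n"
  shows "z / t ^ k \<in> R"
proof -
  have "t ^ n = t ^ k * t ^ (n - k)" using kn by (simp flip: power_add)
  then have "z / t ^ k = (z / t ^ n) * t ^ (n - k)" using t by simp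
  then show ?thesis using R_mult[OF z R_power[OF t(1)]] by metis
qed

end

context cubic_field
begin

definition unif_at :: "'f set \<Rightarrow> 'f" where
  "unif_at R = (SOME t. t \<in> \<O> \<and> place.unif R t)"

lemma unif_at: assumes "finite_place R" shows "unif_at R \<in> \<O>" "place.unif R (unif_at R)"
proof -
  have "\<exists>t. t \<in> \<O> \<and> place.unif R t" using finite_place_unif[OF assms] by blast
  from someI_ex[OF this] show "unif_at R \<in> \<O>" "place.unif R (unif_at R)" unfolding unif_at_def by auto
qed

lemma finite_place_place: "finite_place R \<Longrightarrow> place \<iota> R"
  unfolding finite_place_def by unfold_locales auto

lemma unif_at_m: assumes "finite_place R" shows "unif_at R \<in> max_ideal R" "unif_at R \<noteq> 0" "unif_at R \<in> R"
proof -
  interpret place \<iota> R by (rule finite_place_place[OF assms])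
  show "unif_at R \<in> \<mm>" "unif_at R \<noteq> 0" using unif_at[OF assms] unfolding unif_def by auto
  then show "unif_at R \<in> R" using m_R by blast
qed

lemma finite_place_transversal:
  assumes "finite_place R"
  shows "\<exists>T. place.transversal R T \<and> card T = CARD('k) ^ place_degree \<iota> R"
proof -
  interpret place \<iota> R by (rule finite_place_place[OF assms])
  obtain W where W: "finite W" "\<forall>z\<in>R. \<exists>w\<in>W. z - w \<in> \<mm>" using finite_place_residues(2)[OF assms] by blast
  show ?thesis by (rule transversal_exists[OF W(1)]) (use W(2) in blast)
qed

lemma finite_place_degree_pos: assumes "finite_place R" shows "place_degree \<iota> R > 0"
proof (rule ccontr)
  interpret place \<iota> R by (rule finite_place_place[OF assms])
  assume "\<not> ?thesis"
  moreover obtain T where "transversal T" "card T = CARD('k) ^ place_degree \<iota> R"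
    using finite_place_transversal[OF assms] by blast
  ultimately show False using transversal_card_ge_2[of T] by simp
qed

text \<open>Order at least n R at each R in S, phrased by divisibility so that 0 is included:
  \<open>place_ord\<close> is specified only for nonzero elements.\<close>

definition vanish :: "'f set set \<Rightarrow> ('f set \<Rightarrow> nat) \<Rightarrow> 'f set" where
  "vanish S n = {z. \<forall>R\<in>S. z / unif_at R ^ n R \<in> R}"

text \<open>Raising the order by one costs at most a factor CARD('k)^(deg R): elements of order at
  least n are sorted by the class of z / t^n, and two in the same class differ by an element of
  order at least n + 1.\<close>

lemma vanish_step_le:
  assumes R: "finite_place R" and V: "finite V" "V \<subseteq> \<O>" "\<And>a b. a \<in> V \<Longrightarrow> b \<in> V \<Longrightarrow> a - b \<in> V"
  shows "card V \<le> card {z \<in> V. z / unif_at R ^ n \<in> R} * CARD('k) ^ (n * place_degree \<iota> R)"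
proof (induction n)
  case 0
  have "{z \<in> V. z / unif_at R ^ 0 \<in> R} = V" using V finite_place_O[OF R] by auto
  then show ?case by simp
next
  case (Suc n)
  interpret place \<iota> R by (rule finite_place_place[OF R])
  let ?t = "unif_at R"
  let ?V = "\<lambda>n. {z \<in> V. z / ?t ^ n \<in> R}"
  have t: "?t \<in> \<mm>" "?t \<noteq> 0" "?t \<in> R" using unif_at_m[OF R] by auto
  obtain T where T: "transversal T" "card T = CARD('k) ^ place_degree \<iota> R"
    using finite_place_transversal[OF R] by blast
  have "\<forall>z\<in>?V n. \<exists>\<tau>\<in>T. z / ?t ^ n - \<tau> \<in> \<mm>" using T(1) unfolding transversal_def by blast
  then have "\<forall>z\<in>?V n. \<exists>\<tau>. \<tau> \<in> T \<and> z / ?t ^ n - \<tau> \<in> \<mm>" by blast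
  from bchoice[OF this] obtain f where f: "\<And>z. z \<in> ?V n \<Longrightarrow> f z \<in> T \<and> z / ?t ^ n - f z \<in> \<mm>" by blast
  have "card (?V n) \<le> card (?V (Suc n)) * card T"
  proof (rule card_le_fibres)
    show "finite (?V n)" "finite (?V (Suc n))" using V(1) by auto
    show "finite T" using T(1) unfolding transversal_def by blast
    show "f ` ?V n \<subseteq> T" using f by blast
    fix a b assume ab: "a \<in> ?V n" "b \<in> ?V n" "f a = f b"
    have "a / ?t ^ n - b / ?t ^ n \<in> \<mm>"
      using f[OF ab(1)] f[OF ab(2)] ab(3) m_diff_trans[of "a / ?t ^ n" "f a" "b / ?t ^ n"] m_diff_sym[of "b / ?t ^ n" "f b"] by simp
    then obtain c where c: "c \<in> R" "a / ?t ^ n - b / ?t ^ n = ?t * c"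
      using unif_m[OF unif_at(2)[OF R]] by auto
    have "(a - b) / ?t ^ Suc n = (a / ?t ^ n - b / ?t ^ n) / ?t"
      by (simp add: diff_divide_distrib[symmetric] mult.commute)
    also have "\<dots> = c" unfolding c(2) using t by simp
    finally show "a - b \<in> ?V (Suc n)" using V(3) ab c(1) by simp
  qed
  then have "card (?V n) * CARD('k) ^ (n * place_degree \<iota> R)
      \<le> (card (?V (Suc n)) * card T) * CARD('k) ^ (n * place_degree \<iota> R)"
    by (rule mult_le_mono1)
  also have "\<dots> = card (?V (Suc n)) * CARD('k) ^ (Suc n * place_degree \<iota> R)"
    by (simp add: T(2) power_add mult_ac)
  finally show ?case using Suc.IH by (rule le_trans[rotated])
qed

lemma vanish_card_le:
  assumes S: "finite S" "\<And>R. R \<in> S \<Longrightarrow> finite_place R"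
    and V: "finite V" "V \<subseteq> \<O>" "\<And>a b. a \<in> V \<Longrightarrow> b \<in> V \<Longrightarrow> a - b \<in> V"
  shows "card V \<le> card (V \<inter> vanish S n) * CARD('k) ^ (\<Sum>R\<in>S. n R * place_degree \<iota> R)"
  using S
proof (induction S rule: finite_induct)
  case empty
  then show ?case unfolding vanish_def by simp
next
  case (insert R S)
  have R: "finite_place R" using insert.prems by blast
  interpret place \<iota> R by (rule finite_place_place[OF R])
  let ?W = "V \<inter> vanish S n"
  have W: "finite ?W" "?W \<subseteq> \<O>" using V by auto
  have Wd: "a - b \<in> ?W" if ab: "a \<in> ?W" "b \<in> ?W" for a b
  proof -
    have "(a - b) / unif_at R' ^ n R' \<in> R'" if "R' \<in> S" for R'
    proof -
      interpret R': place \<iota> R' by (rule finite_place_place) (use insert.prems that in blast)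
      show ?thesis using ab that R'.R_diff unfolding vanish_def by (simp add: diff_divide_distrib)
    qed
    then show ?thesis using ab V(3) unfolding vanish_def by blast
  qed
  have e: "{z \<in> ?W. z / unif_at R ^ n R \<in> R} = V \<inter> vanish (insert R S) n" unfolding vanish_def by auto
  have "card V \<le> card ?W * CARD('k) ^ (\<Sum>R\<in>S. n R * place_degree \<iota> R)" using insert by blast
  also have "\<dots> \<le> (card (V \<inter> vanish (insert R S) n) * CARD('k) ^ (n R * place_degree \<iota> R))
      * CARD('k) ^ (\<Sum>R\<in>S. n R * place_degree \<iota> R)"
    using vanish_step_le[OF R W Wd, of "n R"] unfolding e by (rule mult_le_mono1)
  also have "\<dots> = card (V \<inter> vanish (insert R S) n) * CARD('k) ^ (\<Sum>R\<in>insert R S. n R * place_degree \<iota> R)"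
    using insert.hyps by (simp add: power_add mult_ac)
  finally show ?case .
qed

section \<open>Incongruent systems for prescribed vanishing orders\<close>

definition separated :: "'f set \<Rightarrow> 'f set \<Rightarrow> bool" where
  "separated J T \<longleftrightarrow> finite T \<and> T \<subseteq> \<O> \<and> (\<forall>\<tau>\<in>T. \<forall>\<tau>'\<in>T. \<tau> - \<tau>' \<in> J \<longrightarrow> \<tau> = \<tau>')"

text \<open>A substitute for the Chinese remainder theorem: t^(n R) is multiplied by powers of
  elements that lie in the primes of the other R' but are units at R. They exist because centres of
  different places do not contain each other.\<close>

lemma exact_order_element:
  assumes S: "finite S" "\<And>R. R \<in> S \<Longrightarrow> finite_place R" and R: "R \<in> S"
  shows "\<exists>z\<in>\<O>. z \<in> vanish S n \<and> z / unif_at R ^ n R \<in> R - max_ideal R"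
proof -
  have fR: "finite_place R" using S R by blast
  interpret place \<iota> R by (rule finite_place_place[OF fR])
  have "\<exists>u. R' \<noteq> R \<longrightarrow> u \<in> max_ideal R' \<inter> \<O> \<and> u \<notin> \<mm>" if "R' \<in> S" for R'
    using finite_place_eq[OF fR S(2)[OF that]] by blast
  then obtain u where u: "\<And>R'. R' \<in> S \<Longrightarrow> R' \<noteq> R \<Longrightarrow> u R' \<in> max_ideal R' \<inter> \<O> \<and> u R' \<notin> \<mm>" by metis
  define w where "w = (\<Prod>R'\<in>S - {R}. u R' ^ n R')"
  let ?t = "unif_at R"
  have t: "?t \<in> \<O>" "?t \<noteq> 0" "?t \<in> R" using unif_at[OF fR] unif_at_m[OF fR] by auto
  have OR: "\<O> \<subseteq> R" by (rule finite_place_O[OF fR])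
  have wO: "w \<in> \<O>" unfolding w_def using u by (intro O_prod O_power) auto
  have wu: "w \<in> R - \<mm>" unfolding w_def
  proof (rule unit_prod)
    fix R' assume "R' \<in> S - {R}"
    then have "u R' \<in> R - \<mm>" using u[of R'] OR by blast
    then show "u R' ^ n R' \<in> R - \<mm>" by (rule unit_power)
  qed
  have "?t ^ n R * w \<in> vanish S n" unfolding vanish_def
  proof (intro CollectI ballI)
    fix R' assume R': "R' \<in> S"
    show "?t ^ n R * w / unif_at R' ^ n R' \<in> R'"
    proof (cases "R' = R")
      case True
      then show ?thesis using t wO OR by auto
    next
      case False
      have fR': "finite_place R'" using S R' by blast
      interpret R': place \<iota> R' by (rule finite_place_place[OF fR'])
      have OR': "\<O> \<subseteq> R'" by (rule finite_place_O[OF fR'])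
      have t': "unif_at R' \<noteq> 0" using unif_at_m[OF fR'] by auto
      obtain c where c: "c \<in> R'" "u R' = unif_at R' * c"
        using u[OF R' False] R'.unif_m[OF unif_at(2)[OF fR']] by auto
      have "w = u R' ^ n R' * (\<Prod>R''\<in>S - {R} - {R'}. u R'' ^ n R'')"
        unfolding w_def using S(1) R' False by (intro prod.remove) auto
      then have "?t ^ n R * w / unif_at R' ^ n R' = ?t ^ n R * (c ^ n R' * (\<Prod>R''\<in>S - {R} - {R'}. u R'' ^ n R''))"
        using t' c(2) by (simp add: power_mult_distrib)
      moreover have "(\<Prod>R''\<in>S - {R} - {R'}. u R'' ^ n R'') \<in> \<O>" using u by (intro O_prod O_power) auto
      then have "c ^ n R' * (\<Prod>R''\<in>S - {R} - {R'}. u R'' ^ n R'') \<in> R'"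
        using c(1) OR' by (intro R'.R_mult R'.R_power) auto
      moreover have "?t ^ n R \<in> R'" using OR' t(1) by (intro R'.R_power) auto
      ultimately show ?thesis using R'.R_mult by simp
    qed
  qed
  moreover have "?t ^ n R * w / ?t ^ n R \<in> R - \<mm>" using wu t by simp
  ultimately show ?thesis using O_mult O_power t wO by blast
qed

text \<open>Each old class is split by adding z g(\<tau>), where z has exact order n R at R and
  g(\<tau>) runs through representatives in O of the residue field. Division by z at R recovers the
  class of \<tau>.\<close>

lemma separated_step:
  assumes S: "finite S" "\<And>R. R \<in> S \<Longrightarrow> finite_place R" and R: "R \<in> S"
    and T: "separated (vanish S n) T"
  shows "\<exists>T'. separated (vanish S (n(R := Suc (n R)))) T' \<and> card T' = card T * CARD('k) ^ place_degree \<iota> R"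
proof -
  have fR: "finite_place R" using S R by blast
  interpret place \<iota> R by (rule finite_place_place[OF fR])
  let ?n' = "n(R := Suc (n R))"
  let ?t = "unif_at R"
  have t: "?t \<in> \<mm>" "?t \<noteq> 0" "?t \<in> R" using unif_at_m[OF fR] by auto
  have OR: "\<O> \<subseteq> R" by (rule finite_place_O[OF fR])
  obtain z where z: "z \<in> \<O>" "z \<in> vanish S n" "z / ?t ^ n R \<in> R - \<mm>"
    using exact_order_element[OF S R] by blast
  obtain T0 where T0: "transversal T0" "card T0 = CARD('k) ^ place_degree \<iota> R"
    using finite_place_transversal[OF fR] by blast
  have "\<forall>\<tau>\<in>T0. \<exists>a\<in>\<O>. \<tau> - a \<in> \<mm>" using T0(1) finite_place_residues(1)[OF fR] unfolding transversal_def by blast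
  then obtain g where g: "\<And>\<tau>. \<tau> \<in> T0 \<Longrightarrow> g \<tau> \<in> \<O> \<and> \<tau> - g \<tau> \<in> \<mm>" by metis
  have g_inj: "\<tau> = \<tau>'" if "\<tau> \<in> T0" "\<tau>' \<in> T0" "g \<tau> - g \<tau>' \<in> \<mm>" for \<tau> \<tau>'
  proof -
    have "\<tau> - \<tau>' \<in> \<mm>"
      using g[OF that(1)] g[OF that(2)] that(3) m_diff_trans[of \<tau> "g \<tau>" "g \<tau>'"] m_diff_trans[of \<tau> "g \<tau>'" \<tau>'] m_diff_sym by blast
    then show ?thesis using T0(1) that unfolding transversal_def by blast
  qed
  have sub: "vanish S ?n' \<subseteq> vanish S n"
  proof
    fix w assume w: "w \<in> vanish S ?n'"
    show "w \<in> vanish S n" unfolding vanish_def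
    proof (intro CollectI ballI)
      fix R' assume R': "R' \<in> S"
      show "w / unif_at R' ^ n R' \<in> R'"
      proof (cases "R' = R")
        case True
        have "w / ?t ^ Suc (n R) \<in> R" using w R unfolding vanish_def by force
        then show ?thesis using divide_power_R_mono[OF t(3,2), of w "Suc (n R)" "n R"] True by simp
      next
        case False
        then have "?n' R' = n R'" by simp
        moreover have "w / unif_at R' ^ ?n' R' \<in> R'" using w R' unfolding vanish_def by blast
        ultimately show ?thesis by (simp only:)
      qed
    qed
  qed
  have vO: "z * a \<in> vanish S n" if a: "a \<in> \<O>" for a
    unfolding vanish_def
  proof (intro CollectI ballI)
    fix R' assume R': "R' \<in> S"
    interpret R': place \<iota> R' by (rule finite_place_place[OF S(2)[OF R']])
    have "z / unif_at R' ^ n R' \<in> R'" using z(2) R' unfolding vanish_def by blast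
    then have "(z / unif_at R' ^ n R') * a \<in> R'" using R'.R_mult a finite_place_O[OF S(2)[OF R']] by blast
    then show "z * a / unif_at R' ^ n R' \<in> R'" by simp
  qed
  have vdiff: "a - b \<in> vanish S n" if ab: "a \<in> vanish S n" "b \<in> vanish S n" for a b
    unfolding vanish_def
  proof (intro CollectI ballI)
    fix R' assume R': "R' \<in> S"
    interpret R': place \<iota> R' by (rule finite_place_place[OF S(2)[OF R']])
    show "(a - b) / unif_at R' ^ n R' \<in> R'" using ab R' R'.R_diff unfolding vanish_def by (simp add: diff_divide_distrib)
  qed
  let ?f = "\<lambda>(\<sigma>, \<tau>). \<sigma> + z * g \<tau>"
  have key: "\<sigma> = \<sigma>' \<and> \<tau> = \<tau>'"
    if h: "\<sigma> \<in> T" "\<sigma>' \<in> T" "\<tau> \<in> T0" "\<tau>' \<in> T0" and v: "(\<sigma> + z * g \<tau>) - (\<sigma>' + z * g \<tau>') \<in> vanish S ?n'" for \<sigma> \<sigma>' \<tau> \<tau>'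
  proof -
    have gO: "g \<tau>' - g \<tau> \<in> \<O>" using g h O_diff by blast
    have "\<sigma> - \<sigma>' = ((\<sigma> + z * g \<tau>) - (\<sigma>' + z * g \<tau>')) - z * (g \<tau> - g \<tau>')" by (simp add: algebra_simps)
    moreover have "((\<sigma> + z * g \<tau>) - (\<sigma>' + z * g \<tau>')) - z * (g \<tau> - g \<tau>') \<in> vanish S n"
      by (rule vdiff[OF subsetD[OF sub v] vO]) (use g h O_diff in blast)
    ultimately have "\<sigma> - \<sigma>' \<in> vanish S n" by (simp only:)
    then have s: "\<sigma> = \<sigma>'" using T h unfolding separated_def by blast
    have "z * (g \<tau> - g \<tau>') \<in> vanish S ?n'" using v s by (simp add: algebra_simps)
    then have "z * (g \<tau> - g \<tau>') / ?t ^ Suc (n R) \<in> R" using R unfolding vanish_def by force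
    then have "?t * (z * (g \<tau> - g \<tau>') / ?t ^ Suc (n R)) \<in> \<mm>" using m_mult2[OF t(1)] by blast
    moreover have "?t * (z * (g \<tau> - g \<tau>') / ?t ^ Suc (n R)) = (z / ?t ^ n R) * (g \<tau> - g \<tau>')" using t by simp
    ultimately have "(z / ?t ^ n R) * (g \<tau> - g \<tau>') \<in> \<mm>" by simp
    then have "g \<tau> - g \<tau>' \<in> \<mm>" using m_prime[of "z / ?t ^ n R" "g \<tau> - g \<tau>'"] z(3) g h OR O_diff by blast
    then show ?thesis using g_inj h s by blast
  qed
  have zz: "0 \<in> vanish S ?n'" unfolding vanish_def
  proof (intro CollectI ballI)
    fix R' assume R': "R' \<in> S"
    interpret R': place \<iota> R' by (rule finite_place_place[OF S(2)[OF R']])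
    show "0 / unif_at R' ^ ?n' R' \<in> R'" using R'.R_0 by simp
  qed
  have "inj_on ?f (T \<times> T0)"
  proof (rule inj_onI, clarify)
    fix \<sigma> \<tau> \<sigma>' \<tau>' assume "\<sigma> \<in> T" "\<tau> \<in> T0" "\<sigma>' \<in> T" "\<tau>' \<in> T0" "\<sigma> + z * g \<tau> = \<sigma>' + z * g \<tau>'"
    then show "\<sigma> = \<sigma>' \<and> \<tau> = \<tau>'" using key zz by simp
  qed
  then have "card (?f ` (T \<times> T0)) = card T * card T0" by (simp add: card_image card_cartesian_product)
  moreover have "separated (vanish S ?n') (?f ` (T \<times> T0))" unfolding separated_def
  proof (intro conjI ballI impI)
    show "finite (?f ` (T \<times> T0))" using T T0 unfolding separated_def transversal_def by blast
    show "?f ` (T \<times> T0) \<subseteq> \<O>" using T g z O_add O_mult unfolding separated_def by auto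
    fix a b assume "a \<in> ?f ` (T \<times> T0)" "b \<in> ?f ` (T \<times> T0)" "a - b \<in> vanish S ?n'"
    then show "a = b" using key by force
  qed
  ultimately show ?thesis using T0 by metis
qed

lemma separated_exists:
  assumes S: "finite S" "\<And>R. R \<in> S \<Longrightarrow> finite_place R"
  shows "\<exists>T. separated (vanish S n) T \<and> card T = CARD('k) ^ (\<Sum>R\<in>S. n R * place_degree \<iota> R)"
  using S
proof (induction S rule: finite_induct)
  case empty
  have "separated (vanish {} n) {0}" unfolding separated_def using O_0 by simp
  then show ?case by (intro exI[of _ "{0}"]) simp
next
  case (insert R S)
  have fp: "\<And>R'. R' \<in> insert R S \<Longrightarrow> finite_place R'" using insert.prems by blast
  have fin': "finite (insert R S)" using insert.hyps by simp
  \<comment> \<open>The order at R is raised from 0 to n R one step at a time, with the orders on S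
    kept fixed.\<close>
  have ind: "\<exists>T. separated (vanish (insert R S) (n(R := k))) T \<and>
      card T = CARD('k) ^ (k * place_degree \<iota> R + (\<Sum>R\<in>S. n R * place_degree \<iota> R))" for k
  proof (induction k)
    case 0
    obtain T where T: "separated (vanish S n) T" "card T = CARD('k) ^ (\<Sum>R\<in>S. n R * place_degree \<iota> R)"
      using insert by blast
    have "vanish (insert R S) (n(R := 0)) \<subseteq> vanish S n"
      using insert.hyps(2) unfolding vanish_def by (auto split: if_splits)
    then have "separated (vanish (insert R S) (n(R := 0))) T" using T(1) unfolding separated_def by blast
    moreover have "card T = CARD('k) ^ (0 * place_degree \<iota> R + (\<Sum>R\<in>S. n R * place_degree \<iota> R))"
      unfolding T(2) by simp
    ultimately show ?case by blast
  next
    case (Suc k)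
    then obtain T where T: "separated (vanish (insert R S) (n(R := k))) T"
      "card T = CARD('k) ^ (k * place_degree \<iota> R + (\<Sum>R\<in>S. n R * place_degree \<iota> R))" by blast
    have upd: "(n(R := k))(R := Suc ((n(R := k)) R)) = n(R := Suc k)" by simp
    obtain T' where T': "separated (vanish (insert R S) (n(R := Suc k))) T'" "card T' = card T * CARD('k) ^ place_degree \<iota> R"
      using separated_step[OF fin' _ insertI1 T(1)] fp unfolding upd by blast
    have "card T' = CARD('k) ^ (Suc k * place_degree \<iota> R + (\<Sum>R\<in>S. n R * place_degree \<iota> R))"
      unfolding T'(2) T(2) by (simp add: power_add)
    then show ?case using T'(1) by blast
  qed
  show ?case using ind[of "n R"] insert.hyps by simp
qed

text \<open>If \<open>h\<close> vanishes to order \<open>n\<close> on \<open>S\<close>, then a set separated by \<open>vanish S n\<close> is separated modulo \<open>h \<O>\<close>.\<close>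

lemma zero_degree_le:
  assumes S: "finite S" "\<And>R. R \<in> S \<Longrightarrow> finite_place R" and h: "h \<in> \<O>" "h \<noteq> 0"
    and v: "h \<in> vanish S n"
  shows "(\<Sum>R\<in>S. n R * place_degree \<iota> R) \<le> d h"
proof -
  obtain T where T: "separated (vanish S n) T" "card T = CARD('k) ^ (\<Sum>R\<in>S. n R * place_degree \<iota> R)"
    using separated_exists[OF S] by blast
  have hv: "h * g \<in> vanish S n" if "g \<in> \<O>" for g
    unfolding vanish_def
  proof (intro CollectI ballI)
    fix R' assume R': "R' \<in> S"
    interpret R': place \<iota> R' by (rule finite_place_place[OF S(2)[OF R']])
    have "h / unif_at R' ^ n R' \<in> R'" using v R' unfolding vanish_def by blast
    then have "(h / unif_at R' ^ n R') * g \<in> R'" using R'.R_mult that finite_place_O[OF S(2)[OF R']] by blast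
    then show "h * g / unif_at R' ^ n R' \<in> R'" by simp
  qed
  have "card T \<le> CARD('k) ^ d h"
  proof (rule separated_card_le[OF _ _ h])
    show "finite T" "T \<subseteq> \<O>" using T(1) unfolding separated_def by auto
    show "\<tau> = \<tau>'" if "\<tau> \<in> T" "\<tau>' \<in> T" "g \<in> \<O>" "\<tau> - \<tau>' = h * g" for \<tau> \<tau>' g
      using that hv T(1) unfolding separated_def by metis
  qed
  then show ?thesis unfolding T(2) by (simp only: Q_power_le)
qed

end

section \<open>The genus\<close>

context cubic_field
begin

lemma places_eq: "places \<iota> = insert Rinf {R. finite_place R}"
  unfolding places_def finite_place_def using Rinf_valuation infinite_place_unique by blast

lemma Rinf_not_finite: "\<not> finite_place Rinf"
  unfolding finite_place_def using x_notin_Rinf by blast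

lemma ord_ge_at:
  assumes "finite_place R" "z \<noteq> 0"
  shows "place_ord R z \<ge> int n \<longleftrightarrow> z / unif_at R ^ n \<in> R"
  using place.ord_ge_iff[OF finite_place_place[OF assms(1)] unif_at(2)[OF assms(1)] assms(2), of "int n"] by simp

lemma ord_nonneg_at: assumes "finite_place R" "z \<noteq> 0" shows "place_ord R z \<ge> 0 \<longleftrightarrow> z \<in> R"
  using ord_ge_at[OF assms, of 0] by simp

lemma ord_mult_at:
  assumes "finite_place R" "z \<noteq> 0" "w \<noteq> 0"
  shows "place_ord R (z * w) = place_ord R z + place_ord R w"
  using place.ord_mult[OF finite_place_place[OF assms(1)] unif_at(2)[OF assms(1)] assms(2,3)] .

lemma ord_Rinf:
  assumes "a \<in> \<O>" "b \<in> \<O>" "a \<noteq> 0" "b \<noteq> 0"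
  shows "place_ord Rinf (a / b) = int (d b) - int (d a)"
  using infinite_place.ord_quotient[OF infinite_place_Rinf assms] .

lemma degree_Rinf: "place_degree \<iota> Rinf = 1"
  by (rule infinite_place.degree_1[OF infinite_place_Rinf])

lemma riemann_roch_space_iff:
  "z \<in> riemann_roch_space \<iota> D \<longleftrightarrow> z = 0 \<or> (place_ord Rinf z + D Rinf \<ge> 0 \<and> (\<forall>R. finite_place R \<longrightarrow> place_ord R z + D R \<ge> 0))"
  unfolding riemann_roch_space_def places_eq by auto

text \<open>Every zero contributes at least 1 to a sum of degrees that \<open>zero_degree_le\<close>
  bounds by d h.\<close>

lemma finite_zeros: assumes h: "h \<in> \<O>" "h \<noteq> 0"
  shows "finite {R. finite_place R \<and> h \<in> max_ideal R}"
proof (rule finite_if_finite_subsets_card_bdd[THEN conjunct1])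
  fix F assume F: "F \<subseteq> {R. finite_place R \<and> h \<in> max_ideal R}" "finite F"
  have fp: "\<And>R. R \<in> F \<Longrightarrow> finite_place R" using F by blast
  have "h \<in> vanish F (\<lambda>_. 1)" unfolding vanish_def
  proof (intro CollectI ballI)
    fix R assume R: "R \<in> F"
    interpret place \<iota> R by (rule finite_place_place[OF fp[OF R]])
    have "h \<in> \<mm>" using F R by blast
    then obtain c where "c \<in> R" "h = unif_at R * c" using unif_m[OF unif_at(2)[OF fp[OF R]]] by auto
    then show "h / unif_at R ^ 1 \<in> R" using unif_at_m(2)[OF fp[OF R]] by simp
  qed
  then have "(\<Sum>R\<in>F. 1 * place_degree \<iota> R) \<le> d h" using zero_degree_le[OF F(2) _ h] fp by blast
  moreover have "(\<Sum>R\<in>F. 1) \<le> (\<Sum>R\<in>F. 1 * place_degree \<iota> R)"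
    using finite_place_degree_pos fp by (intro sum_mono) (simp add: Suc_leI)
  ultimately show "card F \<le> d h" by simp
qed

lemma vanish_0: "(\<And>R. R \<in> S \<Longrightarrow> finite_place R) \<Longrightarrow> 0 \<in> vanish S n"
  unfolding vanish_def using place.R_0[OF finite_place_place] by auto

lemma vanish_add:
  assumes "\<And>R. R \<in> S \<Longrightarrow> finite_place R" "a \<in> vanish S n" "b \<in> vanish S n"
  shows "a + b \<in> vanish S n"
  unfolding vanish_def using assms place.R_add[OF finite_place_place] unfolding vanish_def
  by (auto simp: add_divide_distrib)

lemma vanish_scale:
  assumes "\<And>R. R \<in> S \<Longrightarrow> finite_place R" "a \<in> vanish S n"
  shows "\<iota> c * a \<in> vanish S n"
  unfolding vanish_def
proof (intro CollectI ballI)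
  fix R assume R: "R \<in> S"
  interpret place \<iota> R by (rule finite_place_place) (use assms R in blast)
  have "a / unif_at R ^ n R \<in> R" using assms R unfolding vanish_def by blast
  then show "\<iota> c * a / unif_at R ^ n R \<in> R" using R_mult[OF R_iota[of c], of "a / unif_at R ^ n R"] by simp
qed

lemma divisor_degree_eq:
  assumes D: "D \<in> divisors \<iota>" and S: "finite S" "\<And>R. R \<in> S \<Longrightarrow> finite_place R"
    and supp: "\<And>R. finite_place R \<Longrightarrow> D R \<noteq> 0 \<Longrightarrow> R \<in> S"
  shows "divisor_degree \<iota> D = D Rinf + (\<Sum>R\<in>S. D R * int (place_degree \<iota> R))"
proof -
  have "Rinf \<notin> S" using S(2) Rinf_not_finite by blast
  moreover have "(\<Sum>R | D R \<noteq> 0. D R * int (place_degree \<iota> R)) = (\<Sum>R\<in>insert Rinf S. D R * int (place_degree \<iota> R))"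
  proof (rule sum.mono_neutral_left)
    show "{R. D R \<noteq> 0} \<subseteq> insert Rinf S" using D supp unfolding divisors_def places_eq by blast
  qed (use S in auto)
  ultimately show ?thesis unfolding divisor_degree_def using S(1) degree_Rinf by simp
qed

text \<open>Multiplication by a suitable \<open>h \<in> \<O>\<close> moves the poles allowed by \<open>D\<close> to infinity.\<close>

lemma riemann_roch_space_shift:
  assumes D: "D \<in> divisors \<iota>"
  shows "\<exists>N S n h. 2 * m \<le> N \<and> finite S \<and> (\<forall>R\<in>S. finite_place R) \<and> h \<noteq> 0 \<and>
    (\<forall>z. z \<in> riemann_roch_space \<iota> D \<longleftrightarrow> z * h \<in> L N \<inter> vanish S n) \<and>
    divisor_degree \<iota> D \<le> int N - int (\<Sum>R\<in>S. n R * place_degree \<iota> R)"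
proof -
  define S0 where "S0 = {R. finite_place R \<and> D R \<noteq> 0}"
  have finD: "finite {R. D R \<noteq> 0}" using D unfolding divisors_def by blast
  have finS0: "finite S0" unfolding S0_def by (rule finite_subset[OF _ finD]) blast
  define h0 where "h0 = (\<Prod>R\<in>S0. unif_at R ^ nat (D R))"
  \<comment> \<open>The power of x adds 3 j to the pole order of h at infinity, which outweighs a
    negative D Rinf and brings N up to at least 2 m, the range of \<open>card_L\<close>.\<close>
  define j where "j = 2 * m + nat \<bar>D Rinf\<bar>"
  define h where "h = x ^ j * h0"
  have h0O: "h0 \<in> \<O>" unfolding h0_def using unif_at(1) by (intro O_prod O_power) (auto simp: S0_def)
  have h0nz: "h0 \<noteq> 0" unfolding h0_def using unif_at_m(2) finS0 by (auto simp: S0_def)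
  have hO: "h \<in> \<O>" and hnz: "h \<noteq> 0" unfolding h_def using h0O h0nz x_nz O_x O_power O_mult by auto
  have dxj: "d (x ^ k) = 3 * k" for k
    using d_e[of "monom 1 k"] by (simp add: e_monom degree_monom_eq)
  have dh: "d h = 3 * j + d h0" unfolding h_def using d_mult[of "x ^ j" h0] O_x O_power h0O h0nz x_nz dxj by simp
  define N where "N = nat (D Rinf + int (d h))"
  have "int j \<ge> int (2 * m)" "int j \<ge> - D Rinf" unfolding j_def by linarith+
  then have "D Rinf + int (d h) \<ge> int (2 * m)" unfolding dh by linarith
  then have N: "int N = D Rinf + int (d h)" "2 * m \<le> N" unfolding N_def by linarith+
  define S where "S = S0 \<union> {R. finite_place R \<and> h \<in> max_ideal R}"
  have finS: "finite S" unfolding S_def using finS0 finite_zeros[OF hO hnz] by blast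
  have fp: "\<And>R. R \<in> S \<Longrightarrow> finite_place R" unfolding S_def S0_def by blast
  define v where "v R = place_ord R h" for R
  have v0: "v R \<ge> 0" if "finite_place R" for R
    unfolding v_def using ord_nonneg_at[OF that hnz] finite_place_O[OF that] hO by blast
  have vD: "v R \<ge> D R" if R: "finite_place R" for R
  proof (cases "D R > 0")
    case True
    then have RS: "R \<in> S0" unfolding S0_def using R by simp
    have "h0 = unif_at R ^ nat (D R) * (\<Prod>R\<in>S0 - {R}. unif_at R ^ nat (D R))"
      unfolding h0_def by (rule prod.remove[OF finS0 RS])
    then have "h / unif_at R ^ nat (D R) = x ^ j * (\<Prod>R\<in>S0 - {R}. unif_at R ^ nat (D R))"
      unfolding h_def using unif_at_m(2)[OF R] by simp
    moreover have "x ^ j * (\<Prod>R\<in>S0 - {R}. unif_at R ^ nat (D R)) \<in> \<O>"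
      using unif_at(1) by (intro O_mult O_prod O_power O_x) (auto simp: S0_def)
    ultimately have "h / unif_at R ^ nat (D R) \<in> R" using finite_place_O[OF R] by auto
    then show ?thesis unfolding v_def using ord_ge_at[OF R hnz, of "nat (D R)"] True by simp
  next
    case False
    then show ?thesis using v0[OF R] by linarith
  qed
  have out: "v R = 0 \<and> D R = 0" if R: "finite_place R" "R \<notin> S" for R
  proof -
    interpret place \<iota> R by (rule finite_place_place[OF R(1)])
    have "h \<in> R - \<mm>" using R finite_place_O[OF R(1)] hO unfolding S_def by blast
    then have "v R = 0" unfolding v_def using place_ord_eq[OF unif_at(2)[OF R(1)], of h h 0] by simp
    then show ?thesis using R unfolding S_def S0_def by blast
  qed
  \<comment> \<open>z h has to vanish to order v R - D R at R. By \<open>vD\<close> this is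
    nonnegative, so the truncation by nat changes nothing at finite places.\<close>
  define n where "n R = nat (v R - D R)" for R
  have zero: "(\<Sum>R\<in>S. nat (v R) * place_degree \<iota> R) \<le> d h"
  proof (rule zero_degree_le[OF finS fp hO hnz])
    show "h \<in> vanish S (\<lambda>R. nat (v R))" unfolding vanish_def
    proof (intro CollectI ballI)
      fix R assume "R \<in> S"
      then show "h / unif_at R ^ nat (v R) \<in> R"
        using ord_ge_at[OF fp hnz, of R "nat (v R)"] v0[OF fp] unfolding v_def by simp
    qed
  qed
  have deg: "divisor_degree \<iota> D = D Rinf + (\<Sum>R\<in>S. D R * int (place_degree \<iota> R))"
    by (rule divisor_degree_eq[OF D finS fp]) (auto simp: S_def S0_def)
  have "int (\<Sum>R\<in>S. n R * place_degree \<iota> R) = (\<Sum>R\<in>S. (v R - D R) * int (place_degree \<iota> R))"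
    unfolding of_nat_sum by (rule sum.cong) (use vD fp in \<open>auto simp: n_def\<close>)
  also have "\<dots> = (\<Sum>R\<in>S. v R * int (place_degree \<iota> R)) - (\<Sum>R\<in>S. D R * int (place_degree \<iota> R))"
    by (simp add: left_diff_distrib sum_subtractf)
  also have "(\<Sum>R\<in>S. v R * int (place_degree \<iota> R)) = int (\<Sum>R\<in>S. nat (v R) * place_degree \<iota> R)"
    unfolding of_nat_sum by (rule sum.cong) (use v0 fp in auto)
  finally have degle: "divisor_degree \<iota> D \<le> int N - int (\<Sum>R\<in>S. n R * place_degree \<iota> R)"
    using zero deg N(1) by linarith
  have "z \<in> riemann_roch_space \<iota> D \<longleftrightarrow> z * h \<in> L N \<inter> vanish S n" for z
  proof (cases "z = 0")
    case True
    then show ?thesis using L_0 vanish_0[OF fp] unfolding riemann_roch_space_iff by auto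
  next
    case False
    then have wnz: "z * h \<noteq> 0" using hnz by simp
    have ord: "place_ord R (z * h) = place_ord R z + v R" if "finite_place R" for R
      unfolding v_def by (rule ord_mult_at[OF that False hnz])
    have inf: "place_ord Rinf z = int (d h) - int (d (z * h))" if "z * h \<in> \<O>"
      using ord_Rinf[OF that hO wnz hnz] hnz by simp
    show ?thesis
    proof
      assume "z \<in> riemann_roch_space \<iota> D"
      then have z: "place_ord Rinf z + D Rinf \<ge> 0" "\<And>R. finite_place R \<Longrightarrow> place_ord R z + D R \<ge> 0"
        unfolding riemann_roch_space_iff using False by auto
      have "z * h \<in> R" if R: "finite_place R" for R
        using ord_nonneg_at[OF R wnz] ord[OF R] z(2)[OF R] vD[OF R] by linarith
      then have wO: "z * h \<in> \<O>" by (rule integrally_closed)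
      have "d (z * h) \<le> N" using inf[OF wO] z(1) N(1) by linarith
      then have "z * h \<in> L N" using wO unfolding L_def by blast
      moreover have "z * h \<in> vanish S n" unfolding vanish_def
      proof (intro CollectI ballI)
        fix R assume R: "R \<in> S"
        have "place_ord R (z * h) \<ge> int (n R)"
          using ord[OF fp[OF R]] z(2)[OF fp[OF R]] vD[OF fp[OF R]] unfolding n_def by linarith
        then show "z * h / unif_at R ^ n R \<in> R" using ord_ge_at[OF fp[OF R] wnz] by blast
      qed
      ultimately show "z * h \<in> L N \<inter> vanish S n" by blast
    next
      assume w: "z * h \<in> L N \<inter> vanish S n"
      then have wO: "z * h \<in> \<O>" and dw: "d (z * h) \<le> N" using wnz unfolding L_def by auto
      have "place_ord R z + D R \<ge> 0" if R: "finite_place R" for R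
      proof (cases "R \<in> S")
        case True
        then have "z * h / unif_at R ^ n R \<in> R" using w unfolding vanish_def by blast
        then have "place_ord R (z * h) \<ge> int (n R)" using ord_ge_at[OF R wnz] by blast
        then show ?thesis using ord[OF R] unfolding n_def by linarith
      next
        case False
        have "z * h \<in> R" using wO finite_place_O[OF R] by blast
        then have "place_ord R (z * h) \<ge> 0" using ord_nonneg_at[OF R wnz] by blast
        then show ?thesis using ord[OF R] out[OF R False] by simp
      qed
      moreover have "place_ord Rinf z + D Rinf \<ge> 0" using inf[OF wO] dw N(1) by linarith
      ultimately show "z \<in> riemann_roch_space \<iota> D" unfolding riemann_roch_space_iff by blast
    qed
  qed
  then show ?thesis using N(2) finS fp hnz degle by blast
qed

text \<open>L(N) has dimension N + 2 - m and the vanishing conditions cost at most the sum of n R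
  deg R. So l(D) is at least N + 2 - m minus that sum, which is at least deg D + 2 - m.\<close>

lemma riemann_inequality:
  assumes D: "D \<in> divisors \<iota>"
  shows "divisor_degree \<iota> D - int (riemann_roch_dim \<iota> D) + 1 \<le> int m - 1"
proof -
  obtain N S n h where N: "2 * m \<le> N" and S: "finite S" "\<And>R. R \<in> S \<Longrightarrow> finite_place R" and h: "h \<noteq> 0"
    and sp: "\<And>z. z \<in> riemann_roch_space \<iota> D \<longleftrightarrow> z * h \<in> L N \<inter> vanish S n"
    and deg: "divisor_degree \<iota> D \<le> int N - int (\<Sum>R\<in>S. n R * place_degree \<iota> R)"
    using riemann_roch_space_shift[OF D] by blast
  let ?V = "riemann_roch_space \<iota> D" and ?J = "L N \<inter> vanish S n"
  interpret vs: vector_space "\<lambda>a z. \<iota> a * z" by (rule vs)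
  have img: "?V = (\<lambda>w. w / h) ` ?J"
  proof
    show "?V \<subseteq> (\<lambda>w. w / h) ` ?J"
    proof
      fix z assume "z \<in> ?V"
      then have "z * h \<in> ?J" using sp by blast
      moreover have "z = (z * h) / h" using h by simp
      ultimately show "z \<in> (\<lambda>w. w / h) ` ?J" by (rule rev_image_eqI)
    qed
    show "(\<lambda>w. w / h) ` ?J \<subseteq> ?V"
    proof (rule image_subsetI)
      fix w assume "w \<in> ?J"
      moreover have "w / h * h = w" using h by simp
      ultimately show "w / h \<in> ?V" unfolding sp by (simp only:)
    qed
  qed
  have "finite ?J" using finite_L by blast
  then have finV: "finite ?V" unfolding img by (rule finite_imageI)
  have "inj_on (\<lambda>w. w / h) ?J" using h by (auto simp: inj_on_def)
  then have cardV: "card ?V = card ?J" unfolding img by (rule card_image)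
  have "vs.subspace ?V"
  proof (rule vs.subspaceI)
    show "0 \<in> ?V" unfolding riemann_roch_space_iff by simp
    show "a + b \<in> ?V" if "a \<in> ?V" "b \<in> ?V" for a b
      using that L_add vanish_add[OF S(2)] unfolding sp by (simp add: distrib_right)
    show "\<iota> c * a \<in> ?V" if "a \<in> ?V" for c a
      using that L_mult_iota[of "a * h" N c] vanish_scale[OF S(2), where a = "a * h" and n = n and c = c] unfolding sp by (simp add: mult.assoc)
  qed
  then have dim: "card ?V = CARD('k) ^ riemann_roch_dim \<iota> D"
    unfolding riemann_roch_dim_def by (rule card_subspace[OF finV])
  have "card (L N) \<le> card ?J * CARD('k) ^ (\<Sum>R\<in>S. n R * place_degree \<iota> R)"
  proof (rule vanish_card_le[OF S(1) _ finite_L])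
    show "L N \<subseteq> \<O>" using L_O by blast
  qed (use S(2) L_diff in auto)
  then have "CARD('k) ^ (N + 2 - m) \<le> CARD('k) ^ (riemann_roch_dim \<iota> D + (\<Sum>R\<in>S. n R * place_degree \<iota> R))"
    unfolding card_L(1)[OF N] cardV[symmetric] dim by (simp add: power_add)
  then have "N + 2 - m \<le> riemann_roch_dim \<iota> D + (\<Sum>R\<in>S. n R * place_degree \<iota> R)"
    by (simp only: Q_power_le)
  then show ?thesis using deg N by linarith
qed

text \<open>D is 2 m times the place at infinity, the smallest multiple covered by
  \<open>card_L\<close>. By \<open>integrally_closed\<close> its space is L(2 m), of dimension m +
  2.\<close>

lemma riemann_equality:
  "\<exists>D\<in>divisors \<iota>. int m - 1 = divisor_degree \<iota> D - int (riemann_roch_dim \<iota> D) + 1"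
proof -
  define D where "D R = (if R = Rinf then int (2 * m) else 0)" for R
  have supp: "{R. D R \<noteq> 0} = {Rinf}" unfolding D_def using m1 by auto
  have D: "D \<in> divisors \<iota>" unfolding divisors_def places_eq using supp by simp
  have deg: "divisor_degree \<iota> D = int (2 * m)"
    unfolding divisor_degree_def supp using degree_Rinf by (simp add: D_def)
  interpret vs: vector_space "\<lambda>a z. \<iota> a * z" by (rule vs)
  have ninf: "R \<noteq> Rinf" if "finite_place R" for R using that Rinf_not_finite by blast
  have ordinf: "place_ord Rinf z = - int (d z)" if "z \<in> \<O>" "z \<noteq> 0" for z
    using ord_Rinf[OF that(1) O_1 that(2)] d_iota[of 1] by simp
  have V: "riemann_roch_space \<iota> D = L (2 * m)"
  proof (intro set_eqI)
    fix z show "z \<in> riemann_roch_space \<iota> D \<longleftrightarrow> z \<in> L (2 * m)"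
    proof (cases "z = 0")
      case True then show ?thesis using L_0 unfolding riemann_roch_space_iff by simp
    next
      case False
      have "(\<forall>R. finite_place R \<longrightarrow> place_ord R z + D R \<ge> 0) \<longleftrightarrow> (\<forall>R. finite_place R \<longrightarrow> z \<in> R)"
        using ord_nonneg_at[OF _ False] ninf unfolding D_def by auto
      also have "\<dots> \<longleftrightarrow> z \<in> \<O>" using integrally_closed finite_place_O by blast
      finally show ?thesis using False ordinf[of z] unfolding riemann_roch_space_iff L_def D_def by auto
    qed
  qed
  have "vs.subspace (L (2 * m))"
    by (rule vs.subspaceI) (use L_0 L_add L_mult_iota in auto)
  then have "CARD('k) ^ riemann_roch_dim \<iota> D = card (L (2 * m))"
    unfolding riemann_roch_dim_def V using card_subspace[OF finite_L] by simp
  also have "\<dots> = CARD('k) ^ (2 * m + 2 - m)" by (rule card_L) simp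
  finally have "riemann_roch_dim \<iota> D = m + 2" unfolding Q_power_inj by simp
  then have "int m - 1 = divisor_degree \<iota> D - int (riemann_roch_dim \<iota> D) + 1" unfolding deg by simp
  then show ?thesis using D by blast
qed

lemma genus_eq: "genus \<iota> = int m - 1"
  unfolding genus_def
  by (rule Greatest_equality) (use riemann_equality riemann_inequality in auto)

end

theorem theorem1p1:
  fixes p r q :: nat
    and \<iota> :: "'k::field \<Rightarrow> 'f::field"
    and x y :: 'f
  assumes "prime p" and "p \<ge> 5" and "[int p = -1] (mod 3)" and "r \<ge> 1" and "q = p ^ r"
    and "CARD('k) = q ^ 6"
    and "curve_C q \<iota> x y"
  shows "real_of_int (genus \<iota>) = (real q ^ 2 - 1) / 2
    \<and> int (num_rational_points \<iota>) =
        int q ^ 6 + 1 + (-1) ^ (r + 1) * (int q ^ 2 - 1) * int q ^ 3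
    \<and> (odd r \<longrightarrow> maximal_curve \<iota>)
    \<and> (even r \<longrightarrow> minimal_curve \<iota>)"
proof -
  define m where "m = (q ^ 2 + 1) div 2"
  have p3: "p mod 3 = 2"
  proof -
    have "int p mod 3 = 2" using assms(3) by (simp add: cong_def)
    then show ?thesis by presburger
  qed
  have oddp: "odd p" using assms(1,2) prime_odd_nat[of p] by linarith
  have cardk: "CARD('k) = p ^ (6 * r)" unfolding assms(6,5) by (simp add: mult.commute flip: power_mult)
  have q5: "q \<ge> 5" using assms(2,4) self_le_power[of p r] unfolding assms(5) by linarith
  have q25: "q ^ 2 \<ge> 25" using power_mono[OF q5, of 2] by simp
  have oddq: "odd (q ^ 2)" using oddp unfolding assms(5) by simp
  then have two_m: "2 * m = q ^ 2 + 1" unfolding m_def by presburger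
  have q3: "q ^ 2 mod 3 = 1"
  proof -
    have "[p ^ 2 = 1] (mod 3)" using cong_pow[of p 2 3 2] p3 by (simp add: cong_def)
    from cong_pow[OF this, of r] show ?thesis unfolding assms(5) by (simp add: cong_def mult.commute flip: power_mult)
  qed
  have fin: "finite (UNIV :: 'k set)"
    using assms(6) q5 by (metis card.infinite power_not_zero not_numeral_le_zero)
  interpret cf: const_field \<iota>
    by unfold_locales (use assms(7) fin in \<open>auto simp: curve_C_def\<close>)
  have ch: "CHAR('k) = p" by (rule CHAR_eq_of_card_power[OF assms(1) cardk])
  \<comment> \<open>Since q^2 vanishes in characteristic p, 2 m = q^2 + 1 becomes 1 in the function
    field.\<close>
  have "p dvd q ^ 2" using assms(4) unfolding assms(5) by (simp flip: power_mult)
  then have "(of_nat (q ^ 2) :: 'k) = 0" by (simp only: of_nat_eq_0_iff_char_dvd ch)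
  then have q2F: "(of_nat (q ^ 2) :: 'f) = 0" by (metis cf.iota_of_nat cf.iota_0)
  have "(of_nat (2 * m) :: 'f) = 1" unfolding two_m using q2F by simp
  then have m2F: "2 * of_nat m = (1 :: 'f)" by simp
  have "\<not> p dvd 3" using assms(2) by (auto dest: dvd_imp_le)
  then have "(of_nat 3 :: 'k) \<noteq> 0" using of_nat_eq_0_iff_char_dvd[where 'a = 'k, of 3] ch by metis
  then have three: "(3 :: 'k) \<noteq> 0" by simp
  interpret cubic_field \<iota> p "6 * r" m x y
  proof unfold_locales
    show "m mod 3 = 1" using two_m q3 by presburger
    show "m > 1" using two_m q25 by linarith
    show "y ^ 3 = x ^ m + x" "adjoin \<iota> {x, y} = UNIV" "transcendental_over \<iota> x"
      using assms(7) unfolding curve_C_def m_def by blast+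
  qed (fact assms(1) cardk m2F three)+
  have g: "2 * genus \<iota> = int q ^ 2 - 1"
  proof -
    have "int (2 * m) = int (q ^ 2 + 1)" by (rule arg_cong[OF two_m])
    then show ?thesis unfolding genus_eq by simp
  qed
  then have g_real: "2 * real_of_int (genus \<iota>) = real q ^ 2 - 1"
    by (metis of_int_1 of_int_diff of_int_mult of_int_numeral of_int_of_nat_eq of_int_power)
  have N: "int (num_rational_points \<iota>) = int q ^ 6 + 1 + (-1) ^ (r + 1) * (int q ^ 2 - 1) * int q ^ 3"
    using affine_point_count[OF assms(1,2) p3 assms(4,5,6)] unfolding num_rational_points_eq m_def[symmetric] by simp
  have "CARD('k) = (q ^ 3) ^ 2" unfolding assms(6) by (simp flip: power_mult)
  then have square: "\<exists>s. CARD('k) = s ^ 2" by blast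
  have "sqrt (real q ^ 6) = sqrt ((real q ^ 3) ^ 2)" by (subst power_mult[symmetric]) simp
  then have sqrt: "sqrt (real q ^ 6) = real q ^ 3" unfolding real_sqrt_abs by simp
  have cardr: "real CARD('k) = real q ^ 6" unfolding assms(6) by simp
  have N_real: "real (num_rational_points \<iota>) = real q ^ 6 + 1 + (-1) ^ (r + 1) * (real q ^ 2 - 1) * real q ^ 3"
    using arg_cong[OF N, of real_of_int] by simp
  \<comment> \<open>As 2 g = q^2 - 1 and the square root of q^6 is q^3, the deviation from q^6 + 1
    is (-1)^(r + 1) times 2 g q^3, and the parity of r selects the sign.\<close>
  have "maximal_curve \<iota>" if "odd r"
    unfolding maximal_curve_def cardr sqrt g_real by (intro conjI fin square) (use that N_real in simp)
  moreover have "minimal_curve \<iota>" if "even r"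
    unfolding minimal_curve_def cardr sqrt g_real by (intro conjI fin square) (use that N_real in \<open>simp add: algebra_simps\<close>)
  ultimately show ?thesis using g_real N by auto
qed

end
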